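(* There are absolute constants $C$ and $p_0$ such that the following holds for every prime $p\ge p_0$. Let $A$ be a zero-sum-free subset of $\mathbf{Z}_p$ of size at least $0.99\,(2p)^{1/2}$. Then there is some non-zero element $b \in \mathbf{Z}_p$ such that $$\sum_{a \in bA,\ a < p/2} \|a\| \le p + C p^{1/2} \qquad\text{and}\qquad \sum_{a \in bA,\ a > p/2} \|a\| \le C p^{1/2}.$$
   Context: $\mathbf{Z}_p$ is the field of integers modulo the prime $p$; its elements are identified with the integers $0,1,\dots,p-1$ when writing $a<p/2$ or $a>p/2$. For $x\in\mathbf{Z}_p$, the norm $\|x\|$ is the distance from $x$ to $0$, i.e. $\|x\|=\min(x,p-x)$ for the representative $x\in\{0,\dots,p-1\}$. $bA=\{ba : a\in A\}$. For $A \subset \mathbf{Z}_p$, $S_A = \{\sum_{x \in B} x : \emptyset \ne B \subset A\}$, and $A$ is zero-sum-free if $0\notin S_A$. *)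

theory Defs
  imports Complex_Main "HOL-Number_Theory.Residues"
begin

text \<open>The field of integers modulo \<open>p\<close> is \<open>residue_ring (int p)\<close>, whose carrier consists of the
  integers \<open>0, \<dots>, p - 1\<close>; so elements are their own representatives.\<close>

abbreviation Zmod :: "nat \<Rightarrow> int ring" where
  "Zmod p \<equiv> residue_ring (int p)"

definition subset_sums :: "nat \<Rightarrow> int set \<Rightarrow> int set" where
  "subset_sums p A = {finsum (Zmod p) (\<lambda>x. x) B | B. B \<noteq> {} \<and> B \<subseteq> A}"

definition zero_sum_free :: "nat \<Rightarrow> int set \<Rightarrow> bool" where
  "zero_sum_free p A \<longleftrightarrow> \<zero>\<^bsub>Zmod p\<^esub> \<notin> subset_sums p A"

definition dilate :: "nat \<Rightarrow> int \<Rightarrow> int set \<Rightarrow> int set" where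
  "dilate p b A = {b \<otimes>\<^bsub>Zmod p\<^esub> a | a. a \<in> A}"

text \<open>Meaningful for \<open>x\<close> in the carrier only.\<close>

definition residue_norm :: "nat \<Rightarrow> int \<Rightarrow> int" where
  "residue_norm p x = min x (int p - x)"

end

theory Submission
  imports Defs
begin

text \<open>
  Adding an element \<open>e\<close> to \<open>B\<close> enlarges the set \<open>X\<close> of subset sums of \<open>B\<close> by \<open>\<lambda>\<^sub>X(e) = |(X + e) \<setminus> X|\<close>, and
  \<open>\<lambda>\<^sub>X\<close> is subadditive. As \<open>|X| \<le> p\<close>, adding few elements of \<open>A\<close> greedily reaches a set \<open>X\<close> of positive
  density and co-density with \<open>\<lambda>\<^sub>X(e) = O(p\<^sup>1\<^sup>/\<^sup>2)\<close> for all remaining \<open>e\<close>. Then \<open>X\<close> is almost invariant under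
  the multiples \<open>i e\<close> with \<open>i \<le> c p\<^sup>1\<^sup>/\<^sup>2\<close>, and Parseval's identity yields a frequency \<open>\<xi>\<close> such that almost all \<open>e \<xi>\<close>
  have norm \<open>O(p\<^sup>1\<^sup>/\<^sup>2)\<close>.

  So almost all of a dilate of \<open>A\<close> is a dense set of integers in an interval of length \<open>O(p\<^sup>1\<^sup>/\<^sup>2)\<close>. A small part of
  such a set has among its subset sums a progression of bounded difference \<open>d\<close>, longer than every
  element, where \<open>d\<close> divides almost all elements. The other elements prolong the progression, which has
  fewer than \<open>p\<close> terms, so after dividing by \<open>d\<close> the norms add up to less than \<open>p\<close>. A second application
  then has \<open>d = 1\<close>, and as the resulting interval avoids \<open>0\<close>, the elements of one sign, say the negative
  ones, have small total norm. The positive ones are about \<open>0.98 (2p)\<^sup>1\<^sup>/\<^sup>2\<close> distinct integers of sum less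
  than \<open>p\<close>, so few integers up to \<open>p\<^sup>1\<^sup>/\<^sup>2\<close> are missing. Sums of two of them fill an interval starting at
  \<open>O(p\<^sup>1\<^sup>/\<^sup>2)\<close>, all other positive elements of the dilate prolong it, and both bounds follow from the fact that
  no subset sum is divisible by \<open>p\<close>.
\<close>

section \<open>Subset sums and Olson's function\<close>

text \<open>The constants serve one comparison. Since 0.99 * sqrt 2 exceeds 1.4 and the losses on
  the way total less than 0.01 sqrt p, at least 1.39 sqrt p positive elements survive. Their least
  possible sum is about 0.966 p, and the slack below p is what limits the missing integers to 0.08
  sqrt p. The obstacle is that Fourier analysis only confines the dilate to norms up to
  \<open>K\<close> sqrt p with a huge \<open>K\<close>, too weak for such a comparison, and that the
  frequency may be off by a factor: the elements found could all be multiples of some bounded d. The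
  progression repairs both, as its being shorter than p turns the crude bound into the sharp total p
  after division by d. Given that total, at least sqrt p elements cannot share a divisor d > 1,
  because their distinct norms would add up to at least d p / 2. The first round may lose a fixed
  fraction of the elements; the second must lose only about a 1 / \<open>K\<close> fraction, because
  each lost element may have norm \<open>K\<close> sqrt p.\<close>

definition zsf :: "int \<Rightarrow> int set \<Rightarrow> bool" where
  "zsf p A \<longleftrightarrow> finite A \<and> (\<forall>B\<subseteq>A. B \<noteq> {} \<longrightarrow> \<not> p dvd \<Sum>B)"

text \<open>The empty sum is included, so that adding \<open>a\<close> to \<open>B\<close> unites
  the set with its translate by \<open>a\<close>, and \<open>lam\<close> is exactly the
  gain.\<close>

definition sums_mod :: "int \<Rightarrow> int set \<Rightarrow> int set" where
  "sums_mod p B = (\<lambda>C. \<Sum>C mod p) ` Pow B"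

text \<open>Olson's function, usually written \<open>\<lambda>\<^sub>X(d)\<close>.\<close>

definition lam :: "int \<Rightarrow> int set \<Rightarrow> int \<Rightarrow> nat" where
  "lam p X d = card {x \<in> X. (x + d) mod p \<notin> X}"

lemma inj_on_shift_mod:
  fixes p d :: int
  assumes "X \<subseteq> {0..<p}"
  shows "inj_on (\<lambda>x. (x + d) mod p) X"
proof (rule inj_onI)
  fix x y assume xy: "x \<in> X" "y \<in> X" and "(x + d) mod p = (y + d) mod p"
  then have "p dvd (x + d) - (y + d)" by (simp add: mod_eq_dvd_iff)
  then have "p dvd x - y" by simp
  then have "x mod p = y mod p" by (simp add: mod_eq_dvd_iff)
  then show "x = y" using xy assms by (metis atLeastLessThan_iff mod_pos_pos_trivial subsetD)
qed

lemma lam_mod: "lam p X (d mod p) = lam p X d"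
  by (simp add: lam_def mod_simps)

lemma lam_cong: "a mod p = b mod p \<Longrightarrow> lam p X a = lam p X b"
  by (metis lam_mod)

lemma lam_le_card: "finite X \<Longrightarrow> lam p X d \<le> card X"
  unfolding lam_def by (intro card_mono) auto

lemma lam_0: "X \<subseteq> {0..<p} \<Longrightarrow> lam p X 0 = 0"
proof -
  assume X: "X \<subseteq> {0..<p}"
  have "x mod p = x" if "x \<in> X" for x using X that by auto
  then have "{x \<in> X. (x + 0) mod p \<notin> X} = {}" by simp
  then show ?thesis by (simp only: lam_def card.empty)
qed

lemma finite_resid: "X \<subseteq> {0..<p::int} \<Longrightarrow> finite X"
  using finite_subset by blast

text \<open>A point that leaves \<open>X\<close> under \<open>a + b\<close> either leaves it under
  \<open>a\<close> (\<open>?U\<close>), or stays and leaves under the following \<open>b\<close>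
  (\<open>?V\<close>). The shift by \<open>a\<close> maps \<open>?V\<close> injectively into the
  points counted by \<open>lam p X b\<close>.\<close>

lemma lam_add:
  assumes X: "X \<subseteq> {0..<p}"
  shows "lam p X (a + b) \<le> lam p X a + lam p X b"
proof -
  let ?f = "\<lambda>x. (x + a) mod p"
  let ?U = "{x \<in> X. (x + a) mod p \<notin> X}"
  let ?V = "{x \<in> X. ?f x \<in> X \<and> (?f x + b) mod p \<notin> X}"
  have fin: "finite X" using X finite_resid by blast
  have "lam p X (a + b) \<le> card (?U \<union> ?V)"
    unfolding lam_def using fin by (intro card_mono) (auto simp: mod_simps add.assoc)
  also have "\<dots> \<le> card ?U + card ?V" by (rule card_Un_le)
  also have "card ?V = card (?f ` ?V)"
    by (rule card_image[symmetric], rule inj_on_subset[OF inj_on_shift_mod[OF X]]) auto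
  also have "\<dots> \<le> lam p X b"
    unfolding lam_def using fin by (intro card_mono) auto
  finally show ?thesis by (simp add: lam_def)
qed

text \<open>The shift by \<open>a\<close> maps \<open>?U\<close> injectively into \<open>?V\<close>;
  \<open>lam\<close> counts the complements of these two sets in \<open>X\<close>.\<close>

lemma lam_minus_le:
  assumes X: "X \<subseteq> {0..<p}"
  shows "lam p X (- a) \<le> lam p X a"
proof -
  let ?f = "\<lambda>x. (x + a) mod p"
  have fin: "finite X" using X finite_resid by blast
  let ?U = "{x \<in> X. ?f x \<in> X}" and ?V = "{x \<in> X. (x + - a) mod p \<in> X}"
  have *: "(x + a - a) mod p = x" if "x \<in> X" for x using X that by auto
  have "card ?U = card (?f ` ?U)"
    by (rule card_image[symmetric], rule inj_on_subset[OF inj_on_shift_mod[OF X]]) auto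
  also have "\<dots> \<le> card ?V"
  proof (rule card_mono)
    show "finite ?V" using fin by simp
    show "?f ` ?U \<subseteq> ?V"
    proof clarsimp
      fix x assume "x \<in> X"
      then show "((x + a) mod p - a) mod p \<in> X" using *[of x] by (simp add: mod_simps)
    qed
  qed
  finally have 1: "card ?U \<le> card ?V" .
  have 2: "card ?U + lam p X a = card X"
  proof -
    have "card (?U \<union> {x \<in> X. (x + a) mod p \<notin> X}) = card ?U + lam p X a"
      unfolding lam_def using fin by (intro card_Un_disjoint) auto
    moreover have "?U \<union> {x \<in> X. (x + a) mod p \<notin> X} = X" by auto
    ultimately show ?thesis by simp
  qed
  have 3: "card ?V + lam p X (- a) = card X"
  proof -
    have "card (?V \<union> {x \<in> X. (x + - a) mod p \<notin> X}) = card ?V + lam p X (- a)"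
      unfolding lam_def using fin by (intro card_Un_disjoint) auto
    moreover have "?V \<union> {x \<in> X. (x + - a) mod p \<notin> X} = X" by auto
    ultimately show ?thesis by simp
  qed
  show ?thesis using 1 2 3 by linarith
qed

lemma lam_minus:
  assumes X: "X \<subseteq> {0..<p}"
  shows "lam p X (- a) = lam p X a"
  using lam_minus_le[OF X, of a] lam_minus_le[OF X, of "- a"] by simp

lemma lam_mult:
  assumes X: "X \<subseteq> {0..<p}"
  shows "lam p X (int i * a) \<le> i * lam p X a"
proof (induction i)
  case 0 then show ?case using lam_0[OF X] by simp
next
  case (Suc i)
  have "int (Suc i) * a = int i * a + a" by (simp add: algebra_simps)
  then show ?case using lam_add[OF X, of "int i * a" a] Suc by simp
qed

lemma lam_compl:
  assumes "finite X"
  shows "card {x \<in> X. (x + a) mod p \<in> X} = card X - lam p X a"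
proof -
  have "card ({x \<in> X. (x + a) mod p \<in> X} \<union> {x \<in> X. (x + a) mod p \<notin> X})
      = card {x \<in> X. (x + a) mod p \<in> X} + lam p X a"
    unfolding lam_def using assms by (intro card_Un_disjoint) auto
  moreover have "{x \<in> X. (x + a) mod p \<in> X} \<union> {x \<in> X. (x + a) mod p \<notin> X} = X" by auto
  ultimately show ?thesis by simp
qed

lemma sum_lam_eq:
  assumes X: "X \<subseteq> {0..<p}" and G: "finite G"
  shows "(\<Sum>d\<in>G. card X - lam p X d) = (\<Sum>x\<in>X. card {d \<in> G. (x + d) mod p \<in> X})"
proof -
  have fin: "finite X" using X finite_resid by blast
  have "(\<Sum>d\<in>G. card X - lam p X d) = (\<Sum>d\<in>G. \<Sum>x\<in>X. if (x + d) mod p \<in> X then 1 else 0)"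
    using fin by (intro sum.cong) (auto simp: lam_compl[OF fin, symmetric] sum.If_cases Int_def)
  also have "\<dots> = (\<Sum>x\<in>X. \<Sum>d\<in>G. if (x + d) mod p \<in> X then 1 else 0)"
    by (rule sum.swap)
  also have "\<dots> = (\<Sum>x\<in>X. card {d \<in> G. (x + d) mod p \<in> X})"
    using G by (intro sum.cong) (auto simp: sum.If_cases Int_def)
  finally show ?thesis .
qed

lemma inj_on_shift_mod_left:
  fixes p x :: int
  assumes "G \<subseteq> {0..<p}"
  shows "inj_on (\<lambda>d. (x + d) mod p) G"
  using inj_on_shift_mod[OF assms, of x] by (simp add: add.commute)

text \<open>For fixed \<open>x\<close>, distinct \<open>d\<close> give distinct
  \<open>x + d\<close>, so at most \<open>card X\<close> of them land in \<open>X\<close>. Hence few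
  shifts can have \<open>lam\<close> well below \<open>card X\<close>.\<close>

lemma sum_lam_le:
  assumes X: "X \<subseteq> {0..<p}" and G: "G \<subseteq> {0..<p}"
  shows "(\<Sum>d\<in>G. card X - lam p X d) \<le> card X * card X"
proof -
  have finG: "finite G" using G finite_resid by blast
  have fin: "finite X" using X finite_resid by blast
  have "card {d \<in> G. (x + d) mod p \<in> X} \<le> card X" for x
    by (rule card_inj_on_le[where f = "\<lambda>d. (x + d) mod p"])
       (use fin inj_on_subset[OF inj_on_shift_mod_left[OF G]] in auto)
  then have "(\<Sum>x\<in>X. card {d \<in> G. (x + d) mod p \<in> X}) \<le> (\<Sum>x\<in>X. card X)"
    by (intro sum_mono)
  then show ?thesis by (simp add: sum_lam_eq[OF X finG])
qed

text \<open>Averaging over all residues: the mean of \<open>card X - lam p X d\<close> is at most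
  \<open>card X * card X / p\<close>, hence at most a quarter of \<open>card X\<close>.\<close>

lemma ex_large_lam:
  assumes X: "X \<subseteq> {0..<p}" and N: "4 * int (card X) \<le> p" and pos: "X \<noteq> {}"
  shows "\<exists>d\<in>{0..<p}. 3 * card X \<le> 4 * lam p X d"
proof (rule ccontr)
  assume "\<not> ?thesis"
  then have *: "4 * lam p X d < 3 * card X" if "d \<in> {0..<p}" for d using that by force
  have fin: "finite X" using X finite_resid by blast
  have N0: "card X > 0" using pos fin by auto
  have "card X * nat p < 4 * (\<Sum>d\<in>{0..<p}. card X - lam p X d)"
  proof -
    have "(\<Sum>d\<in>{0..<p}. card X) < (\<Sum>d\<in>{0..<p}. 4 * (card X - lam p X d))"
    proof (rule sum_strict_mono)
      show "{0..<p} \<noteq> {}" using N N0 by auto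
      fix d assume "d \<in> {0..<p}"
      from *[OF this] show "card X < 4 * (card X - lam p X d)" by linarith
    qed auto
    then show ?thesis by (simp add: sum_distrib_left mult.commute)
  qed
  also have "\<dots> \<le> 4 * (card X * card X)" using sum_lam_le[OF X order_refl] by simp
  finally have "card X * nat p < card X * (4 * card X)" by simp
  then have "nat p < 4 * card X" by simp
  then show False using N by linarith
qed

lemma first_exceed:
  fixes a :: "nat \<Rightarrow> nat"
  assumes a0: "a 0 = 0" and step: "\<And>i. a (Suc i) \<le> a i + t" and big: "s < a n"
  shows "\<exists>i. s < a i \<and> a i \<le> s + t"
proof -
  define i where "i = (LEAST i. s < a i)"
  have 1: "s < a i" unfolding i_def using big by (rule LeastI)
  then obtain j where j: "i = Suc j" using a0 by (cases i) auto
  have "\<not> s < a j" by (rule not_less_Least) (simp add: i_def[symmetric] j)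
  then show ?thesis using 1 step[of j] j by (intro exI[of _ i]) auto
qed

lemma ex_mult_mod:
  fixes p h d :: int
  assumes p: "prime p" and h: "\<not> p dvd h"
  shows "\<exists>i. (int i * h) mod p = d mod p"
proof -
  have "coprime h p" using prime_imp_coprime[OF p h] by (simp add: coprime_commute)
  then obtain x where x: "[h * x = 1] (mod p)" using cong_solve_coprime_int by blast
  have p0: "p > 0" using p prime_gt_0_int by blast
  define i where "i = nat ((x * d) mod p)"
  have i: "int i = (x * d) mod p" using p0 by (simp add: i_def)
  have "(int i * h) mod p = (h * x * d) mod p"
    by (simp add: i mod_simps mult_ac)
  also have "\<dots> = (1 * d) mod p"
    using x by (metis cong_def mod_mult_left_eq)
  finally show ?thesis by auto
qed

text \<open>\<open>X\<close> is invariant under \<open>h\<close>, hence under all multiples of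
  \<open>h\<close>, which exhaust the residues.\<close>

lemma lam_zero_imp:
  assumes p: "prime p" and X: "X \<subseteq> {0..<p}" and h: "\<not> p dvd h" and z: "lam p X h = 0"
  shows "lam p X d = 0"
proof -
  obtain i where i: "(int i * h) mod p = d mod p" using ex_mult_mod[OF p h] by blast
  have "lam p X d = lam p X (int i * h)" using i by (intro lam_cong) simp
  also have "\<dots> \<le> i * lam p X h" by (rule lam_mult[OF X])
  finally show ?thesis using z by simp
qed

text \<open>Walking along the multiples of a nonzero \<open>h \<in> E\<close> changes \<open>lam\<close> by at most \<open>t\<close> per step, so
  every window \<open>(3jt, 3jt + t]\<close> contains a value \<open>lam d\<^sub>j\<close>; the translates \<open>d\<^sub>j + E\<close> are then
  disjoint by subadditivity and all have small \<open>lam\<close>.\<close>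

lemma lam_growth:
  fixes p :: int
  assumes p: "prime p" and X: "X \<subseteq> {0..<p}" and Xne: "X \<noteq> {}" and N: "4 * int (card X) \<le> p"
    and E: "finite E" "inj_on (\<lambda>e. e mod p) E" and h: "h \<in> E" "\<not> p dvd h"
    and t: "\<And>e. e \<in> E \<Longrightarrow> lam p X e \<le> t" and tN: "8 * t \<le> card X"
  shows "card E \<le> 24 * t"
proof -
  have fin: "finite X" using X finite_resid by blast
  let ?N = "card X"
  have N0: "?N > 0" using Xne fin by auto
  have p0: "p > 0" using p prime_gt_0_int by blast
  obtain dd where dd: "3 * ?N \<le> 4 * lam p X dd" using ex_large_lam[OF X N Xne] by blast
  have t0: "t > 0"
  proof (rule ccontr)
    assume "\<not> t > 0"
    then have "lam p X h = 0" using t[OF h(1)] by simp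
    from lam_zero_imp[OF p X h(2) this, of dd] show False using dd N0 by simp
  qed
  define a where "a i = lam p X (int i * h)" for i :: nat
  have a0: "a 0 = 0" using lam_0[OF X] by (simp add: a_def)
  have step: "a (Suc i) \<le> a i + t" for i
  proof -
    have "int (Suc i) * h = int i * h + h" by (simp add: algebra_simps)
    then show ?thesis unfolding a_def using lam_add[OF X, of "int i * h" h] t[OF h(1)] by simp
  qed
  obtain i0 where i0: "(int i0 * h) mod p = dd mod p" using ex_mult_mod[OF p h(2)] by blast
  have ai0: "a i0 = lam p X dd" unfolding a_def using i0 by (intro lam_cong) simp
  have "\<exists>i. s < a i \<and> a i \<le> s + t" if "4 * s < 3 * ?N" for s
    by (rule first_exceed[OF a0 step, of s i0]) (use that ai0 dd in linarith)
  then have lev: "\<exists>d. s < lam p X d \<and> lam p X d \<le> s + t" if "4 * s < 3 * ?N" for s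
    using that unfolding a_def by blast
  \<comment> \<open>With \<open>R\<close> levels spaced by \<open>3 * t\<close>, \<open>lam\<close>
    is at most \<open>?N / 2\<close> on all \<open>R * card E\<close> translates, so each of them
    contributes at least \<open>?N / 2\<close> to the sum bounded by
    \<open>sum_lam_le\<close>.\<close>
  define R where "R = ?N div (6 * t)"
  have R6: "R * (6 * t) \<le> ?N" unfolding R_def by (simp add: div_times_less_eq_dividend)
  have R1: "R \<ge> 1" unfolding R_def using tN t0
  proof -
    have "1 * (6 * t) \<le> ?N" using tN by simp
    then show "1 \<le> ?N div (6 * t)" using t0 by (subst less_eq_div_iff_mult_less_eq) auto
  qed
  have "\<exists>d. 3 * j * t < lam p X d \<and> lam p X d \<le> 3 * j * t + t" if "j < R" for j
  proof (rule lev)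
    have "j * (6 * t) \<le> R * (6 * t)" using that by (intro mult_right_mono) auto
    then have "j * (6 * t) \<le> ?N" using R6 by linarith
    then show "4 * (3 * j * t) < 3 * ?N" using N0 by (simp add: algebra_simps)
  qed
  then obtain d where d: "\<And>j. j < R \<Longrightarrow> 3 * j * t < lam p X (d j) \<and> lam p X (d j) \<le> 3 * j * t + t"
    by metis
  let ?f = "\<lambda>(j, e). (d j + e) mod p"
  have disj: False if "i < j" "j < R" "e \<in> E" "e' \<in> E" and eq: "(d j + e) mod p = (d i + e') mod p"
    for i j e e'
  proof -
    have "p dvd (d j + e) - (d i + e')" using eq by (simp add: mod_eq_dvd_iff)
    then have "p dvd d j - (d i + (e' + - e))" by (simp add: algebra_simps)
    then have "d j mod p = (d i + (e' + - e)) mod p" by (simp add: mod_eq_dvd_iff)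
    then have "lam p X (d j) = lam p X (d i + (e' + - e))" by (rule lam_cong)
    also have "\<dots> \<le> lam p X (d i) + lam p X (e' + - e)" by (rule lam_add[OF X])
    also have "\<dots> \<le> lam p X (d i) + (lam p X e' + lam p X e)"
      using lam_add[OF X, of e' "- e"] lam_minus[OF X, of e] by simp
    \<comment> \<open>One \<open>t\<close> is the width of window \<open>i\<close>, the other two
      bound \<open>lam\<close> of \<open>e\<close> and \<open>e'\<close>: the spacing
      \<open>3 * t\<close> is just what separates level \<open>i\<close> from level
      \<open>j\<close>.\<close>
    also have "\<dots> \<le> 3 * i * t + t + (t + t)" using d[of i] that t by (intro add_mono) auto
    also have "\<dots> = 3 * Suc i * t" by (simp add: algebra_simps)
    also have "\<dots> \<le> 3 * j * t" using that by (intro mult_right_mono mult_left_mono) auto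
    finally show False using d[of j] that by simp
  qed
  have inj: "inj_on ?f ({..<R} \<times> E)"
  proof (rule inj_onI, clarify)
    fix i e j e' assume *: "i < R" "e \<in> E" "j < R" "e' \<in> E" "(d i + e) mod p = (d j + e') mod p"
    have ij: "i = j" using disj[of i j e' e] disj[of j i e e'] * by (metis linorder_neqE_nat)
    then have "p dvd (d i + e) - (d i + e')" using * by (simp add: mod_eq_dvd_iff)
    then have "e mod p = e' mod p" by (simp add: mod_eq_dvd_iff)
    then show "i = j \<and> e = e'" using ij E(2) * by (auto dest: inj_onD)
  qed
  define G where "G = ?f ` ({..<R} \<times> E)"
  have G: "G \<subseteq> {0..<p}" unfolding G_def using p0 by auto
  have cG: "card G = R * card E" unfolding G_def using card_image[OF inj] E(1)
    by (simp add: card_cartesian_product)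
  have lamG: "?N \<le> 2 * (?N - lam p X g)" if "g \<in> G" for g
  proof -
    from that obtain j e where je: "j < R" "e \<in> E" "g = (d j + e) mod p" unfolding G_def by auto
    have "lam p X g \<le> lam p X (d j) + lam p X e" using lam_add[OF X] je lam_mod by metis
    also have "\<dots> \<le> 3 * j * t + t + t" using d[of j] t je by (intro add_mono) auto
    also have "\<dots> \<le> 3 * Suc j * t" by (simp add: algebra_simps)
    also have "\<dots> \<le> 3 * R * t" using je by (intro mult_right_mono mult_left_mono) auto
    finally show ?thesis using R6 by (simp add: algebra_simps)
  qed
  have "(\<Sum>g\<in>G. ?N) \<le> (\<Sum>g\<in>G. 2 * (?N - lam p X g))" by (intro sum_mono lamG)
  also have "\<dots> \<le> 2 * (?N * ?N)" using sum_lam_le[OF X G] by (simp flip: sum_distrib_left)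
  finally have "R * card E * ?N \<le> (2 * ?N) * ?N" by (simp add: cG)
  then have RE: "R * card E \<le> 2 * ?N" using N0 by simp
  have R12: "?N \<le> R * (12 * t)"
  proof -
    have "?N = R * (6 * t) + ?N mod (6 * t)" unfolding R_def by (simp only: div_mult_mod_eq)
    moreover have "?N mod (6 * t) < 6 * t" using t0 by simp
    moreover have "6 * t \<le> R * (6 * t)" using R1 by simp
    moreover have "R * (12 * t) = R * (6 * t) + R * (6 * t)" by (simp add: algebra_simps)
    ultimately show ?thesis by linarith
  qed
  have "R * card E \<le> 2 * (R * (12 * t))" using RE R12 by linarith
  then have "R * card E \<le> R * (24 * t)" by (simp add: algebra_simps)
  then show ?thesis using R1 by simp
qed

section \<open>Growth of the subset sums of a zero-sum-free set\<close>

lemma zsf_subset: "zsf p A \<Longrightarrow> B \<subseteq> A \<Longrightarrow> zsf p B"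
  unfolding zsf_def using finite_subset by blast

lemma zsf_finite: "zsf p A \<Longrightarrow> finite A"
  unfolding zsf_def by blast

lemma zsf_not_dvd: "zsf p A \<Longrightarrow> B \<subseteq> A \<Longrightarrow> B \<noteq> {} \<Longrightarrow> \<not> p dvd \<Sum>B"
  unfolding zsf_def by blast

lemma zsf_elem: "zsf p A \<Longrightarrow> a \<in> A \<Longrightarrow> \<not> p dvd a"
  using zsf_not_dvd[of p A "{a}"] by simp

lemma sums_mod_range: "p > 0 \<Longrightarrow> sums_mod p B \<subseteq> {0..<p}"
  unfolding sums_mod_def by auto

lemma sums_mod_zero: "0 \<in> sums_mod p B"
  unfolding sums_mod_def by (rule image_eqI[of _ _ "{}"]) auto

lemma sums_mod_mono: "B \<subseteq> C \<Longrightarrow> sums_mod p B \<subseteq> sums_mod p C"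
  unfolding sums_mod_def by (intro image_mono Pow_mono)

lemma finite_sums_mod: "p > 0 \<Longrightarrow> finite (sums_mod p B)"
  using sums_mod_range finite_resid by blast

lemma card_sums_mod_mono: "p > 0 \<Longrightarrow> B \<subseteq> C \<Longrightarrow> card (sums_mod p B) \<le> card (sums_mod p C)"
  by (intro card_mono sums_mod_mono finite_sums_mod)

lemma card_sums_mod_le: "p > 0 \<Longrightarrow> int (card (sums_mod p B)) \<le> p"
  using card_mono[OF _ sums_mod_range, of p B] by simp

lemma sums_mod_insert:
  assumes "finite B" "a \<notin> B"
  shows "sums_mod p (insert a B) = sums_mod p B \<union> (\<lambda>x. (x + a) mod p) ` sums_mod p B"
proof -
  have "\<Sum>(insert a C) mod p = (\<Sum>C mod p + a) mod p" if "C \<in> Pow B" for C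
  proof -
    have "finite C" "a \<notin> C" using assms that finite_subset by auto
    then show ?thesis by (simp add: mod_simps add.commute)
  qed
  then have "(\<lambda>C. \<Sum>C mod p) ` insert a ` Pow B = (\<lambda>x. (x + a) mod p) ` sums_mod p B"
    unfolding sums_mod_def image_image by (intro image_cong) auto
  then show ?thesis unfolding sums_mod_def Pow_insert image_Un by simp
qed

lemma card_sums_mod_insert:
  assumes "finite B" "a \<notin> B" and p: "p > 0"
  shows "card (sums_mod p (insert a B)) = card (sums_mod p B) + lam p (sums_mod p B) a"
proof -
  let ?X = "sums_mod p B"
  let ?U = "{x \<in> ?X. (x + a) mod p \<notin> ?X}"
  have X: "?X \<subseteq> {0..<p}" using sums_mod_range[OF p] .
  have fin: "finite ?X" using finite_sums_mod[OF p] .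
  have "sums_mod p (insert a B) = ?X \<union> (\<lambda>x. (x + a) mod p) ` ?U"
    unfolding sums_mod_insert[OF assms(1,2)] by auto
  moreover have "card (?X \<union> (\<lambda>x. (x + a) mod p) ` ?U) = card ?X + card ((\<lambda>x. (x + a) mod p) ` ?U)"
    using fin by (intro card_Un_disjoint) auto
  moreover have "card ((\<lambda>x. (x + a) mod p) ` ?U) = card ?U"
    by (rule card_image, rule inj_on_subset[OF inj_on_shift_mod[OF X]]) auto
  ultimately show ?thesis by (simp add: lam_def)
qed

text \<open>The empty sum and the singletons are distinct residues. This linear bound covers those
  steps of the growth argument in which the gain exceeds \<open>card X / 8\<close> and
  \<open>lam_growth\<close> does not apply.\<close>

lemma card_sums_mod_gt:
  assumes p: "p > 0" and z: "zsf p B" and inj: "inj_on (\<lambda>a. a mod p) B"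
  shows "card B < card (sums_mod p B)"
proof -
  have "(\<lambda>a. a mod p) ` B \<subseteq> sums_mod p B - {0}"
  proof
    fix y assume "y \<in> (\<lambda>a. a mod p) ` B"
    then obtain a where a: "a \<in> B" "y = a mod p" by blast
    have "y \<in> sums_mod p B" unfolding sums_mod_def
      by (rule image_eqI[of _ _ "{a}"]) (use a in auto)
    moreover have "y \<noteq> 0" using zsf_elem[OF z a(1)] a(2) by (simp add: dvd_eq_mod_eq_0)
    ultimately show "y \<in> sums_mod p B - {0}" by simp
  qed
  then have "card ((\<lambda>a. a mod p) ` B) \<le> card (sums_mod p B - {0})"
    by (intro card_mono) (use finite_sums_mod[OF p] in auto)
  also have "\<dots> < card (sums_mod p B)"
    by (rule card_Diff1_less[OF finite_sums_mod[OF p] sums_mod_zero])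
  finally show ?thesis using card_image[OF inj] by simp
qed

text \<open>A sum over \<open>B\<close> equal to a negated sum over \<open>C\<close> gives a subset
  of \<open>B \<union> C\<close> with sum divisible by \<open>p\<close>, so the two sets share only
  0. This is the source of the co-density: part of \<open>A\<close> is reserved as
  \<open>C\<close>.\<close>

lemma card_sums_mod_disjoint:
  assumes p: "p > 0" and z: "zsf p A" and B: "B \<subseteq> A" and C: "C \<subseteq> A" and disj: "B \<inter> C = {}"
  shows "int (card (sums_mod p B)) + int (card (sums_mod p C)) \<le> p + 1"
proof -
  let ?Y = "(\<lambda>y. (- y) mod p) ` sums_mod p C"
  have "inj_on (\<lambda>y. (- y) mod p) (sums_mod p C)"
  proof (rule inj_onI)
    fix x y assume xy: "x \<in> sums_mod p C" "y \<in> sums_mod p C" and e: "(- x) mod p = (- y) mod p"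
    have "x mod p = y mod p" using mod_minus_cong[OF e] by simp
    then show "x = y" using xy sums_mod_range[OF p] by (metis atLeastLessThan_iff mod_pos_pos_trivial subsetD)
  qed
  then have cY: "card ?Y = card (sums_mod p C)" by (rule card_image)
  have int: "sums_mod p B \<inter> ?Y \<subseteq> {0}"
  proof
    fix x assume x: "x \<in> sums_mod p B \<inter> ?Y"
    then obtain B' where B': "B' \<subseteq> B" "x = \<Sum>B' mod p" unfolding sums_mod_def by auto
    from x obtain C' where C': "C' \<subseteq> C" "x = (- (\<Sum>C' mod p)) mod p" unfolding sums_mod_def by auto
    have fin: "finite B'" "finite C'" using zsf_finite[OF z] B C B' C' by (meson finite_subset)+
    have "(\<Sum>B') mod p = (- (\<Sum>C')) mod p" using B' C' by (simp add: mod_simps)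
    then have "p dvd \<Sum>B' + \<Sum>C'" by (simp add: mod_eq_dvd_iff)
    also have "\<Sum>B' + \<Sum>C' = \<Sum>(B' \<union> C')"
      using fin disj B' C' by (subst sum.union_disjoint) auto
    finally have "B' \<union> C' = {}" using zsf_not_dvd[OF z, of "B' \<union> C'"] B C B' C' by blast
    then show "x \<in> {0}" using B' by simp
  qed
  have "card (sums_mod p B) + card ?Y = card (sums_mod p B \<union> ?Y) + card (sums_mod p B \<inter> ?Y)"
    using finite_sums_mod[OF p] by (intro card_Un_Int) auto
  moreover have "card (sums_mod p B \<inter> ?Y) \<le> 1" using card_mono[OF _ int] by simp
  moreover have "card (sums_mod p B \<union> ?Y) \<le> card {0..<p}"
    using sums_mod_range[OF p] p by (intro card_mono) (auto intro: pos_mod_bound)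
  ultimately show ?thesis using cY p by simp
qed

text \<open>Greedy growth: the next element is one with the largest \<open>lam\<close>. At the step
  from \<open>n\<close> to \<open>Suc n\<close> at least \<open>n + 2\<close> candidates are left,
  so the gain is at least \<open>(n + 2) / 24\<close>, and these gains add up to
  \<open>n * n / 48\<close>.\<close>

lemma ex_large_sums_mod:
  assumes p: "prime p" and z: "zsf p A" and inj: "inj_on (\<lambda>a. a mod p) A" and n: "2 * n \<le> card A"
  shows "\<exists>B\<subseteq>A. card B = n \<and> (p < 4 * int (card (sums_mod p B)) \<or> n * n \<le> 48 * card (sums_mod p B))"
  using n
proof (induction n)
  case 0 then show ?case by (intro exI[of _ "{}"]) auto
next
  case (Suc n)
  have p0: "p > 0" using p prime_gt_0_int by blast
  have finA: "finite A" using z zsf_finite by blast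
  obtain B where B: "B \<subseteq> A" "card B = n"
    and large: "p < 4 * int (card (sums_mod p B)) \<or> n * n \<le> 48 * card (sums_mod p B)"
    using Suc by auto
  have finB: "finite B" using B finA finite_subset by blast
  let ?X = "sums_mod p B"
  let ?E = "A - B"
  have cE: "card ?E = card A - n" using B finB by (simp add: card_Diff_subset)
  then have "card ?E > 0" using Suc.prems by simp
  then have Ene: "?E \<noteq> {}" by (metis card.empty less_irrefl)
  have finE: "finite ?E" using finA by simp
  define t where "t = Max (lam p ?X ` ?E)"
  have "t \<in> lam p ?X ` ?E" unfolding t_def using finE Ene by (intro Max_in) auto
  then obtain e where e: "e \<in> ?E" "t = lam p ?X e" by blast
  have t: "lam p ?X e \<le> t" if "e \<in> ?E" for e unfolding t_def using finE that by (intro Max_ge) auto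
  have ins: "card (sums_mod p (insert e B)) = card ?X + t"
    using card_sums_mod_insert[OF finB _ p0] e by auto
  have eB: "insert e B \<subseteq> A" "card (insert e B) = Suc n" using e B finB by auto
  show ?case
  proof (cases "p < 4 * int (card ?X)")
    case True
    then show ?thesis using eB ins by (intro exI[of _ "insert e B"]) auto
  next
    case False
    have Xgt: "n < card ?X"
      using card_sums_mod_gt[OF p0 zsf_subset[OF z B(1)] inj_on_subset[OF inj B(1)]] B by simp
    have "n + 2 \<le> 24 * t"
    proof (cases "8 * t \<le> card ?X")
      case True
      have "card ?E \<le> 24 * t"
      proof (rule lam_growth[OF p sums_mod_range[OF p0, of B] _ _ finE _ _ _ t True, where h = e])
        show "?X \<noteq> {}" using sums_mod_zero by auto
        show "inj_on (\<lambda>e. e mod p) ?E" by (rule inj_on_subset[OF inj]) auto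
        show "\<not> p dvd e" using zsf_elem[OF z] e by auto
      qed (use False e in auto)
      then show ?thesis using cE Suc.prems by simp
    qed (use Xgt in linarith)
    then have "Suc n * Suc n \<le> 48 * (card ?X + t)" using large False by simp
    then show ?thesis using eB ins by (intro exI[of _ "insert e B"]) auto
  qed
qed

text \<open>Otherwise \<open>n\<close> elements could be added one by one, each with a gain of at
  least \<open>\<tau>\<close>, and there would be more than \<open>p\<close> residues.\<close>

lemma ex_small_lam:
  assumes p: "p > 0" and finA: "finite A" and B0: "B0 \<subseteq> A" and n: "card B0 + n \<le> card A" "int (n * \<tau>) > p"
  shows "\<exists>B. B0 \<subseteq> B \<and> B \<subseteq> A \<and> card B \<le> card B0 + n \<and> (\<forall>e\<in>A - B. lam p (sums_mod p B) e < \<tau>)"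
proof (rule ccontr)
  assume neg: "\<not> ?thesis"
  have "\<exists>B. B0 \<subseteq> B \<and> B \<subseteq> A \<and> card B = card B0 + j \<and> j * \<tau> \<le> card (sums_mod p B)" if "j \<le> n" for j
    using that
  proof (induction j)
    case 0 then show ?case using B0 by (intro exI[of _ B0]) auto
  next
    case (Suc j)
    then obtain B where B: "B0 \<subseteq> B" "B \<subseteq> A" "card B = card B0 + j" "j * \<tau> \<le> card (sums_mod p B)" by auto
    have "card B \<le> card B0 + n" using B Suc by simp
    then obtain e where e: "e \<in> A - B" "\<tau> \<le> lam p (sums_mod p B) e" using neg B by (meson not_less)
    have finB: "finite B" using B finA finite_subset by blast
    have "card (sums_mod p (insert e B)) = card (sums_mod p B) + lam p (sums_mod p B) e"
      using card_sums_mod_insert[OF finB _ p] e by auto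
    then show ?case using B e finB by (intro exI[of _ "insert e B"]) auto
  qed
  then obtain B where "n * \<tau> \<le> card (sums_mod p B)" by blast
  then show False using n(2) card_sums_mod_le[OF p, of B] by linarith
qed

text \<open>\<open>A\<close> is used in three portions: \<open>B0\<close> provides the density, up
  to \<open>n\<close> further elements bring \<open>lam\<close> down to \<open>p / n\<close>, and a
  set \<open>C\<close> in the remainder provides the co-density.\<close>

lemma ex_almost_invariant_sums_mod:
  assumes p: "prime p" and z: "zsf p A" and inj: "inj_on (\<lambda>a. a mod p) A"
    and n: "0 < n" "8 * n \<le> card A" and k: "p \<le> int (card A) * int (card A)" "20 \<le> card A" and pl: "2400 \<le> p"
  shows "\<exists>B\<subseteq>A. card B \<le> 2 * n \<and> (\<forall>e\<in>A - B. int (n * lam p (sums_mod p B) e) \<le> p)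
     \<and> (p < 4 * int (card (sums_mod p B)) \<or> n * n \<le> 48 * card (sums_mod p B))
     \<and> p \<le> 2400 * (p - int (card (sums_mod p B)))"
proof -
  have p0: "p > 0" using p prime_gt_0_int by blast
  have finA: "finite A" using z zsf_finite by blast
  obtain B0 where B0: "B0 \<subseteq> A" "card B0 = n"
    and large: "p < 4 * int (card (sums_mod p B0)) \<or> n * n \<le> 48 * card (sums_mod p B0)"
    using ex_large_sums_mod[OF p z inj, of n] n by auto
  \<comment> \<open>The least \<open>\<tau>\<close> with \<open>n * \<tau> > p\<close>, so that
    \<open>lam < \<tau>\<close> means \<open>n * lam \<le> p\<close>.\<close>
  define \<tau> where "\<tau> = nat (p div int n) + 1"
  have pd: "p div int n \<ge> 0" using p0 n by (simp add: pos_imp_zdiv_nonneg_iff)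
  have "int (n * \<tau>) > p"
  proof -
    have "p = int n * (p div int n) + p mod int n" by simp
    moreover have "p mod int n < int n" using n by simp
    ultimately have "p < int n * (p div int n) + int n" by linarith
    then show ?thesis using pd by (simp add: \<tau>_def algebra_simps)
  qed
  then obtain B where B: "B0 \<subseteq> B" "B \<subseteq> A" "card B \<le> card B0 + n"
    and lamB: "\<forall>e\<in>A - B. lam p (sums_mod p B) e < \<tau>"
    using ex_small_lam[OF p0 finA B0(1), of n \<tau>] B0 n by auto
  have finB: "finite B" using B finA finite_subset by blast
  have c1: "card B \<le> 2 * n" using B B0 by simp
  have c2: "int (n * lam p (sums_mod p B) e) \<le> p" if "e \<in> A - B" for e
  proof -
    have "lam p (sums_mod p B) e < \<tau>" using lamB that by blast
    then have "int (lam p (sums_mod p B) e) \<le> p div int n" using pd by (simp add: \<tau>_def)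
    then have "int n * int (lam p (sums_mod p B) e) \<le> int n * (p div int n)" by (intro mult_left_mono) auto
    also have "\<dots> \<le> p" using n by (simp add: minus_mod_eq_mult_div[symmetric])
    finally show ?thesis by simp
  qed
  have mono: "card (sums_mod p B0) \<le> card (sums_mod p B)" by (rule card_sums_mod_mono[OF p0 B(1)])
  have c3: "p < 4 * int (card (sums_mod p B)) \<or> n * n \<le> 48 * card (sums_mod p B)"
    using large mono by linarith
  \<comment> \<open>\<open>A - B\<close> keeps three quarters of \<open>A\<close>, enough for
    \<open>2 * q\<close>. The constant 1200 below is 48 * 25; it is doubled to absorb the
    \<open>+ 1\<close> of \<open>card_sums_mod_disjoint\<close>.\<close>
  define q where "q = card A div 4"
  have q5: "card A \<le> 5 * q" using k(2) by (simp add: q_def)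
  have "2 * q \<le> card (A - B)" using c1 n finB B by (simp add: card_Diff_subset q_def)
  then obtain C where C: "C \<subseteq> A - B"
    and largeC: "p < 4 * int (card (sums_mod p C)) \<or> q * q \<le> 48 * card (sums_mod p C)"
    using ex_large_sums_mod[OF p zsf_subset[OF z, of "A - B"] inj_on_subset[OF inj, of "A - B"], of q] by auto
  have "card A * card A \<le> (5 * q) * (5 * q)" using q5 by (intro mult_mono) auto
  then have "int (card A) * int (card A) \<le> 25 * int (q * q)" by (simp flip: of_nat_mult)
  then have "p \<le> 25 * int (q * q)" using k(1) by linarith
  then have "p \<le> 1200 * int (card (sums_mod p C))"
    using largeC by (elim disjE) linarith+
  moreover have "int (card (sums_mod p B)) + int (card (sums_mod p C)) \<le> p + 1"
    by (rule card_sums_mod_disjoint[OF p0 z B(2)]) (use C in auto)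
  ultimately have "p \<le> 2400 * (p - int (card (sums_mod p B)))" using pl
    unfolding right_diff_distrib by linarith
  then show ?thesis using B(2) c1 c2 c3 by blast
qed

section \<open>Concentration of a dilate near zero\<close>

text \<open>The representative in \<open>[-p/2, p/2)\<close>: its absolute value is the norm of
  \<open>x\<close>, and its sign tells the half of the field in which \<open>x\<close> lies.\<close>

definition smod :: "int \<Rightarrow> int \<Rightarrow> int" where
  "smod p x = (if 2 * (x mod p) < p then x mod p else x mod p - p)"

lemma smod_cong_dvd: "p dvd smod p x - x"
proof -
  have "smod p x mod p = x mod p" by (simp add: smod_def)
  then show ?thesis by (simp add: mod_eq_dvd_iff)
qed

lemma smod_bounds: "p > 0 \<Longrightarrow> - p \<le> 2 * smod p x \<and> 2 * smod p x < p"
  using pos_mod_bound[of p x] pos_mod_sign[of p x] unfolding smod_def by (auto simp del: pos_mod_bound pos_mod_sign)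

section \<open>Fourier analysis modulo \<open>p\<close>\<close>

definition angle :: "nat \<Rightarrow> int \<Rightarrow> real" where
  "angle p m = 2 * pi * real_of_int m / real p"

lemma angle_mult: "angle p (m * int i) = real i * angle p m"
  by (simp add: angle_def)

lemma angle_add: "angle p (m + n) = angle p m + angle p n"
  by (simp add: angle_def add_divide_distrib algebra_simps)

lemma angle_diff: "angle p (m - n) = angle p m - angle p n"
  by (simp add: angle_def diff_divide_distrib algebra_simps)

lemma cos_angle_cong:
  assumes p: "p > 0" and d: "int p dvd m - n"
  shows "cos (angle p m) = cos (angle p n)"
proof -
  obtain k where k: "m - n = int p * k" using d by auto
  then have m: "m = n + int p * k" by simp
  have "angle p m = angle p n + 2 * pi * real_of_int k"
    unfolding m angle_add using p by (simp add: angle_def)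
  then show ?thesis by (simp add: cos_add)
qed

lemma sum_cos_angle:
  assumes p: "p > 0"
  shows "(\<Sum>\<xi><p. cos (angle p (m * int \<xi>))) = (if int p dvd m then real p else 0)"
proof (cases "int p dvd m")
  case True
  have "cos (angle p (m * int \<xi>)) = 1" for \<xi>
    using cos_angle_cong[OF p, of "m * int \<xi>" 0] True by (simp add: angle_def)
  then show ?thesis using True by simp
next
  case False
  let ?z = "cis (angle p m)"
  have z1: "?z \<noteq> 1"
  proof
    assume "?z = 1"
    then have "cos (angle p m) = 1" by (metis cis.simps(1) one_complex.simps(1))
    then obtain n where "angle p m = real_of_int n * 2 * pi" unfolding cos_one_2pi_int by blast
    then have "real_of_int m = real_of_int n * real p" using p by (simp add: angle_def field_simps)
    then have "real_of_int m = real_of_int (n * int p)" by simp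
    then have "m = n * int p" by (simp only: of_int_eq_iff)
    then show False using False by simp
  qed
  have zp: "?z ^ p = 1"
  proof -
    have "real p * angle p m = 2 * pi * real_of_int m" using p by (simp add: angle_def)
    then show ?thesis by (simp add: DeMoivre complex_eq_iff)
  qed
  have "(\<Sum>\<xi><p. cos (angle p (m * int \<xi>))) = Re (\<Sum>\<xi><p. ?z ^ \<xi>)"
    by (simp add: DeMoivre angle_mult)
  also have "(\<Sum>\<xi><p. ?z ^ \<xi>) = 0" using geometric_sum[OF z1, of p] zp by simp
  finally show ?thesis using False by simp
qed

text \<open>The squared modulus of the Fourier coefficient at \<open>\<xi>\<close> of the indicator function of \<open>X\<close>.\<close>

definition energy :: "nat \<Rightarrow> int set \<Rightarrow> nat \<Rightarrow> real" where
  "energy p X \<xi> = (\<Sum>x\<in>X. cos (angle p (x * int \<xi>)))\<^sup>2 + (\<Sum>x\<in>X. sin (angle p (x * int \<xi>)))\<^sup>2"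

lemma energy_nonneg: "energy p X \<xi> \<ge> 0"
  by (simp add: energy_def)

lemma energy_eq: "energy p X \<xi> = (\<Sum>x\<in>X. \<Sum>y\<in>X. cos (angle p ((x - y) * int \<xi>)))"
  unfolding energy_def power2_eq_square sum_product
  by (simp add: sum.distrib[symmetric] left_diff_distrib angle_diff cos_diff)

lemma sum_dvd_indicator:
  assumes X: "X \<subseteq> {0..<int p}" and p: "p > 0"
  shows "(\<Sum>x\<in>X. if int p dvd x - z then c else 0) = (if z mod int p \<in> X then c else (0::real))"
proof -
  have "(int p dvd x - z) = (x = z mod int p)" if "x \<in> X" for x
  proof -
    have "x mod int p = x" using X that by auto
    then show ?thesis by (metis mod_eq_dvd_iff)
  qed
  then have "(\<Sum>x\<in>X. if int p dvd x - z then c else 0) = (\<Sum>x\<in>X. if x = z mod int p then c else 0)"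
    by (intro sum.cong) auto
  also have "\<dots> = (if z mod int p \<in> X then c else 0)"
    using finite_resid[OF X] by (simp add: sum.delta')
  finally show ?thesis .
qed

text \<open>Fourier inversion for the autocorrelation of \<open>X\<close>, whose value at
  \<open>d\<close> is the number of pairs with difference \<open>d\<close>, that is
  \<open>card X - lam d\<close>. Cosines see \<open>d\<close> and \<open>- d\<close> together,
  whence the two halves, which agree by \<open>lam_minus\<close>.\<close>

lemma sum_energy_cos:
  assumes X: "X \<subseteq> {0..<int p}" and p: "p > 0"
  shows "(\<Sum>\<xi><p. energy p X \<xi> * cos (angle p (d * int \<xi>)))
    = real p * (real (card X) - real (lam (int p) X d))"
proof -
  have fin: "finite X" using finite_resid[OF X] .
  have cnt: "(\<Sum>y\<in>X. \<Sum>x\<in>X. if int p dvd x - y - d then real p else 0)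
      = real p * (real (card X) - real (lam (int p) X d))" for d
  proof -
    have "(\<Sum>y\<in>X. \<Sum>x\<in>X. if int p dvd x - y - d then real p else 0)
        = (\<Sum>y\<in>X. if (y + d) mod int p \<in> X then real p else 0)"
      by (intro sum.cong refl) (simp add: sum_dvd_indicator[OF X p, symmetric] diff_diff_eq)
    also have "\<dots> = real p * real (card {y \<in> X. (y + d) mod int p \<in> X})"
      using fin by (simp add: sum.If_cases Int_def)
    also have "card {y \<in> X. (y + d) mod int p \<in> X} = card X - lam (int p) X d"
      by (rule lam_compl[OF fin])
    also have "real (card X - lam (int p) X d) = real (card X) - real (lam (int p) X d)"
      using lam_le_card[OF fin] by simp
    finally show ?thesis .
  qed
  have "(\<Sum>\<xi><p. energy p X \<xi> * cos (angle p (d * int \<xi>)))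
      = (\<Sum>\<xi><p. \<Sum>x\<in>X. \<Sum>y\<in>X. (cos (angle p ((x - y - d) * int \<xi>)) + cos (angle p ((x - y - - d) * int \<xi>))) / 2)"
    unfolding energy_eq sum_distrib_right
    by (intro sum.cong refl)
       (simp add: cos_times_cos left_diff_distrib distrib_right angle_diff angle_add)
  also have "\<dots> = (\<Sum>x\<in>X. \<Sum>\<xi><p. \<Sum>y\<in>X. (cos (angle p ((x - y - d) * int \<xi>)) + cos (angle p ((x - y - - d) * int \<xi>))) / 2)"
    by (rule sum.swap)
  also have "\<dots> = (\<Sum>x\<in>X. \<Sum>y\<in>X. \<Sum>\<xi><p. (cos (angle p ((x - y - d) * int \<xi>)) + cos (angle p ((x - y - - d) * int \<xi>))) / 2)"
    by (intro sum.cong refl sum.swap)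
  also have "\<dots> = (\<Sum>x\<in>X. \<Sum>y\<in>X. ((if int p dvd x - y - d then real p else 0) + (if int p dvd x - y - - d then real p else 0)) / 2)"
    unfolding sum_divide_distrib[symmetric] sum.distrib sum_cos_angle[OF p] by (rule refl)
  also have "\<dots> = ((\<Sum>x\<in>X. \<Sum>y\<in>X. if int p dvd x - y - d then real p else 0) + (\<Sum>x\<in>X. \<Sum>y\<in>X. if int p dvd x - y - - d then real p else 0)) / 2"
    by (simp only: sum_divide_distrib[symmetric] sum.distrib)
  also have "(\<Sum>x\<in>X. \<Sum>y\<in>X. if int p dvd x - y - d then real p else 0) = (\<Sum>y\<in>X. \<Sum>x\<in>X. if int p dvd x - y - d then real p else 0)"
    by (rule sum.swap)
  also have "(\<Sum>x\<in>X. \<Sum>y\<in>X. if int p dvd x - y - - d then real p else 0) = (\<Sum>y\<in>X. \<Sum>x\<in>X. if int p dvd x - y - - d then real p else 0)"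
    by (rule sum.swap)
  finally show ?thesis unfolding cnt lam_minus[OF X] by simp
qed

text \<open>The case \<open>d = 0\<close> minus the general case. A small \<open>lam\<close> thus
  forces the energy onto frequencies \<open>\<xi>\<close> at which \<open>d * \<xi>\<close> is close
  to a multiple of \<open>p\<close>.\<close>

lemma sum_energy_one_minus_cos:
  assumes X: "X \<subseteq> {0..<int p}" and p: "p > 0"
  shows "(\<Sum>\<xi><p. energy p X \<xi> * (1 - cos (angle p (d * int \<xi>)))) = real p * real (lam (int p) X d)"
  using sum_energy_cos[OF X p, of d] sum_energy_cos[OF X p, of 0] lam_0[OF X]
  by (simp add: right_diff_distrib sum_subtractf angle_def)

text \<open>Frequency 0 yields no dilate and carries \<open>card X * card X\<close> of the energy.
  Density and co-density of \<open>X\<close> ensure that a fixed fraction of \<open>p * p\<close>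
  remains.\<close>

lemma sum_energy_nonzero:
  assumes X: "X \<subseteq> {0..<int p}" and p: "p > 0"
  shows "(\<Sum>\<xi>=1..<p. energy p X \<xi>) = real (card X) * (real p - real (card X))"
proof -
  have "(\<Sum>\<xi><p. energy p X \<xi>) = real p * real (card X)"
    using sum_energy_cos[OF X p, of 0] lam_0[OF X] by (simp add: angle_def)
  moreover have "{..<p} = insert 0 {1..<p}" using p by auto
  moreover have "energy p X 0 = real (card X) * real (card X)"
    by (simp add: energy_def angle_def power2_eq_square)
  ultimately show ?thesis by (simp add: algebra_simps)
qed

section \<open>Cosine sums along the multiples of an angle\<close>

lemma sin_ge_third:
  fixes x :: real
  assumes "0 \<le> x" "x \<le> 2"
  shows "x / 3 \<le> sin x"
proof -
  have "\<bar>sin x - (\<Sum>m<3. sin_coeff m * x ^ m)\<bar> \<le> inverse (fact 3) * \<bar>x\<bar> ^ 3"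
    by (rule Maclaurin_sin_bound)
  then have "\<bar>sin x - x\<bar> \<le> x ^ 3 / 6"
    using assms by (simp add: sin_coeff_def eval_nat_numeral fact_numeral)
  moreover have "x ^ 3 \<le> 4 * x"
  proof -
    have "x * x \<le> 2 * 2" using assms by (intro mult_mono) auto
    then have "(x * x) * x \<le> 4 * x" using assms by (intro mult_right_mono) auto
    then show ?thesis by (simp add: power3_eq_cube)
  qed
  ultimately show ?thesis by linarith
qed

text \<open>The Dirichlet kernel; multiplied by the sine of the half angle, the sum
  telescopes.\<close>

lemma sum_cos_mult:
  "2 * sin (\<phi> / 2) * (\<Sum>i=1..J. cos (real i * \<phi>)) = sin ((real J + 1/2) * \<phi>) - sin (\<phi> / (2::real))"
proof (induction J)
  case 0 then show ?case by simp
next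
  case (Suc J)
  have "sin ((real (Suc J) + 1/2) * \<phi>) - sin ((real J + 1/2) * \<phi>)
      = 2 * sin (\<phi> / 2) * cos (real (Suc J) * \<phi>)"
    unfolding sin_diff_sin by (simp add: algebra_simps add_divide_distrib diff_divide_distrib)
  then show ?case using Suc by (simp add: algebra_simps)
qed

lemma sum_cos_le_half:
  fixes \<theta> :: real
  assumes "\<bar>\<theta>\<bar> \<le> 1 / 2" "2 \<le> real J * \<bar>\<theta>\<bar>"
  shows "(\<Sum>i=1..J. cos (real i * (2 * pi * \<theta>))) \<le> real J / 2"
proof -
  have ev: "cos (real i * (2 * pi * \<theta>)) = cos (real i * (2 * pi * \<bar>\<theta>\<bar>))" for i
    by (cases "\<theta> \<ge> 0") auto
  let ?t = "\<bar>\<theta>\<bar>"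
  let ?S = "\<Sum>i=1..J. cos (real i * (2 * pi * ?t))"
  have t0: "?t > 0" using assms(2) by (cases "\<theta> = 0") auto
  have "2 * ?t \<le> pi * ?t" using pi_ge_two t0 by (intro mult_right_mono) auto
  \<comment> \<open>\<open>pi < 4\<close> keeps the argument within the range \<open>[0, 2]\<close>
    of \<open>sin_ge_third\<close>.\<close>
  moreover have "pi * ?t \<le> 4 * (1 / 2)" using pi_less_4 assms(1) by (intro mult_mono) auto
  ultimately have s: "2 / 3 * ?t \<le> sin (pi * ?t)" using sin_ge_third[of "pi * ?t"] t0 by linarith
  have "2 * sin (pi * ?t) * ?S = sin ((real J + 1/2) * (2 * pi * ?t)) - sin (pi * ?t)"
    using sum_cos_mult[of "2 * pi * ?t" J] by simp
  also have "\<dots> \<le> 1" using s t0 sin_le_one[of "(real J + 1/2) * (2 * pi * ?t)"] by linarith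
  finally have 1: "2 * sin (pi * ?t) * ?S \<le> 1" .
  show ?thesis
  proof (cases "?S \<le> 0")
    case True then show ?thesis unfolding ev by linarith
  next
    case False
    have "(4 / 3 * ?t) * ?S \<le> (2 * sin (pi * ?t)) * ?S" using s False by (intro mult_right_mono) auto
    then have "(4 / 3 * ?t) * ?S \<le> 1" using 1 by linarith
    also have "1 \<le> (4 / 3 * ?t) * (real J / 2)" using assms(2) by (simp add: mult.commute)
    finally have "?S \<le> real J / 2" using t0 by (simp add: mult_le_cancel_left_pos)
    then show ?thesis unfolding ev .
  qed
qed

text \<open>If the angle is at least \<open>2 / J\<close> of a full turn, its first \<open>J\<close>
  multiples wind around the circle at least twice, and their cosines average to at most one
  half.\<close>

lemma sum_one_minus_cos_ge:
  assumes p: "p > 0" and far: "2 * int p \<le> int J * \<bar>smod (int p) m\<bar>"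
  shows "real J / 2 \<le> (\<Sum>i=1..J. 1 - cos (angle p (m * int i)))"
proof -
  define \<theta> where "\<theta> = real_of_int (smod (int p) m) / real p"
  have "\<bar>real_of_int (smod (int p) m)\<bar> \<le> real p / 2"
    using smod_bounds[of "int p" m] p by linarith
  then have "\<bar>\<theta>\<bar> \<le> 1 / 2" using p by (simp add: \<theta>_def field_simps)
  moreover have "2 \<le> real J * \<bar>\<theta>\<bar>"
  proof -
    have "real_of_int (2 * int p) \<le> real_of_int (int J * \<bar>smod (int p) m\<bar>)" using far by (simp only: of_int_le_iff)
    then show ?thesis using p by (simp add: \<theta>_def field_simps)
  qed
  ultimately have "(\<Sum>i=1..J. cos (real i * (2 * pi * \<theta>))) \<le> real J / 2" by (rule sum_cos_le_half)
  moreover have "cos (angle p (m * int i)) = cos (real i * (2 * pi * \<theta>))" for i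
  proof -
    have "int p dvd m * int i - smod (int p) m * int i"
      using smod_cong_dvd[of "int p" m] by (metis dvd_mult2 dvd_minus_iff left_diff_distrib minus_diff_eq)
    from cos_angle_cong[OF p this] show ?thesis by (simp add: angle_def \<theta>_def mult_ac)
  qed
  ultimately show ?thesis by (simp add: sum_subtractf)
qed

text \<open>Averaging over the multiples \<open>i e\<close> with \<open>i \<le> J\<close>, for which \<open>lam\<close> is still at most \<open>J \<tau>\<close>, rather
  than over \<open>e \<in> E\<close> alone is what brings most \<open>e \<xi>\<close> down to size \<open>O(p / J)\<close>.\<close>

lemma ex_concentrating_frequency:
  assumes X: "X \<subseteq> {0..<int p}" and p: "p > 1" and E: "finite E"
    and lamE: "\<And>e. e \<in> E \<Longrightarrow> real (lam (int p) X e) \<le> \<tau>"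
  shows "\<exists>\<xi>\<in>{1..<p}. real (card {e \<in> E. 2 * int p \<le> int J * \<bar>smod (int p) (e * int \<xi>)\<bar>})
      * (real (card X) * (real p - real (card X))) \<le> 2 * real (card E) * real p * real J * \<tau>"
proof (rule ccontr)
  assume neg: "\<not> ?thesis"
  have p0: "p > 0" using p by simp
  define bad where "bad \<xi> = {e \<in> E. 2 * int p \<le> int J * \<bar>smod (int p) (e * int \<xi>)\<bar>}" for \<xi>
  \<comment> \<open>\<open>W\<close> is the total energy of the nonzero frequencies. With the
    energies as weights, it suffices that the weighted mean of \<open>card (bad \<xi>)\<close> is at
    most \<open>Q / W\<close>.\<close>
  define W where "W = real (card X) * (real p - real (card X))"
  define Q where "Q = 2 * real (card E) * real p * real J * \<tau>"
  have bad: "Q < real (card (bad \<xi>)) * W" if "\<xi> \<in> {1..<p}" for \<xi>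
    using neg that unfolding bad_def W_def Q_def by force
  have cX: "card X \<le> p" using card_mono[OF _ X] by simp
  have J0: "J > 0"
  proof (rule ccontr)
    assume "\<not> J > 0"
    then have "bad 1 = {}" "Q = 0" using p by (auto simp: bad_def Q_def)
    then show False using bad[of 1] p by simp
  qed
  have \<tau>0: "\<tau> \<ge> 0"
  proof (rule ccontr)
    assume "\<not> \<tau> \<ge> 0"
    then have "E = {}" using lamE by fastforce
    then show False using bad[of 1] p by (simp add: bad_def Q_def)
  qed
  have W0: "W > 0"
  proof (rule ccontr)
    assume "\<not> W > 0"
    then have "W = 0" using cX unfolding W_def by (auto simp: zero_less_mult_iff)
    moreover have "Q \<ge> 0" using \<tau>0 by (simp add: Q_def)
    ultimately show False using bad[of 1] p by simp
  qed
  have ptw: "(\<Sum>\<xi><p. energy p X \<xi> * (1 - cos (angle p (e * int i * int \<xi>)))) \<le> real p * (real J * \<tau>)"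
    if "e \<in> E" "i \<in> {1..J}" for e i
  proof -
    have "real (lam (int p) X (e * int i)) \<le> real (i * lam (int p) X e)"
      using lam_mult[OF X, of i e] by (simp add: mult.commute flip: of_nat_mult)
    also have "\<dots> \<le> real J * \<tau>"
      unfolding of_nat_mult using that lamE[OF that(1)] \<tau>0 by (intro mult_mono) auto
    finally show ?thesis unfolding sum_energy_one_minus_cos[OF X p0] by (intro mult_left_mono) auto
  qed
  have "W * Q = (\<Sum>\<xi>=1..<p. energy p X \<xi> * Q)"
    unfolding W_def sum_energy_nonzero[OF X p0, symmetric] sum_distrib_right ..
  also have "\<dots> < (\<Sum>\<xi>=1..<p. energy p X \<xi> * (real (card (bad \<xi>)) * W))"
  proof (rule sum_strict_mono_ex1)
    show "\<forall>\<xi>\<in>{1..<p}. energy p X \<xi> * Q \<le> energy p X \<xi> * (real (card (bad \<xi>)) * W)"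
      using bad energy_nonneg by (intro ballI mult_left_mono) (auto intro: less_imp_le)
    have "\<exists>\<xi>\<in>{1..<p}. energy p X \<xi> \<noteq> 0"
    proof (rule ccontr)
      assume "\<not> ?thesis"
      then have "(\<Sum>\<xi>=1..<p. energy p X \<xi>) = 0" by (intro sum.neutral) auto
      then show False using W0 sum_energy_nonzero[OF X p0] unfolding W_def by linarith
    qed
    then obtain \<xi> where "\<xi> \<in> {1..<p}" "energy p X \<xi> > 0" using energy_nonneg by (metis less_le)
    then show "\<exists>\<xi>\<in>{1..<p}. energy p X \<xi> * Q < energy p X \<xi> * (real (card (bad \<xi>)) * W)"
      using bad by (intro bexI[of _ \<xi>] mult_strict_left_mono) auto
  qed auto
  also have "\<dots> = W * (\<Sum>\<xi>=1..<p. energy p X \<xi> * real (card (bad \<xi>)))"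
    by (simp add: sum_distrib_left mult_ac)
  finally have 1: "Q < (\<Sum>\<xi>=1..<p. energy p X \<xi> * real (card (bad \<xi>)))"
    using W0 by simp
  \<comment> \<open>Double counting: at each frequency a bad \<open>e\<close> contributes at least
    \<open>J / 2\<close>, while over all frequencies a pair of \<open>e\<close> and \<open>i\<close>
    contributes at most \<open>p * J * \<tau>\<close>.\<close>
  have "(real J / 2) * (\<Sum>\<xi>=1..<p. energy p X \<xi> * real (card (bad \<xi>)))
      \<le> (\<Sum>\<xi>=1..<p. energy p X \<xi> * (\<Sum>e\<in>E. \<Sum>i=1..J. 1 - cos (angle p (e * int i * int \<xi>))))"
    unfolding sum_distrib_left
  proof (rule sum_mono)
    fix \<xi>
    have nn: "0 \<le> (\<Sum>i=1..J. 1 - cos (angle p (e * int i * int \<xi>)))" for e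
      by (intro sum_nonneg) simp
    have "real (card (bad \<xi>)) * (real J / 2) = (\<Sum>e\<in>bad \<xi>. real J / 2)" by simp
    also have "\<dots> \<le> (\<Sum>e\<in>bad \<xi>. \<Sum>i=1..J. 1 - cos (angle p (e * int i * int \<xi>)))"
    proof (rule sum_mono)
      fix e assume "e \<in> bad \<xi>"
      then have "2 * int p \<le> int J * \<bar>smod (int p) (e * int \<xi>)\<bar>" by (simp add: bad_def)
      from sum_one_minus_cos_ge[OF p0 this]
      show "real J / 2 \<le> (\<Sum>i=1..J. 1 - cos (angle p (e * int i * int \<xi>)))"
        by (simp add: mult_ac)
    qed
    also have "\<dots> \<le> (\<Sum>e\<in>E. \<Sum>i=1..J. 1 - cos (angle p (e * int i * int \<xi>)))"
      using E nn by (intro sum_mono2) (auto simp: bad_def)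
    finally have "energy p X \<xi> * (real (card (bad \<xi>)) * (real J / 2))
      \<le> energy p X \<xi> * (\<Sum>e\<in>E. \<Sum>i=1..J. 1 - cos (angle p (e * int i * int \<xi>)))"
      by (intro mult_left_mono energy_nonneg)
    then show "real J / 2 * (energy p X \<xi> * real (card (bad \<xi>)))
      \<le> (\<Sum>n\<in>E. \<Sum>i=1..J. energy p X \<xi> * (1 - cos (angle p (n * int i * int \<xi>))))"
      by (simp add: sum_distrib_left mult_ac)
  qed
  also have "\<dots> \<le> (\<Sum>\<xi><p. energy p X \<xi> * (\<Sum>e\<in>E. \<Sum>i=1..J. 1 - cos (angle p (e * int i * int \<xi>))))"
    by (intro sum_mono2) (auto intro!: mult_nonneg_nonneg energy_nonneg sum_nonneg)
  also have "\<dots> = (\<Sum>\<xi><p. \<Sum>e\<in>E. \<Sum>i=1..J. energy p X \<xi> * (1 - cos (angle p (e * int i * int \<xi>))))"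
    by (simp add: sum_distrib_left)
  also have "\<dots> = (\<Sum>e\<in>E. \<Sum>\<xi><p. \<Sum>i=1..J. energy p X \<xi> * (1 - cos (angle p (e * int i * int \<xi>))))"
    by (rule sum.swap)
  also have "\<dots> = (\<Sum>e\<in>E. \<Sum>i=1..J. \<Sum>\<xi><p. energy p X \<xi> * (1 - cos (angle p (e * int i * int \<xi>))))"
    by (intro sum.cong refl sum.swap)
  also have "\<dots> \<le> (\<Sum>e\<in>E. \<Sum>i=1..J. real p * (real J * \<tau>))"
    by (intro sum_mono ptw)
  also have "\<dots> = (real J / 2) * Q" by (simp add: Q_def)
  finally have "(\<Sum>\<xi>=1..<p. energy p X \<xi> * real (card (bad \<xi>))) \<le> Q"
    using J0 by (simp add: mult_le_cancel_left_pos)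
  then show False using 1 by simp
qed

lemma floor_ge_half:
  fixes x :: real
  assumes "x \<ge> 1"
  shows "x / 2 \<le> real (nat \<lfloor>x\<rfloor>)" "real (nat \<lfloor>x\<rfloor>) \<le> x" "1 \<le> nat \<lfloor>x\<rfloor>"
proof -
  have "1 \<le> \<lfloor>x\<rfloor>" using assms by (simp add: le_floor_iff)
  moreover have "x < real_of_int \<lfloor>x\<rfloor> + 1" by linarith
  moreover have "real_of_int \<lfloor>x\<rfloor> \<le> x" by simp
  ultimately show "x / 2 \<le> real (nat \<lfloor>x\<rfloor>)" "real (nat \<lfloor>x\<rfloor>) \<le> x" "1 \<le> nat \<lfloor>x\<rfloor>"
    by linarith+
qed

text \<open>\<open>c * p * p\<close> is to be a lower bound for
  \<open>card X * (p - card X)\<close>: the factor 12288 = 48 * 16 * 16 comes from the quadratic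
  growth with \<open>n\<close> at least \<open>\<epsilon> * card A / 16\<close>, and 2400 from the
  co-density.\<close>

lemma ex_concentrating_dilate_aux:
  fixes p :: nat and \<epsilon> c :: real
  assumes p: "prime p" and pl: "2400 \<le> p" and z: "zsf (int p) A" and inj: "inj_on (\<lambda>a. a mod int p) A"
    and \<epsilon>: "0 < \<epsilon>" "\<epsilon> \<le> 1" and c: "c = \<epsilon>\<^sup>2 / 12288 / 2400"
    and k: "p \<le> card A * card A" and big: "128 / (c * \<epsilon>\<^sup>2) \<le> sqrt (real p)"
  shows "\<exists>\<xi>\<in>{1..<p}. real (card {a \<in> A. \<bar>smod (int p) (a * int \<xi>)\<bar> > (256 / (c * \<epsilon>\<^sup>2)) * sqrt (real p)})
      \<le> \<epsilon> * real (card A)"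
proof -
  define k where "k = card A"
  have finA: "finite A" using z zsf_finite by blast
  have p': "prime (int p)" using p by simp
  have "\<epsilon>\<^sup>2 \<le> 1" using \<epsilon> by (simp add: power_le_one)
  then have c0: "c > 0" "c \<le> 1" using \<epsilon> unfolding c by auto
  have "sqrt (real p) \<le> sqrt (real k * real k)"
    using assms(8) unfolding k_def by (intro real_sqrt_le_mono) (simp flip: of_nat_mult)
  then have sk: "sqrt (real p) \<le> real k" by simp
  have \<epsilon>2: "\<epsilon>\<^sup>2 \<le> \<epsilon>" "\<epsilon>\<^sup>2 > 0" using \<epsilon> by (auto simp: power2_eq_square mult_left_le)
  have ce: "c * \<epsilon>\<^sup>2 > 0" "c * \<epsilon>\<^sup>2 \<le> \<epsilon>"
  proof -
    show "c * \<epsilon>\<^sup>2 > 0" using c0 \<epsilon>2 by simp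
    have "c * \<epsilon>\<^sup>2 \<le> 1 * \<epsilon>\<^sup>2" using c0 \<epsilon>2 by (intro mult_right_mono) auto
    then show "c * \<epsilon>\<^sup>2 \<le> \<epsilon>" using \<epsilon>2 by linarith
  qed
  have kb: "128 \<le> c * \<epsilon>\<^sup>2 * real k"
    using order.trans[OF big sk] ce by (simp add: divide_le_eq mult.commute)
  also have "\<dots> \<le> \<epsilon> * real k" using ce by (intro mult_right_mono) auto
  finally have ek: "128 \<le> \<epsilon> * real k" .
  also have "\<dots> \<le> 1 * real k" using \<epsilon> by (intro mult_right_mono) auto
  finally have k128: "128 \<le> k" by simp
  \<comment> \<open>\<open>B\<close> is written off as exceptional; with this \<open>n\<close> it
    takes at most a quarter of the allowance \<open>\<epsilon> * k\<close>.\<close>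
  define n where "n = nat \<lfloor>\<epsilon> * real k / 8\<rfloor>"
  have n: "\<epsilon> * real k / 16 \<le> real n" "real n \<le> \<epsilon> * real k / 8" "1 \<le> n"
    using floor_ge_half[of "\<epsilon> * real k / 8"] ek unfolding n_def by auto
  have "\<epsilon> * real k \<le> 1 * real k" using \<epsilon> by (intro mult_right_mono) auto
  then have n8: "8 * n \<le> k" using n by linarith
  obtain B where B: "B \<subseteq> A" "card B \<le> 2 * n"
    and lamB: "\<And>e. e \<in> A - B \<Longrightarrow> int (n * lam (int p) (sums_mod (int p) B) e) \<le> int p"
    and large: "int p < 4 * int (card (sums_mod (int p) B)) \<or> n * n \<le> 48 * card (sums_mod (int p) B)"
    and small: "int p \<le> 2400 * (int p - int (card (sums_mod (int p) B)))"
  proof -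
    have "0 < n" "int p \<le> int (card A) * int (card A)" "20 \<le> card A" "2400 \<le> int p" "8 * n \<le> card A"
      using n n8 k128 assms(8) pl unfolding k_def by (auto simp flip: of_nat_mult)
    from ex_almost_invariant_sums_mod[OF p' z inj this(1) this(5) this(2,3,4)] that show ?thesis by blast
  qed
  let ?X = "sums_mod (int p) B"
  define N where "N = real (card ?X)"
  have p0: "int p > 0" "real p > 0" using pl by auto
  have N1: "c * 2400 * real p \<le> N"
    using large
  proof
    assume "int p < 4 * int (card ?X)"
    then have "real p / 4 \<le> N" by (simp add: N_def)
    moreover have "c * 2400 * real p \<le> 1 / 4 * real p"
      using \<epsilon>2 \<epsilon> by (intro mult_right_mono) (auto simp: c)
    ultimately show ?thesis by simp
  next
    assume "n * n \<le> 48 * card ?X"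
    then have "real (n * n) \<le> real (48 * card ?X)" by (simp only: of_nat_le_iff)
    then have "real n * real n \<le> 48 * N" by (simp add: N_def)
    moreover have "(\<epsilon> * real k / 16) * (\<epsilon> * real k / 16) \<le> real n * real n"
      using n \<epsilon> by (intro mult_mono) auto
    moreover have "\<epsilon>\<^sup>2 * real p \<le> \<epsilon>\<^sup>2 * (real k * real k)"
      using assms(8) unfolding k_def by (intro mult_left_mono) (auto simp flip: of_nat_mult)
    ultimately show ?thesis by (simp add: c power2_eq_square algebra_simps)
  qed
  have N2: "real p / 2400 \<le> real p - N"
  proof -
    have "real_of_int (int p) \<le> real_of_int (2400 * (int p - int (card ?X)))" using small by (simp only: of_int_le_iff)
    then show ?thesis by (simp add: N_def)
  qed
  have "(c * 2400 * real p) * (real p / 2400) \<le> N * (real p - N)"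
    using N1 N2 c0 by (intro mult_mono) (auto simp: N_def)
  then have W: "c * real p * real p \<le> N * (real p - N)" by simp
  \<comment> \<open>Chosen so that the frequency bound leaves at most
    \<open>\<epsilon> / 2 * k\<close> bad elements. The norm threshold \<open>2 * p / J\<close> is
    of order sqrt p, because \<open>n\<close> is at least of that order.\<close>
  define J where "J = nat \<lfloor>real n * c * \<epsilon> / 4\<rfloor>"
  have "1 \<le> real n * c * \<epsilon> / 4"
  proof -
    have "\<epsilon> * real k / 16 * (c * \<epsilon>) \<le> real n * (c * \<epsilon>)" using n c0 \<epsilon> by (intro mult_right_mono) auto
    then show ?thesis using kb by (simp add: power2_eq_square algebra_simps)
  qed
  note J = floor_ge_half[OF this, folded J_def]
  define \<tau> where "\<tau> = real p / real n"
  have lamE: "real (lam (int p) ?X e) \<le> \<tau>" if "e \<in> A - B" for e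
  proof -
    have "n * lam (int p) ?X e \<le> p" using lamB[OF that] by (simp flip: of_nat_mult)
    then have "real n * real (lam (int p) ?X e) \<le> real p" by (simp flip: of_nat_mult)
    then show ?thesis using n unfolding \<tau>_def by (simp add: le_divide_eq mult.commute)
  qed
  obtain \<xi> where \<xi>: "\<xi> \<in> {1..<p}"
    and bad: "real (card {e \<in> A - B. 2 * int p \<le> int J * \<bar>smod (int p) (e * int \<xi>)\<bar>})
      * (real (card ?X) * (real p - real (card ?X))) \<le> 2 * real (card (A - B)) * real p * real J * \<tau>"
    using ex_concentrating_frequency[OF sums_mod_range[OF p0(1)] _ _ lamE, of "A - B" J] pl finA by auto
  let ?bad = "{e \<in> A - B. 2 * int p \<le> int J * \<bar>smod (int p) (e * int \<xi>)\<bar>}"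
  have cb: "real (card ?bad) \<le> \<epsilon> / 2 * real k"
  proof -
    have "real (card ?bad) * (c * real p * real p) \<le> real (card ?bad) * (N * (real p - N))"
      using W by (intro mult_left_mono) auto
    also have "\<dots> \<le> 2 * real (card (A - B)) * real p * real J * \<tau>" using bad by (simp add: N_def)
    also have "\<dots> = (2 * real p * \<tau>) * (real (card (A - B)) * real J)" by simp
    also have "\<dots> \<le> (2 * real p * \<tau>) * (real k * (real n * c * \<epsilon> / 4))"
      using J finA unfolding k_def \<tau>_def by (intro mult_left_mono mult_mono) (auto intro: card_mono)
    also have "\<dots> = (\<epsilon> / 2 * real k) * (c * real p * real p)"
      using n unfolding \<tau>_def by simp
    finally show ?thesis using c0 p0 by simp
  qed
  have "{a \<in> A. \<bar>smod (int p) (a * int \<xi>)\<bar> > (256 / (c * \<epsilon>\<^sup>2)) * sqrt (real p)} \<subseteq> B \<union> ?bad"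
  proof
    fix a assume "a \<in> {a \<in> A. \<bar>smod (int p) (a * int \<xi>)\<bar> > (256 / (c * \<epsilon>\<^sup>2)) * sqrt (real p)}"
    then have a: "a \<in> A" and gt: "real_of_int \<bar>smod (int p) (a * int \<xi>)\<bar> > (256 / (c * \<epsilon>\<^sup>2)) * sqrt (real p)" by auto
    have "2 * int p \<le> int J * \<bar>smod (int p) (a * int \<xi>)\<bar>"
    proof -
      have "c * \<epsilon>\<^sup>2 * real k / 128 \<le> real J"
      proof -
        have "(\<epsilon> * real k / 16) * (c * \<epsilon>) \<le> real n * (c * \<epsilon>)" using n c0 \<epsilon> by (intro mult_right_mono) auto
        then show ?thesis using J(1) by (simp add: power2_eq_square algebra_simps)
      qed
      moreover have "c * \<epsilon>\<^sup>2 * sqrt (real p) / 128 \<le> c * \<epsilon>\<^sup>2 * real k / 128"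
        using sk ce(1) by (intro divide_right_mono mult_left_mono) auto
      ultimately have J': "c * \<epsilon>\<^sup>2 * sqrt (real p) / 128 \<le> real J" by linarith
      have "2 * real p = (c * \<epsilon>\<^sup>2 * sqrt (real p) / 128) * ((256 / (c * \<epsilon>\<^sup>2)) * sqrt (real p))"
        using c0 \<epsilon>2(2) by simp
      also have "\<dots> \<le> real J * real_of_int \<bar>smod (int p) (a * int \<xi>)\<bar>"
        using J' gt ce by (intro mult_mono) auto
      finally have "real_of_int (2 * int p) \<le> real_of_int (int J * \<bar>smod (int p) (a * int \<xi>)\<bar>)" by simp
      then show ?thesis by (simp only: of_int_le_iff)
    qed
    then show "a \<in> B \<union> ?bad" using a by blast
  qed
  then have "card {a \<in> A. \<bar>smod (int p) (a * int \<xi>)\<bar> > (256 / (c * \<epsilon>\<^sup>2)) * sqrt (real p)} \<le> card (B \<union> ?bad)"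
    using finA B finite_subset by (intro card_mono) auto
  also have "\<dots> \<le> card B + card ?bad" by (rule card_Un_le)
  finally have "real (card {a \<in> A. \<bar>smod (int p) (a * int \<xi>)\<bar> > (256 / (c * \<epsilon>\<^sup>2)) * sqrt (real p)})
      \<le> real (card B) + real (card ?bad)" by linarith
  also have "\<dots> \<le> \<epsilon> * real k" using cb B(2) n by linarith
  finally show ?thesis using \<xi> unfolding k_def by blast
qed

lemma ex_concentrating_dilate:
  fixes \<epsilon> :: real
  assumes \<epsilon>: "0 < \<epsilon>" "\<epsilon> \<le> 1"
  shows "\<exists>(K::real) (p\<^sub>0::nat). K > 0 \<and> (\<forall>p A. prime p \<longrightarrow> p\<^sub>0 \<le> p \<longrightarrow> zsf (int p) A \<longrightarrow>
     inj_on (\<lambda>a. a mod int p) A \<longrightarrow> p \<le> card A * card A \<longrightarrow>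
     (\<exists>\<xi>\<in>{1..<p}. real (card {a \<in> A. \<bar>smod (int p) (a * int \<xi>)\<bar> > K * sqrt (real p)}) \<le> \<epsilon> * real (card A)))"
proof -
  define c where "c = \<epsilon>\<^sup>2 / 12288 / 2400"
  have c0: "c * \<epsilon>\<^sup>2 > 0" using \<epsilon> by (simp add: c_def)
  define p0 where "p0 = nat \<lceil>(128 / (c * \<epsilon>\<^sup>2))\<^sup>2\<rceil> + 2400"
  have big: "128 / (c * \<epsilon>\<^sup>2) \<le> sqrt (real p)" if "p0 \<le> p" for p
  proof (rule real_le_rsqrt)
    have "(128 / (c * \<epsilon>\<^sup>2))\<^sup>2 \<le> real (nat \<lceil>(128 / (c * \<epsilon>\<^sup>2))\<^sup>2\<rceil>)" by (rule real_nat_ceiling_ge)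
    also have "\<dots> \<le> real p" using that by (simp add: p0_def)
    finally show "(128 / (c * \<epsilon>\<^sup>2))\<^sup>2 \<le> real p" .
  qed
  show ?thesis
    by (rule exI[of _ "256 / (c * \<epsilon>\<^sup>2)"], rule exI[of _ p0], intro conjI allI impI)
       (use c0 \<epsilon> big ex_concentrating_dilate_aux[OF _ _ _ _ \<epsilon> c_def] in \<open>auto simp: p0_def\<close>)
qed

section \<open>Progressions among subset sums of dense sets of integers\<close>

text \<open>Unlike in \<open>sums_mod\<close>, sums are taken in the integers and the empty one is
  excluded, so that for a zero-sum-free set no member is divisible by \<open>p\<close>.\<close>

definition nonempty_sums :: "int set \<Rightarrow> int set" where
  "nonempty_sums F = {\<Sum>C | C. C \<subseteq> F \<and> C \<noteq> {}}"

text \<open>The progression has \<open>l + 1\<close> terms.\<close>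

definition has_ap :: "int set \<Rightarrow> int \<Rightarrow> int \<Rightarrow> int \<Rightarrow> bool" where
  "has_ap F u d l \<longleftrightarrow> (\<forall>i\<in>{0..l}. u + i * d \<in> nonempty_sums F)"

lemma nonempty_sumsI: "C \<subseteq> F \<Longrightarrow> C \<noteq> {} \<Longrightarrow> s = \<Sum>C \<Longrightarrow> s \<in> nonempty_sums F"
  unfolding nonempty_sums_def by blast

lemma nonempty_sums_mono: "F \<subseteq> G \<Longrightarrow> nonempty_sums F \<subseteq> nonempty_sums G"
  unfolding nonempty_sums_def by blast

lemma nonempty_sums_Un:
  assumes "finite F" "finite G" "F \<inter> G = {}" "s \<in> nonempty_sums F" "C \<subseteq> G"
  shows "s + \<Sum>C \<in> nonempty_sums (F \<union> G)"
proof -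
  obtain B where B: "B \<subseteq> F" "B \<noteq> {}" "s = \<Sum>B" using assms(4) unfolding nonempty_sums_def by blast
  have "\<Sum>(B \<union> C) = \<Sum>B + \<Sum>C"
    using assms B by (intro sum.union_disjoint) (auto intro: finite_subset)
  then show ?thesis using B assms(5) by (intro nonempty_sumsI[of "B \<union> C"]) auto
qed

lemma nonempty_sums_insert:
  assumes "finite F" "x \<notin> F" "s \<in> nonempty_sums F"
  shows "s + x \<in> nonempty_sums (insert x F)"
  using nonempty_sums_Un[OF assms(1) _ _ assms(3), of "{x}" "{x}"] assms(2) by simp

text \<open>Exactly one of \<open>x\<close> and \<open>y\<close> enters each sum. Using
  \<open>y\<close> instead of \<open>x\<close> shifts the progression by \<open>q\<close> terms, and
  \<open>q \<le> l + 1\<close> leaves no gap. Only the difference has to be a multiple of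
  \<open>d\<close>, so pairs serve while nothing is known about divisibility of single
  elements.\<close>

lemma has_ap_pair:
  assumes fin: "finite F" and x: "x \<notin> F" "y \<notin> F" and ap: "has_ap F u d l"
    and y: "y = x + q * d" and q: "0 < q" "q \<le> l + 1"
  shows "has_ap (insert x (insert y F)) (u + x) d (l + q)"
  unfolding has_ap_def
proof
  fix i assume i: "i \<in> {0..l + q}"
  show "u + x + i * d \<in> nonempty_sums (insert x (insert y F))"
  proof (cases "i \<le> l")
    case True
    then have "u + i * d \<in> nonempty_sums F" using ap i by (auto simp: has_ap_def)
    from nonempty_sums_insert[OF fin x(1) this]
    show ?thesis using nonempty_sums_mono[of "insert x F" "insert x (insert y F)"]
      by (auto simp: algebra_simps)
  next
    case False
    then have "i - q \<in> {0..l}" using i q by auto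
    then have "u + (i - q) * d \<in> nonempty_sums F" using ap by (auto simp: has_ap_def)
    from nonempty_sums_insert[OF fin x(2) this]
    show ?thesis using nonempty_sums_mono[of "insert y F" "insert x (insert y F)"] y
      by (auto simp: algebra_simps)
  qed
qed

lemma has_ap_insert_nonneg:
  assumes fin: "finite F" and x: "x \<notin> F" "x = q * d" and ap: "has_ap F u d l" and q: "0 \<le> q" "q \<le> l + 1"
  shows "has_ap (insert x F) u d (l + q)"
  unfolding has_ap_def
proof
  fix i assume i: "i \<in> {0..l + q}"
  show "u + i * d \<in> nonempty_sums (insert x F)"
  proof (cases "i \<le> l")
    case True
    then have "u + i * d \<in> nonempty_sums F" using ap i by (auto simp: has_ap_def)
    then show ?thesis using nonempty_sums_mono[of F "insert x F"] by auto
  next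
    case False
    then have "i - q \<in> {0..l}" using i q by auto
    then have "u + (i - q) * d \<in> nonempty_sums F" using ap by (auto simp: has_ap_def)
    from nonempty_sums_insert[OF fin x(1) this] show ?thesis using x(2) by (simp add: algebra_simps)
  qed
qed

text \<open>A negative multiple prolongs the progression downwards: its start moves by
  \<open>x\<close>, its end stays.\<close>

lemma has_ap_insert_neg:
  assumes fin: "finite F" and x: "x \<notin> F" "x = - q * d" and ap: "has_ap F u d l" and q: "0 \<le> q" "q \<le> l + 1"
  shows "has_ap (insert x F) (u + x) d (l + q)"
  unfolding has_ap_def
proof
  fix i assume i: "i \<in> {0..l + q}"
  show "u + x + i * d \<in> nonempty_sums (insert x F)"
  proof (cases "i \<le> l")
    case True
    then have "u + i * d \<in> nonempty_sums F" using ap i by (auto simp: has_ap_def)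
    from nonempty_sums_insert[OF fin x(1) this] show ?thesis by (simp add: algebra_simps)
  next
    case False
    then have "i - q \<in> {0..l}" using i q by auto
    then have "u + (i - q) * d \<in> nonempty_sums F" using ap by (auto simp: has_ap_def)
    then show ?thesis using nonempty_sums_mono[of F "insert x F"] x(2) by (auto simp: algebra_simps)
  qed
qed

text \<open>Each pair \<open>y\<close>, \<open>y + d\<close> adds one term. To keep the pairs
  disjoint, the choice of \<open>y\<close> also rules out \<open>y - d\<close> and
  \<open>y + d\<close>, so each step uses up three elements of \<open>Y\<close>.\<close>

lemma ex_ap_from_equal_gaps:
  fixes d :: int
  assumes "finite Y" "3 * Suc j \<le> card Y" "d > 0"
  shows "\<exists>F u. F \<subseteq> Y \<union> (\<lambda>y. y + d) ` Y \<and> card F \<le> 2 * Suc j \<and> has_ap F u d (int (Suc j))"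
  using assms
proof (induction j arbitrary: Y)
  case 0
  then obtain y where y: "y \<in> Y" by fastforce
  have "has_ap {y, y + d} y d 1"
    unfolding has_ap_def
  proof
    fix i :: int assume "i \<in> {0..1}"
    then consider "i = 0" | "i = 1" by force
    then show "y + i * d \<in> nonempty_sums {y, y + d}"
      by cases (auto intro: nonempty_sumsI[of "{y}"] nonempty_sumsI[of "{y + d}"])
  qed
  moreover have "card {y, y + d} \<le> 2" by (simp add: card_insert_if)
  ultimately show ?case using y by (intro exI[of _ "{y, y + d}"] exI[of _ y]) auto
next
  case (Suc j)
  have "Y \<noteq> {}" using Suc.prems(2) by auto
  then obtain y where y: "y \<in> Y" by blast
  define Y' where "Y' = Y - {y, y - d, y + d}"
  have fY': "finite Y'" using Suc by (simp add: Y'_def)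
  have "card {y, y - d, y + d} \<le> 3" by (simp add: card_insert_if)
  then have "card Y - 3 \<le> card Y'"
    unfolding Y'_def using diff_card_le_card_Diff[of "{y, y - d, y + d}" Y] by simp
  then have "3 * Suc j \<le> card Y'" using Suc.prems(2) by simp
  from Suc.IH[OF fY' this Suc.prems(3)] obtain F u where F: "F \<subseteq> Y' \<union> (\<lambda>y. y + d) ` Y'"
    "card F \<le> 2 * Suc j" "has_ap F u d (int (Suc j))" by blast
  have fF: "finite F" using F(1) fY' finite_subset by blast
  have "y \<notin> Y' \<union> (\<lambda>y. y + d) ` Y'" "y + d \<notin> Y' \<union> (\<lambda>y. y + d) ` Y'"
    using Suc.prems(3) unfolding Y'_def by auto
  then have nin: "y \<notin> F" "y + d \<notin> F" using F(1) by blast+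
  have "has_ap (insert y (insert (y + d) F)) (u + y) d (int (Suc j) + 1)"
    using has_ap_pair[OF fF nin F(3), of 1] by simp
  moreover have "card (insert y (insert (y + d) F)) \<le> 2 * Suc (Suc j)"
    using F(2) fF by (simp add: card_insert_if)
  moreover have "insert y (insert (y + d) F) \<subseteq> Y \<union> (\<lambda>y. y + d) ` Y"
    using F(1) y unfolding Y'_def by auto
  ultimately show ?case by (intro exI[of _ "insert y (insert (y + d) F)"] exI[of _ "u + y"]) (simp add: add.commute)
qed

text \<open>Points of \<open>D\<close> with no larger element of \<open>D\<close> at distance below
  \<open>q\<close> lie in different blocks of length \<open>q\<close>. More than
  \<open>(q - 1) * n\<close> points remain, and one of their \<open>q - 1\<close> possible gaps is
  popular.\<close>

lemma ex_popular_gap: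
  fixes M q :: int
  assumes M0: "M \<ge> 0" and D: "D \<subseteq> {-M..M}" and q: "q > 1" and n: "0 \<le> n"
    and big: "int (card D) > (M div q - (- M) div q + 1) + (q - 1) * n"
  shows "\<exists>d\<in>{1..<q}. n < int (card {x \<in> D. x + d \<in> D})"
proof (rule ccontr)
  assume neg: "\<not> ?thesis"
  have fin: "finite D" using D finite_subset by blast
  define Y where "Y d = {x \<in> D. x + d \<in> D}" for d
  define Z where "Z = D - (\<Union>d\<in>{1..<q}. Y d)"
  have "inj_on (\<lambda>x. x div q) Z"
  proof (rule linorder_inj_onI')
    fix x y assume xy: "x \<in> Z" "y \<in> Z" "x < y"
    show "x div q \<noteq> y div q"
    proof
      assume "x div q = y div q"
      then have "y - x = y mod q - x mod q" by (metis add_diff_cancel_left mult_div_mod_eq)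
      then have "y - x < q" using q pos_mod_bound[of q y] pos_mod_sign[of q x] by linarith
      then have "x \<in> Y (y - x)" "y - x \<in> {1..<q}" using xy by (auto simp: Y_def Z_def)
      then show False using xy(1) by (auto simp: Z_def)
    qed
  qed
  moreover have "(\<lambda>x. x div q) ` Z \<subseteq> {(- M) div q..M div q}"
  proof
    fix z assume "z \<in> (\<lambda>x. x div q) ` Z"
    then obtain x where "x \<in> D" "z = x div q" unfolding Z_def by blast
    then show "z \<in> {(- M) div q..M div q}" using D q by (auto intro!: zdiv_mono1)
  qed
  ultimately have cZ: "card Z \<le> card {(- M) div q..M div q}" by (intro card_inj_on_le) auto
  have Yle: "card (Y d) \<le> nat n" if "d \<in> {1..<q}" for d using neg that n unfolding Y_def by force
  have "D \<subseteq> Z \<union> (\<Union>d\<in>{1..<q}. Y d)" by (auto simp: Z_def)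
  then have "card D \<le> card (Z \<union> (\<Union>d\<in>{1..<q}. Y d))"
    using fin by (intro card_mono) (auto simp: Z_def Y_def)
  also have "\<dots> \<le> card Z + card (\<Union>d\<in>{1..<q}. Y d)" by (rule card_Un_le)
  also have "card (\<Union>d\<in>{1..<q}. Y d) \<le> (\<Sum>d\<in>{1..<q}. card (Y d))" by (rule card_UN_le) simp
  also have "\<dots> \<le> (\<Sum>d\<in>{1..<q}. nat n)" by (intro sum_mono Yle)
  finally have "card D \<le> card {(- M) div q..M div q} + nat (q - 1) * nat n" using cZ by simp
  then have "int (card D) \<le> int (card {(- M) div q..M div q} + nat (q - 1) * nat n)"
    by (simp only: of_nat_le_iff)
  then have "int (card D) \<le> int (card {(- M) div q..M div q}) + (q - 1) * n"
    using q n by simp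
  moreover have "(- M) div q \<le> M div q" using q M0 by (intro zdiv_mono1) auto
  ultimately show False using big by simp
qed

text \<open>Pigeonhole over blocks of length \<open>L\<close> and residues modulo \<open>d\<close>:
  the extremes of a class with more than \<open>m\<close> elements are at least \<open>m\<close>
  apart.\<close>

lemma ex_long_difference:
  fixes M L d :: int
  assumes M0: "M \<ge> 0" and R: "R \<subseteq> {-M..M}" and L: "L > 0" and d: "d > 0" and m: "m > 0"
    and big: "int (card R) > int m * (d * (M div L - (- M) div L + 1))"
  shows "\<exists>x\<in>R. \<exists>y\<in>R. x < y \<and> d dvd y - x \<and> y - x < L \<and> int m \<le> y - x"
proof -
  have fin: "finite R" using R finite_subset by blast
  define Cl where "Cl = {(- M) div L..M div L} \<times> {0..<d}"
  define cl where "cl x = (x div L, x mod d)" for x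
  have cCl: "int (card Cl) = d * (M div L - (- M) div L + 1)"
  proof -
    have "(- M) div L \<le> M div L" using L M0 by (intro zdiv_mono1) auto
    then show ?thesis using d by (simp add: Cl_def card_cartesian_product)
  qed
  have clR: "cl x \<in> Cl" if "x \<in> R" for x
    using that R L d by (auto simp: Cl_def cl_def intro!: zdiv_mono1)
  have "\<exists>c\<in>Cl. m < card {x \<in> R. cl x = c}"
  proof (rule ccontr)
    assume neg: "\<not> ?thesis"
    have "R \<subseteq> (\<Union>c\<in>Cl. {x \<in> R. cl x = c})" using clR by blast
    then have "card R \<le> card (\<Union>c\<in>Cl. {x \<in> R. cl x = c})"
      using fin by (intro card_mono) (auto simp: Cl_def)
    also have "\<dots> \<le> (\<Sum>c\<in>Cl. card {x \<in> R. cl x = c})" by (rule card_UN_le) (simp add: Cl_def)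
    also have "\<dots> \<le> (\<Sum>c\<in>Cl. m)" using neg by (intro sum_mono) force
    finally have "card R \<le> card Cl * m" by simp
    then have "int (card R) \<le> int (card Cl) * int m" by (simp flip: of_nat_mult)
    then show False using big unfolding cCl by (simp add: mult.commute)
  qed
  then obtain c where c: "m < card {x \<in> R. cl x = c}" by blast
  define S where "S = {x \<in> R. cl x = c}"
  have S: "finite S" "S \<noteq> {}" using c fin unfolding S_def by (auto simp: card_gt_0_iff dest: gr_implies_not0)
  define x where "x = Min S"
  define y where "y = Max S"
  have xy: "x \<in> S" "y \<in> S" using S by (auto simp: x_def y_def)
  have "S \<subseteq> {x..y}" using S by (auto simp: x_def y_def)
  then have "card S \<le> card {x..y}" by (intro card_mono) auto
  then have my: "int m \<le> y - x" using c unfolding S_def[symmetric] by simp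
  have "x div L = y div L" "x mod d = y mod d" using xy by (auto simp: S_def cl_def)
  then have "y - x < L" "d dvd y - x"
  proof -
    assume "x div L = y div L"
    then have "y - x = y mod L - x mod L" by (metis add_diff_cancel_left mult_div_mod_eq)
    then show "y - x < L" using L pos_mod_bound[of L y] pos_mod_sign[of L x] by linarith
  next
    assume "x mod d = y mod d"
    then show "d dvd y - x" by (metis mod_eq_dvd_iff)
  qed
  then show ?thesis using xy my m unfolding S_def by (intro bexI[of _ x] bexI[of _ y]) auto
qed

text \<open>Each pair raises the span \<open>l * d\<close> by at least \<open>m\<close> at the cost
  of two elements. \<open>L\<close> is fixed by the initial length and stays admissible as the
  progression grows. If \<open>m\<close> is of order \<open>M\<close>, boundedly many pairs yield a
  span of many times \<open>M\<close>.\<close>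

lemma ap_extend_by_pairs:
  fixes M d :: int
  assumes M0: "M \<ge> 0" and D: "D \<subseteq> {-M..M}" and F0: "F0 \<subseteq> D" "has_ap F0 u0 d l0" and l0: "l0 \<ge> 0" and d: "d > 0" and m: "m > 0"
    and L: "L = (l0 + 1) * d"
    and big: "int (card D) > int (card F0) + 2 * int J + int m * (d * (M div L - (- M) div L + 1))"
  shows "\<exists>F u l. F \<subseteq> D \<and> card F \<le> card F0 + 2 * J \<and> has_ap F u d l \<and> l0 \<le> l \<and> int J * int m \<le> l * d"
  using big
proof (induction J)
  case 0 then show ?case using F0 l0 d by (intro exI[of _ F0] exI[of _ u0] exI[of _ l0]) auto
next
  case (Suc J)
  then obtain F u l where F: "F \<subseteq> D" "card F \<le> card F0 + 2 * J" "has_ap F u d l" "l0 \<le> l" "int J * int m \<le> l * d"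
    by auto
  have fin: "finite D" using D finite_subset by blast
  have finF: "finite F" using F fin finite_subset by blast
  have "int (card (D - F)) = int (card D) - int (card F)"
    using F fin finF by (simp add: card_Diff_subset card_mono)
  then have "int (card (D - F)) > int m * (d * (M div L - (- M) div L + 1))"
    using F Suc.prems by simp
  moreover have "L > 0" using L l0 d by simp
  ultimately obtain x y where xy: "x \<in> D - F" "y \<in> D - F" "x < y" "d dvd y - x" "y - x < L" "int m \<le> y - x"
    using ex_long_difference[OF M0, of "D - F" L d m] D d m by auto
  then obtain q where q: "y - x = d * q" by auto
  have q0: "0 < q" using q xy(3) d by (metis diff_gt_0_iff_gt zero_less_mult_pos)
  have "q * d < (l0 + 1) * d" using q xy(5) L by (simp add: mult.commute)
  then have "q \<le> l + 1" using F(4) d by simp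
  then have "has_ap (insert x (insert y F)) (u + x) d (l + q)"
    using has_ap_pair[OF finF _ _ F(3), of x y q] xy q q0 by (simp add: algebra_simps)
  moreover have "card (insert x (insert y F)) \<le> card F0 + 2 * Suc J"
    using F(2) finF by (simp add: card_insert_if)
  moreover have "int (Suc J) * int m \<le> (l + q) * d" using F(5) q xy(6) by (simp add: algebra_simps)
  ultimately show ?case using F xy q0
    by (intro exI[of _ "insert x (insert y F)"] exI[of _ "u + x"] exI[of _ "l + q"]) auto
qed

section \<open>Refining the common difference\<close>

lemma abs_sum_le:
  fixes M :: int
  assumes "C \<subseteq> {-M..M}"
  shows "\<bar>\<Sum>C\<bar> \<le> int (card C) * M"
proof -
  have "\<bar>\<Sum>C\<bar> \<le> (\<Sum>x\<in>C. \<bar>x\<bar>)" by (rule sum_abs)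
  also have "\<dots> \<le> (\<Sum>x\<in>C. M)" using assms by (intro sum_mono) (auto simp: abs_le_iff)
  finally show ?thesis by simp
qed

lemma sum_cong_const:
  fixes r d :: int
  assumes "\<And>x. x \<in> C \<Longrightarrow> x mod d = r mod d"
  shows "\<Sum>C mod d = (int (card C) * r) mod d"
proof -
  have "\<Sum>C mod d = (\<Sum>x\<in>C. x mod d) mod d" by (simp add: mod_sum_eq)
  also have "\<dots> = (\<Sum>x\<in>C. r mod d) mod d" using assms by simp
  finally show ?thesis by (simp add: mod_simps)
qed

text \<open>If \<open>d - 1\<close> elements share a residue \<open>r\<close> modulo \<open>d\<close>, their partial sums turn a progression of
  difference \<open>d\<close> into one of difference \<open>gcd r d\<close>.\<close>

lemma has_ap_gcd:
  fixes M d r :: int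
  assumes M: "M \<ge> 0" and d: "d > 0" and F: "finite F" "has_ap F u d l"
    and Y: "finite Y" "Y \<subseteq> {-M..M}" "Y \<inter> F = {}" "int (card Y) = d - 1" "\<And>y. y \<in> Y \<Longrightarrow> y mod d = r mod d"
    and l: "2 * M \<le> l"
  shows "has_ap (F \<union> Y) (u + d * M) (gcd r d) ((l - 2 * M) * (d div gcd r d))"
  unfolding has_ap_def
proof
  let ?g = "gcd r d"
  fix i assume i: "i \<in> {0..(l - 2 * M) * (d div ?g)}"
  have g0: "?g > 0" using d by simp
  have dg: "d div ?g * ?g = d" by simp
  have ig: "0 \<le> i * ?g" "i * ?g \<le> (l - 2 * M) * d"
  proof -
    show "0 \<le> i * ?g" using i by auto
    have "i * ?g \<le> (l - 2 * M) * (d div ?g) * ?g" using i g0 by (intro mult_right_mono) auto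
    then show "i * ?g \<le> (l - 2 * M) * d" by (simp only: mult.assoc dg)
  qed
  obtain x where x: "[r * x = ?g] (mod d)" using cong_solve_int by blast
  define j where "j = (x * i) mod d"
  have j: "0 \<le> j" "j < d" using d by (auto simp: j_def)
  have jr: "(j * r) mod d = (i * ?g) mod d"
  proof -
    have "(j * r) mod d = ((r * x) * i) mod d" by (simp add: j_def mod_simps mult_ac)
    also have "\<dots> = (?g * i) mod d" using x by (metis cong_def mod_mult_left_eq)
    finally show ?thesis by (simp add: mult.commute)
  qed
  \<comment> \<open>Any sum of \<open>j\<close> elements of \<open>Y\<close> is congruent to
    \<open>i * ?g\<close>. Every \<open>j\<close> up to \<open>d - 1\<close> may occur, hence the
    size of \<open>Y\<close>.\<close>
  obtain C where C: "C \<subseteq> Y" "card C = nat j"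
    using obtain_subset_with_card_n[of "nat j" Y] j Y(4) by (metis zle_diff1_eq nat_le_iff)
  have sC: "\<Sum>C mod d = (j * r) mod d" using sum_cong_const[of C d r] C Y(5) j by auto
  have aC: "\<bar>\<Sum>C\<bar> \<le> d * M"
  proof -
    have "\<bar>\<Sum>C\<bar> \<le> int (card C) * M" using C Y(2) by (intro abs_sum_le) auto
    also have "\<dots> \<le> d * M" using C j M by (intro mult_right_mono) auto
    finally show ?thesis .
  qed
  have "d dvd i * ?g - \<Sum>C" using sC jr by (simp add: mod_eq_dvd_iff[symmetric])
  \<comment> \<open>Sums over subsets of \<open>Y\<close> may be anywhere in
    \<open>[- d * M, d * M]\<close>; starting \<open>M\<close> terms later and stopping
    \<open>M\<close> terms earlier keeps the index \<open>k\<close> between 0 and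
    \<open>l\<close>.\<close>
  then have "d dvd d * M + (i * ?g - \<Sum>C)" by simp
  then obtain k where k: "d * M + (i * ?g - \<Sum>C) = d * k" by blast
  have "0 \<le> d * k" using k aC ig by linarith
  then have k0: "0 \<le> k" using d by (simp add: zero_le_mult_iff)
  have "d * k \<le> d * l" using k aC ig(2) by (simp add: algebra_simps)
  then have kl: "k \<le> l" using d by simp
  have "u + k * d \<in> nonempty_sums F" using F(2) k0 kl by (auto simp: has_ap_def)
  from nonempty_sums_Un[OF F(1) Y(1) _ this C(1)] Y(3)
  have "u + k * d + \<Sum>C \<in> nonempty_sums (F \<union> Y)" by auto
  moreover have "u + k * d + \<Sum>C = u + d * M + i * ?g" using k by (simp add: mult.commute)
  ultimately show "u + d * M + i * ?g \<in> nonempty_sums (F \<union> Y)" by simp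
qed

text \<open>Descent on \<open>d\<close>: if more than \<open>d * d\<close> elements outside
  \<open>F\<close> are not divisible by \<open>d\<close>, some nonzero residue class holds
  \<open>d - 1\<close> of them, and \<open>has_ap_gcd\<close> leads to a proper divisor
  \<open>g\<close>. The quadratic terms are budgets. A descent costs \<open>2 * d * M\<close> of the
  span and \<open>d - 1\<close> elements, both covered by the drop from \<open>d * d\<close> to
  \<open>g * g\<close>.\<close>

lemma ex_ap_almost_all_divisible:
  fixes M :: int
  assumes M: "M \<ge> 0" and D: "D \<subseteq> {-M..M}" and d: "d > 0"
    and F: "F \<subseteq> D" "has_ap F u (int d) l" "(2 + 2 * int d * int d) * M \<le> l * int d"
  shows "\<exists>d' F' u' l' D1. 0 < d' \<and> d' \<le> d \<and> F' \<subseteq> D \<and> has_ap F' u' (int d') l' \<and> card F' \<le> card F + d * d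
     \<and> 2 * M \<le> l' * int d' \<and> D1 \<subseteq> D - F' \<and> (\<forall>x\<in>D1. int d' dvd x) \<and> card D \<le> card D1 + card F + 2 * d * d"
  using d F
proof (induction d arbitrary: F u l rule: less_induct)
  case (less d)
  have fin: "finite D" using D finite_subset by blast
  have finF: "finite F" using less.prems fin finite_subset by blast
  define Z where "Z = {x \<in> D - F. \<not> int d dvd x}"
  have finZ: "finite Z" using fin by (simp add: Z_def)
  show ?case
  proof (cases "card Z \<le> d * d")
    case True
    define D1 where "D1 = D - F - Z"
    have "card D \<le> card (D1 \<union> (F \<union> Z))" using fin finF finZ by (intro card_mono) (auto simp: D1_def)
    also have "\<dots> \<le> card D1 + (card F + card Z)"
      using card_Un_le[of D1 "F \<union> Z"] card_Un_le[of F Z] by linarith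
    finally have "card D \<le> card D1 + card F + 2 * d * d" using True by simp
    moreover have "2 * M \<le> l * int d"
    proof -
      have "2 * M \<le> (2 + 2 * int d * int d) * M" using M by (intro mult_right_mono) auto
      then show ?thesis using less.prems(4) by linarith
    qed
    moreover have "\<forall>x\<in>D1. int d dvd x" by (auto simp: D1_def Z_def)
    ultimately show ?thesis using less.prems
      by (intro exI[of _ d] exI[of _ F] exI[of _ u] exI[of _ l] exI[of _ D1]) (auto simp: D1_def)
  next
    case False
    have "\<exists>r\<in>{1..<int d}. d - 1 \<le> card {x \<in> Z. x mod int d = r}"
    proof (rule ccontr)
      assume neg: "\<not> ?thesis"
      have "Z \<subseteq> (\<Union>r\<in>{1..<int d}. {x \<in> Z. x mod int d = r})"
      proof
        fix x assume x: "x \<in> Z"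
        have "x mod int d \<noteq> 0" using x by (auto simp: Z_def)
        moreover have "0 \<le> x mod int d" "x mod int d < int d" using less.prems(1) by simp_all
        ultimately have "x mod int d \<in> {1..<int d}" unfolding atLeastLessThan_iff by linarith
        then show "x \<in> (\<Union>r\<in>{1..<int d}. {x \<in> Z. x mod int d = r})" using x by blast
      qed
      then have "card Z \<le> card (\<Union>r\<in>{1..<int d}. {x \<in> Z. x mod int d = r})"
        using finZ by (intro card_mono) auto
      also have "\<dots> \<le> (\<Sum>r\<in>{1..<int d}. card {x \<in> Z. x mod int d = r})" by (rule card_UN_le) simp
      also have "\<dots> \<le> (\<Sum>r\<in>{1..<int d}. d)" using neg by (intro sum_mono) force
      also have "\<dots> \<le> d * d" by (simp add: nat_le_iff)
      finally show False using False by simp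
    qed
    then obtain r where r: "r \<in> {1..<int d}" and cr: "d - 1 \<le> card {x \<in> Z. x mod int d = r}" by blast
    obtain Y where Y: "Y \<subseteq> {x \<in> Z. x mod int d = r}" "card Y = d - 1"
      using obtain_subset_with_card_n[OF cr] by blast
    have finY: "finite Y" using Y(1) finZ finite_subset by fastforce
    have YD: "Y \<subseteq> D - F" using Y(1) by (auto simp: Z_def)
    define g where "g = nat (gcd r (int d))"
    have g: "int g = gcd r (int d)" by (simp add: g_def)
    have g0: "g > 0" using less.prems(1) by (simp add: g_def)
    have "gcd r (int d) \<le> r" using r by (intro zdvd_imp_le) auto
    then have gd: "int g \<le> int d - 1" using r unfolding g atLeastLessThan_iff by linarith
    then have gd': "g < d" by linarith
    define l' where "l' = (l - 2 * M) * (int d div int g)"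
    have ld: "l * int d - 2 * int d * M = l' * int g"
    proof -
      have "int d div int g * int g = int d" by (simp add: g)
      then show ?thesis by (simp add: l'_def algebra_simps)
    qed
    have lM: "2 * M \<le> l"
    proof -
      have "2 * M * int d \<le> (2 + 2 * int d * int d) * M"
      proof -
        have "1 * int d \<le> int d * int d" using less.prems(1) by (intro mult_right_mono) auto
        then have "2 * int d \<le> 2 + 2 * int d * int d" by simp
        then have "(2 * int d) * M \<le> (2 + 2 * int d * int d) * M" using M by (intro mult_right_mono) auto
        then show ?thesis by (simp add: mult_ac)
      qed
      then have "2 * M * int d \<le> l * int d" using less.prems(4) by linarith
      then show ?thesis using less.prems(1) by simp
    qed
    have r': "y mod int d = r mod int d" if "y \<in> Y" for y using that Y(1) r by auto
    have ap': "has_ap (F \<union> Y) (u + int d * M) (int g) l'"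
      unfolding l'_def g
      by (rule has_ap_gcd[OF M _ finF less.prems(3) finY _ _ _ r' lM])
         (use less.prems(1) YD D Y(2) in auto)
    have bd: "int g * int g \<le> (int d - 1) * (int d - 1)" using gd by (intro mult_mono) auto
    have span: "(2 + 2 * int g * int g) * M \<le> l' * int g"
    proof -
      have "2 + 2 * int g * int g \<le> 2 + 2 * int d * int d - 2 * int d"
        using bd less.prems(1) by (simp add: algebra_simps)
      then have "(2 + 2 * int g * int g) * M \<le> (2 + 2 * int d * int d - 2 * int d) * M"
        using M by (intro mult_right_mono) auto
      also have "\<dots> = (2 + 2 * int d * int d) * M - 2 * int d * M" by (simp add: algebra_simps)
      also have "\<dots> \<le> l' * int g" using less.prems(4) ld by linarith
      finally show ?thesis .
    qed
    have "F \<union> Y \<subseteq> D" using less.prems(2) YD by blast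
    from less.IH[OF gd' g0 this ap' span] obtain d' F' u' l'' D1 where IH: "0 < d'" "d' \<le> g" "F' \<subseteq> D"
      "has_ap F' u' (int d') l''" "card F' \<le> card (F \<union> Y) + g * g" "2 * M \<le> l'' * int d'" "D1 \<subseteq> D - F'"
      "\<forall>x\<in>D1. int d' dvd x" "card D \<le> card D1 + card (F \<union> Y) + 2 * g * g" 
      by (elim exE conjE) (rule that)
    have "int (g * g) + int d \<le> int (d * d) + 1" using bd less.prems(1) by (simp add: algebra_simps)
    then have gg: "g * g + (d - 1) \<le> d * d" using less.prems(1) by linarith
    have "card (F \<union> Y) \<le> card F + (d - 1)" using card_Un_le[of F Y] Y(2) by simp
    then have "card F' \<le> card F + d * d" "card D \<le> card D1 + card F + 2 * d * d"
      using IH(5,9) gg by linarith+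
    then show ?thesis using IH gd'
      by (intro exI[of _ d'] exI[of _ F'] exI[of _ u'] exI[of _ l''] exI[of _ D1]) simp
  qed
qed

text \<open>\<open>b1\<close>, \<open>b2\<close> and \<open>b3\<close> are what the three stages
  consume: a popular gap for an initial progression of \<open>Suc j\<close> steps, \<open>J\<close>
  pairs with a gain of \<open>m\<close> each, and the span required by the descent.\<close>

lemma ex_ap_dense_aux:
  fixes M q :: int
  assumes M: "M \<ge> 0" and D: "D \<subseteq> {-M..M}" and q: "q > 1" and m: "m > 0"
    and b1: "int (card D) > (M div q - (- M) div q + 1) + (q - 1) * (3 * int (Suc j))"
    and b2: "\<And>L. int (Suc j) < L \<Longrightarrow> int (card D) > 2 * int (Suc j) + 2 * int J + int m * (q * (M div L - (- M) div L + 1))"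
    and b3: "(2 + 2 * q * q) * M \<le> int J * int m"
  shows "\<exists>d' F' u' l' D1. 0 < d' \<and> F' \<subseteq> D \<and> has_ap F' u' d' l' \<and> int (card F') \<le> 2 * int (Suc j) + 2 * int J + q * q
     \<and> 2 * M \<le> l' * d' \<and> D1 \<subseteq> D - F' \<and> (\<forall>x\<in>D1. d' dvd x)
     \<and> int (card D) \<le> int (card D1) + 2 * int (Suc j) + 2 * int J + 2 * q * q"
proof -
  have fin: "finite D" using D finite_subset by blast
  obtain d where d: "d \<in> {1..<q}" and cd: "3 * int (Suc j) < int (card {x \<in> D. x + d \<in> D})"
    using ex_popular_gap[OF M D q _ b1] by auto
  define Y where "Y = {x \<in> D. x + d \<in> D}"
  have "finite Y" "3 * Suc j \<le> card Y" "d > 0" using fin cd d by (auto simp: Y_def)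
  from ex_ap_from_equal_gaps[OF this] obtain F0 u0 where F0: "F0 \<subseteq> Y \<union> (\<lambda>y. y + d) ` Y" "card F0 \<le> 2 * Suc j"
    "has_ap F0 u0 d (int (Suc j))" by blast
  have F0D: "F0 \<subseteq> D" using F0(1) by (auto simp: Y_def)
  define L where "L = (int (Suc j) + 1) * d"
  have "(int (Suc j) + 1) * 1 \<le> L" unfolding L_def using d by (intro mult_left_mono) auto
  then have L: "int (Suc j) < L" by simp
  have "(- M) div L \<le> M div L" using L M by (intro zdiv_mono1) auto
  then have "int m * (d * (M div L - (- M) div L + 1)) \<le> int m * (q * (M div L - (- M) div L + 1))"
    using d by (intro mult_left_mono mult_right_mono) auto
  then have "int (card D) > int (card F0) + 2 * int J + int m * (d * (M div L - (- M) div L + 1))"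
    using b2[OF L] F0(2) by linarith
  from ap_extend_by_pairs[OF M D F0D F0(3) _ _ m L_def this] d
  obtain F u l where F: "F \<subseteq> D" "card F \<le> card F0 + 2 * J" "has_ap F u d l" "int J * int m \<le> l * d" by auto
  define dn where "dn = nat d"
  have dn: "int dn = d" "dn > 0" using d by (auto simp: dn_def)
  have dq: "d * d \<le> q * q" using d by (intro mult_mono) auto
  have span: "(2 + 2 * int dn * int dn) * M \<le> l * int dn"
  proof -
    have "(2 + 2 * int dn * int dn) * M \<le> (2 + 2 * q * q) * M"
      using dq dn M by (intro mult_right_mono) auto
    then show ?thesis using F(4) b3 dn by simp
  qed
  have ap: "has_ap F u (int dn) l" using F(3) dn by simp
  from ex_ap_almost_all_divisible[OF M D dn(2) F(1) ap span] obtain d' F' u' l' D1 where res: "0 < d'" "F' \<subseteq> D" "has_ap F' u' (int d') l'" "card F' \<le> card F + dn * dn"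
    "2 * M \<le> l' * int d'" "D1 \<subseteq> D - F'" "\<forall>x\<in>D1. int d' dvd x" "card D \<le> card D1 + card F + 2 * dn * dn"
    by (elim exE conjE) (rule that)
  have ddn: "int (dn * dn) \<le> q * q" using dq dn by simp
  have cF: "int (card F) \<le> 2 * int (Suc j) + 2 * int J" using F(2) F0(2) by linarith
  have "int (card F') \<le> 2 * int (Suc j) + 2 * int J + q * q"
    using res(4) cF ddn by linarith
  moreover have "int (card D) \<le> int (card D1) + 2 * int (Suc j) + 2 * int J + 2 * q * q"
  proof -
    have "int (card D) \<le> int (card D1) + int (card F) + 2 * int (dn * dn)" using res(8) by (simp flip: of_nat_mult of_nat_add)
    then show ?thesis using cF ddn by linarith
  qed
  ultimately show ?thesis using res
    by (intro exI[of _ "int d'"] exI[of _ F'] exI[of _ u'] exI[of _ l'] exI[of _ D1]) simp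
qed

lemma div_count_le:
  fixes M L :: int
  assumes "L > 0"
  shows "real_of_int (M div L - (- M) div L + 1) \<le> 2 * real_of_int M / real_of_int L + 2"
proof -
  have "real_of_int (M div L) \<le> real_of_int M / real_of_int L" by (rule real_of_int_div4)
  moreover have "real_of_int (- M) / real_of_int L - real_of_int ((- M) div L) \<le> 1" by (rule real_of_int_div3)
  ultimately show ?thesis by simp
qed

lemma ex_ap_dense:
  fixes K \<eta> :: real
  assumes K: "K \<ge> 1" and \<eta>: "0 < \<eta>" "\<eta> \<le> 1"
  shows "\<exists>s\<^sub>0. \<forall>s D. s\<^sub>0 \<le> s \<longrightarrow> finite D \<longrightarrow> (\<forall>x\<in>D. real_of_int \<bar>x\<bar> \<le> K * s) \<longrightarrow> s \<le> real (card D) \<longrightarrow>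
    (\<exists>d F u l D1. 0 < d \<and> F \<subseteq> D \<and> has_ap F u d l \<and> real (card F) \<le> \<eta> * s \<and> (\<forall>x\<in>D. \<bar>x\<bar> \<le> l * d)
       \<and> D1 \<subseteq> D - F \<and> (\<forall>x\<in>D1. d dvd x) \<and> real (card D) - \<eta> * s \<le> real (card D1))"
proof -
  \<comment> \<open>Blocks of length at least \<open>8 * K\<close> number at most
    \<open>s / 4 + 2\<close>, far fewer than the elements.\<close>
  define q where "q = \<lceil>8 * K\<rceil> + 1"
  have "8 * K \<le> real_of_int \<lceil>8 * K\<rceil>" by (rule le_of_int_ceiling)
  then have q: "q > 1" "8 * K \<le> real_of_int q"
    using K unfolding q_def by linarith+
  define c where "c = \<eta> / (16 * real_of_int q)"
  have c0: "c > 0" using \<eta> q by (simp add: c_def)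
  \<comment> \<open>\<open>Suc j\<close> will be at least \<open>c * s\<close>, and so will
    \<open>L\<close> in \<open>b2\<close>. Hence \<open>\<kappa>\<close> bounds \<open>q\<close>
    times the number of blocks of length \<open>L\<close> independently of \<open>s\<close>;
    \<open>m\<close> can be about \<open>s / (4 * \<kappa>)\<close> and the number \<open>J\<close>
    of pairs a constant.\<close>
  define \<kappa> where "\<kappa> = real_of_int q * (2 * K / c + 2)"
  have \<kappa>0: "\<kappa> > 0" using q K c0 by (simp add: \<kappa>_def add_nonneg_pos)
  define J where "J = nat \<lceil>real_of_int (2 + 2 * q * q) * K * (8 * \<kappa>)\<rceil>"
  define s0 where "s0 = 8 * real_of_int q / \<eta> + 4 * \<kappa> + 6 + 4 * real J + 4 * (real J + real_of_int (q * q)) / \<eta>"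
  show ?thesis
  proof (intro exI[of _ s0] allI impI)
    fix s :: real and D :: "int set"
    assume s: "s0 \<le> s" and fin: "finite D" and small: "\<forall>x\<in>D. real_of_int \<bar>x\<bar> \<le> K * s" and card: "s \<le> real (card D)"
    have nn: "0 \<le> 8 * real_of_int q / \<eta>" "0 \<le> 4 * (real J + real_of_int (q * q)) / \<eta>"
      using \<eta> q by auto
    have s1: "8 * real_of_int q / \<eta> \<le> s" "4 * \<kappa> \<le> s" "6 \<le> s" "4 * real J + 6 \<le> s"
      "4 * (real J + real_of_int (q * q)) / \<eta> \<le> s"
      using s nn \<kappa>0 unfolding s0_def by linarith+
    define M where "M = \<lfloor>K * s\<rfloor>"
    have M: "M \<ge> 0" "real_of_int M \<le> K * s" using K s1 by (auto simp: M_def)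
    have D: "D \<subseteq> {-M..M}"
    proof
      fix x assume "x \<in> D"
      then have "real_of_int \<bar>x\<bar> \<le> K * s" using small by blast
      then have "\<bar>x\<bar> \<le> M" unfolding M_def by (simp add: le_floor_iff)
      then show "x \<in> {-M..M}" by auto
    qed
    define j where "j = nat \<lfloor>\<eta> * s / (8 * real_of_int q)\<rfloor> - 1"
    have "1 \<le> \<eta> * s / (8 * real_of_int q)" using s1(1) \<eta> q by (simp add: field_simps)
    define t where "t = real (Suc j)"
    have t0: "0 \<le> t" by (simp add: t_def)
    from floor_ge_half[OF \<open>1 \<le> \<eta> * s / (8 * real_of_int q)\<close>] have j: "\<eta> * s / (8 * real_of_int q) / 2 \<le> t"
      "t \<le> \<eta> * s / (8 * real_of_int q)" unfolding j_def t_def by auto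
    have j': "c * s \<le> t" using j(1) by (simp add: c_def)
    define m where "m = nat \<lfloor>s / (4 * \<kappa>)\<rfloor>"
    have "1 \<le> s / (4 * \<kappa>)" using s1(2) \<kappa>0 by simp
    note m = floor_ge_half[OF this, folded m_def]
    have qj: "real_of_int q * t \<le> s / 8"
    proof -
      have "real_of_int q * t \<le> real_of_int q * (\<eta> * s / (8 * real_of_int q))"
        using q by (intro mult_left_mono j(2)) auto
      also have "\<dots> = \<eta> * s / 8" using q by simp
      also have "\<dots> \<le> 1 * s / 8" using \<eta> s1 by (intro divide_right_mono mult_right_mono) auto
      finally show ?thesis by simp
    qed
    have sj: "2 * t \<le> \<eta> * s / 4"
    proof -
      have "\<eta> * s / (8 * real_of_int q) \<le> \<eta> * s / (8 * 1)"
        using q \<eta> s1 by (intro divide_left_mono mult_left_mono) auto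
      from order.trans[OF j(2) this] have "t \<le> \<eta> * s / 8" by (simp only: mult_1_right)
      then show ?thesis by linarith
    qed
    have es: "\<eta> * s \<le> 1 * s" using \<eta> s1 by (intro mult_right_mono) auto
    have b1: "int (card D) > (M div q - (- M) div q + 1) + (q - 1) * (3 * int (Suc j))"
    proof -
      have "real_of_int (M div q - (- M) div q + 1) \<le> 2 * real_of_int M / real_of_int q + 2"
        using q by (intro div_count_le) auto
      also have "\<dots> \<le> 2 * (K * s) / real_of_int q + 2" using M q by (intro add_right_mono divide_right_mono) auto
      also have "\<dots> \<le> s / 4 + 2"
      proof -
        have "8 * K * s \<le> real_of_int q * s" using q s1 by (intro mult_right_mono) auto
        then show ?thesis using q by (simp add: field_simps)
      qed
      finally have 1: "real_of_int (M div q - (- M) div q + 1) \<le> s / 4 + 2" .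
      have "real_of_int ((q - 1) * (3 * int (Suc j))) = 3 * (real_of_int q * t) - 3 * t"
        by (simp add: t_def algebra_simps)
      then have "real_of_int ((M div q - (- M) div q + 1) + (q - 1) * (3 * int (Suc j))) < real (card D)"
        using 1 qj s1(3) card t0 unfolding of_int_add[of "M div q - (- M) div q + 1"] by linarith
      then have "real_of_int ((M div q - (- M) div q + 1) + (q - 1) * (3 * int (Suc j))) < real_of_int (int (card D))"
        by simp
      then show ?thesis by (simp only: of_int_less_iff)
    qed
    have b2: "int (card D) > 2 * int (Suc j) + 2 * int J + int m * (q * (M div L - (- M) div L + 1))"
      if L: "int (Suc j) < L" for L
    proof -
      have L0: "0 < L" using L by simp
      have cL: "c * s \<le> real_of_int L"
      proof -
        have "real_of_int (int (Suc j)) \<le> real_of_int L" using L by (simp only: of_int_le_iff)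
        then show ?thesis using j' by (simp add: t_def)
      qed
      have "real_of_int (M div L - (- M) div L + 1) \<le> 2 * real_of_int M / real_of_int L + 2"
        using L0 by (rule div_count_le)
      also have "2 * real_of_int M / real_of_int L \<le> 2 * (K * s) / (c * s)"
        using M cL c0 s1 K by (intro frac_le) auto
      also have "\<dots> = 2 * K / c" using s1 by simp
      finally have "real_of_int q * real_of_int (M div L - (- M) div L + 1) \<le> \<kappa>"
        unfolding \<kappa>_def using q by (intro mult_left_mono) auto
      then have "real m * (real_of_int q * real_of_int (M div L - (- M) div L + 1)) \<le> real m * \<kappa>"
        by (intro mult_left_mono) auto
      also have "\<dots> \<le> s / (4 * \<kappa>) * \<kappa>"
        using m \<kappa>0 by (intro mult_right_mono) auto
      also have "\<dots> = s / 4" using \<kappa>0 by simp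
      finally have "real_of_int (int m * (q * (M div L - (- M) div L + 1))) \<le> s / 4" by simp
      moreover have "real_of_int (2 * int (Suc j) + 2 * int J + int m * (q * (M div L - (- M) div L + 1)))
        = 2 * t + 2 * real J + real_of_int (int m * (q * (M div L - (- M) div L + 1)))" by (simp add: t_def)
      ultimately have "real_of_int (2 * int (Suc j) + 2 * int J + int m * (q * (M div L - (- M) div L + 1)))
        < real_of_int (int (card D))"
        using sj es s1 card unfolding of_int_of_nat_eq by linarith
      then show ?thesis by (simp only: of_int_less_iff)
    qed
    have b3: "(2 + 2 * q * q) * M \<le> int J * int m"
    proof -
      have Q0: "0 \<le> real_of_int (2 + 2 * q * q)" using q by simp
      have "real_of_int ((2 + 2 * q * q) * M) \<le> real_of_int (2 + 2 * q * q) * (K * s)"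
        unfolding of_int_mult[of "2 + 2 * q * q" M] using M Q0 by (intro mult_left_mono) auto
      also have "\<dots> = (real_of_int (2 + 2 * q * q) * K * (8 * \<kappa>)) * (s / (4 * \<kappa>) / 2)" using \<kappa>0 by simp
      also have "\<dots> \<le> real J * real m"
        using m \<kappa>0 s1 by (intro mult_mono) (auto simp: J_def real_nat_ceiling_ge)
      finally have "real_of_int ((2 + 2 * q * q) * M) \<le> real_of_int (int J * int m)" by simp
      then show ?thesis by (simp only: of_int_le_iff)
    qed
    have bJ: "2 * t + 2 * real J + 2 * real_of_int (q * q) \<le> \<eta> * s"
    proof -
      have "4 * (real J + real_of_int (q * q)) \<le> s * \<eta>" using s1(5) \<eta> by (simp only: pos_divide_le_eq)
      then show ?thesis using sj t0 unfolding mult.commute[of s \<eta>] distrib_left by linarith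
    qed
    have qq: "0 \<le> real_of_int (q * q)" by simp
    have m0: "m > 0" using m by simp
    obtain d F u l D1 where res: "0 < d" "F \<subseteq> D" "has_ap F u d l" "int (card F) \<le> 2 * int (Suc j) + 2 * int J + q * q"
      "2 * M \<le> l * d" "D1 \<subseteq> D - F" "\<forall>x\<in>D1. d dvd x"
      "int (card D) \<le> int (card D1) + 2 * int (Suc j) + 2 * int J + 2 * q * q"
      using ex_ap_dense_aux[OF M(1) D q(1) m0 b1 b2 b3] by blast
    have "real_of_int (int (card F)) \<le> real_of_int (2 * int (Suc j) + 2 * int J + q * q)"
      using res(4) by (simp only: of_int_le_iff)
    then have "real (card F) \<le> 2 * t + 2 * real J + real_of_int (q * q)" by (simp add: t_def)
    then have "real (card F) \<le> \<eta> * s" using bJ qq by linarith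
    moreover have "real_of_int (int (card D)) \<le> real_of_int (int (card D1) + 2 * int (Suc j) + 2 * int J + 2 * q * q)"
      using res(8) by (simp only: of_int_le_iff)
    then have "real (card D) \<le> real (card D1) + 2 * t + 2 * real J + 2 * real_of_int (q * q)" by (simp add: t_def)
    then have "real (card D) - \<eta> * s \<le> real (card D1)" using bJ by linarith
    moreover have "\<forall>x\<in>D. \<bar>x\<bar> \<le> l * d" using D res(5) M(1) by fastforce
    ultimately show "\<exists>d F u l D1. 0 < d \<and> F \<subseteq> D \<and> has_ap F u d l \<and> real (card F) \<le> \<eta> * s \<and> (\<forall>x\<in>D. \<bar>x\<bar> \<le> l * d)
       \<and> D1 \<subseteq> D - F \<and> (\<forall>x\<in>D1. d dvd x) \<and> real (card D) - \<eta> * s \<le> real (card D1)"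
      using res by blast
  qed
qed

section \<open>A dilate with a dense positive part\<close>

text \<open>The sum is least for consecutive integers starting at \<open>w + 1\<close>; everything
  is doubled to stay within the integers.\<close>

lemma sum_ge_of_lower_bound:
  fixes S :: "int set"
  assumes "finite S" "\<And>x. x \<in> S \<Longrightarrow> w < x"
  shows "2 * int (card S) * w + int (card S) * (int (card S) + 1) \<le> 2 * \<Sum>S"
  using assms
proof (induction "card S" arbitrary: S)
  case 0 then show ?case by simp
next
  case (Suc n)
  then have ne: "S \<noteq> {}" by auto
  define m where "m = Max S"
  have m: "m \<in> S" using ne Suc.prems by (simp add: m_def)
  have n: "n = card (S - {m})" using Suc m by simp
  have "2 * int n * w + int n * (int n + 1) \<le> 2 * \<Sum>(S - {m})"
    using Suc.hyps(1)[OF n] Suc.prems n by simp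
  moreover have "w + int n + 1 \<le> m"
  proof -
    have "S \<subseteq> {w<..m}" using Suc.prems by (auto simp: m_def)
    then have "card S \<le> card {w<..m}" by (intro card_mono) auto
    then show ?thesis using Suc.hyps(2) by simp
  qed
  moreover have "\<Sum>S = m + \<Sum>(S - {m})" using m Suc.prems by (simp add: sum.remove)
  ultimately show ?case unfolding Suc.hyps(2)[symmetric] by (simp add: algebra_simps)
qed

lemma sum_ge_card_square:
  fixes S :: "int set"
  assumes "finite S" "\<And>x. x \<in> S \<Longrightarrow> 0 < x"
  shows "int (card S) * int (card S) \<le> 2 * \<Sum>S"
  using sum_ge_of_lower_bound[of S 0] assms by (simp add: algebra_simps)

lemma zsf_inj_abs: "zsf p A \<Longrightarrow> inj_on abs A"
proof (rule inj_onI)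
  fix x y :: int assume z: "zsf p A" and xy: "x \<in> A" "y \<in> A" "\<bar>x\<bar> = \<bar>y\<bar>"
  show "x = y"
  proof (rule ccontr)
    assume "x \<noteq> y"
    then have "\<Sum>{x, y} = 0" using xy(3) by auto
    then show False using zsf_not_dvd[OF z, of "{x, y}"] xy by simp
  qed
qed

text \<open>The size condition refers to the initial \<open>l\<close>. As the progression only
  grows, the elements can be absorbed in any order, the positive ones at the upper end and the
  negative ones at the lower.\<close>

lemma has_ap_absorb:
  assumes fin: "finite F" and d: "d > 0" and ap: "has_ap F u d l" and l: "l \<ge> 0"
    and R: "finite R" "R \<inter> F = {}" "\<And>x. x \<in> R \<Longrightarrow> d dvd x" "\<And>x. x \<in> R \<Longrightarrow> \<bar>x\<bar> \<le> (l + 1) * d"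
  shows "has_ap (F \<union> R) (u + (\<Sum>x | x \<in> R \<and> x < 0. x)) d (l + (\<Sum>x\<in>R. \<bar>x\<bar> div d))"
  using R
proof (induction R rule: finite_induct)
  case empty then show ?case using ap by simp
next
  case (insert x R)
  let ?u = "u + (\<Sum>x | x \<in> R \<and> x < 0. x)" and ?l = "l + (\<Sum>x\<in>R. \<bar>x\<bar> div d)"
  have IH: "has_ap (F \<union> R) ?u d ?l" using insert by auto
  have finFR: "finite (F \<union> R)" using fin insert by simp
  have x: "x \<notin> F \<union> R" using insert by auto
  define q where "q = \<bar>x\<bar> div d"
  have "d dvd \<bar>x\<bar>" using insert.prems(2) by simp
  then have q: "\<bar>x\<bar> = q * d" by (simp add: q_def)
  have q0: "q \<ge> 0" using d by (simp add: q_def pos_imp_zdiv_nonneg_iff)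
  have "0 \<le> (\<Sum>x\<in>R. \<bar>x\<bar> div d)" using d by (intro sum_nonneg) (simp add: pos_imp_zdiv_nonneg_iff)
  moreover have "q * d \<le> (l + 1) * d" using insert.prems(3)[of x] q by simp
  then have "q \<le> l + 1" using d by simp
  ultimately have ql: "q \<le> ?l + 1" by simp
  have sl: "l + (\<Sum>x\<in>insert x R. \<bar>x\<bar> div d) = ?l + q" using insert by (simp add: q_def)
  show ?case
  proof (cases "x < 0")
    case True
    have "{y. y \<in> insert x R \<and> y < 0} = insert x {y. y \<in> R \<and> y < 0}" using True by auto
    then have su: "u + (\<Sum>y | y \<in> insert x R \<and> y < 0. y) = ?u + x" using insert by simp
    have "x = - q * d" using q True by simp
    from has_ap_insert_neg[OF finFR x this IH q0 ql] show ?thesis by (simp only: sl su Un_insert_right)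
  next
    case False
    have "{y. y \<in> insert x R \<and> y < 0} = {y. y \<in> R \<and> y < 0}" using False by auto
    then have su: "u + (\<Sum>y | y \<in> insert x R \<and> y < 0. y) = ?u" by simp
    have "x = q * d" using q False by simp
    from has_ap_insert_nonneg[OF finFR x this IH q0 ql] show ?thesis by (simp only: sl su Un_insert_right)
  qed
qed

lemma has_ap_avoids:
  assumes ap: "has_ap F u d l" and z: "zsf p F" and i: "0 \<le> i" "i \<le> l"
  shows "\<not> p dvd u + i * d"
proof -
  have "u + i * d \<in> nonempty_sums F" using ap i by (simp add: has_ap_def)
  then obtain C where C: "C \<subseteq> F" "C \<noteq> {}" "u + i * d = \<Sum>C" unfolding nonempty_sums_def by auto
  show ?thesis unfolding C(3) by (rule zsf_not_dvd[OF z C(1,2)])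
qed

text \<open>As \<open>p\<close> does not divide \<open>d\<close>, any \<open>p\<close> consecutive
  terms represent all residues, 0 among them.\<close>

lemma has_ap_short:
  assumes p: "prime p" and ap: "has_ap F u d l" and z: "zsf p F" and d: "\<not> p dvd d"
  shows "l + 1 < p"
proof (rule ccontr)
  assume l: "\<not> l + 1 < p"
  have p0: "p > 0" using p prime_gt_0_int by blast
  obtain i where i: "(int i * d) mod p = (- u) mod p" using ex_mult_mod[OF p d] by blast
  define j where "j = int i mod p"
  have j: "0 \<le> j" "j < p" using p0 by (auto simp: j_def)
  have "(j * d) mod p = (- u) mod p" using i by (simp add: j_def mod_simps)
  then have "p dvd j * d - (- u)" by (simp add: mod_eq_dvd_iff)
  then have "p dvd u + j * d" by (simp add: add.commute)
  then show False using has_ap_avoids[OF ap z j(1)] j(2) l by simp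
qed

section \<open>Signed representatives of a dilate\<close>

lemma smod_unique:
  assumes "p dvd x - y" "- p < 2 * y" "2 * y < p"
  shows "smod p x = y"
proof -
  have m: "x mod p = y mod p" using assms(1) by (simp add: mod_eq_dvd_iff)
  show ?thesis
  proof (cases "y \<ge> 0")
    case True
    then have "y mod p = y" using assms by simp
    then show ?thesis using m assms by (simp add: smod_def)
  next
    case False
    have "y mod p = (y + p) mod p" by simp
    also have "\<dots> = y + p" using False assms by (intro mod_pos_pos_trivial) auto
    finally show ?thesis using m assms by (simp add: smod_def)
  qed
qed

definition signed_dilate :: "int \<Rightarrow> int \<Rightarrow> int set \<Rightarrow> int set" where
  "signed_dilate p b A = (\<lambda>a. smod p (b * a)) ` A"

lemma inj_on_signed_dilate:
  assumes p: "prime p" and b: "\<not> p dvd b" and inj: "inj_on (\<lambda>a. a mod p) A"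
  shows "inj_on (\<lambda>a. smod p (b * a)) A"
proof (rule inj_onI)
  fix x y assume xy: "x \<in> A" "y \<in> A" "smod p (b * x) = smod p (b * y)"
  have "p dvd (smod p (b * y) - b * y) - (smod p (b * x) - b * x)"
    by (intro dvd_diff smod_cong_dvd)
  then have "p dvd b * (x - y)" using xy(3) by (simp add: algebra_simps)
  then have "p dvd x - y" using p b by (simp add: prime_dvd_mult_iff)
  then have "x mod p = y mod p" by (simp add: mod_eq_dvd_iff)
  then show "x = y" using inj xy by (auto dest: inj_onD)
qed

text \<open>A sum of representatives is congruent to \<open>b\<close> times the sum of their
  preimages. Distinctness modulo \<open>p\<close>, which \<open>zsf\<close> does not include,
  ensures that each representative has one preimage.\<close>

lemma zsf_signed_dilate:
  assumes p: "prime p" and b: "\<not> p dvd b" and z: "zsf p A" and inj: "inj_on (\<lambda>a. a mod p) A"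
  shows "zsf p (signed_dilate p b A)"
  unfolding zsf_def
proof (intro conjI allI impI)
  show "finite (signed_dilate p b A)" using z zsf_finite by (auto simp: signed_dilate_def)
  fix C assume C: "C \<subseteq> signed_dilate p b A" "C \<noteq> {}"
  let ?f = "\<lambda>a. smod p (b * a)"
  obtain B where B: "B \<subseteq> A" "C = ?f ` B" using C(1) unfolding signed_dilate_def by (meson subset_imageE)
  have "\<Sum>C = (\<Sum>a\<in>B. ?f a)"
    unfolding B(2) using inj_on_subset[OF inj_on_signed_dilate[OF p b inj] B(1)] by (simp add: sum.reindex)
  then have eq: "\<Sum>C - b * \<Sum>B = (\<Sum>a\<in>B. ?f a - b * a)" by (simp add: sum_subtractf sum_distrib_left)
  have "p dvd \<Sum>C - b * \<Sum>B" unfolding eq by (intro dvd_sum smod_cong_dvd)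
  moreover have "\<not> p dvd b * \<Sum>B" using p b zsf_not_dvd[OF z B(1)] C(2) B(2) by (auto simp: prime_dvd_mult_iff)
  ultimately show "\<not> p dvd \<Sum>C" by (metis diff_add_cancel dvd_add_right_iff)
qed

text \<open>For odd \<open>p\<close> the value \<open>- p / 2\<close> does not occur, so the range
  of \<open>smod\<close> is symmetric.\<close>

lemma signed_dilate_minus:
  assumes p: "odd p" "p > 0"
  shows "signed_dilate p (- b) A = uminus ` signed_dilate p b A"
proof -
  have "smod p (- b * a) = - smod p (b * a)" for a
  proof (rule smod_unique)
    have "p dvd - (smod p (b * a) - b * a)" using smod_cong_dvd by (simp only: dvd_minus_iff)
    then have "p dvd - (- (smod p (b * a) - b * a))" by (simp only: dvd_minus_iff)
    then show "p dvd - b * a - - smod p (b * a)" by simp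
    have "- p \<noteq> 2 * smod p (b * a)" using p(1) by (metis dvd_minus_iff dvd_triv_left)
    then show "2 * - smod p (b * a) < p" using smod_bounds[OF p(2), of "b * a"] by simp
    show "- p < 2 * - smod p (b * a)" using smod_bounds[OF p(2), of "b * a"] by simp
  qed
  then show ?thesis by (simp add: signed_dilate_def image_image)
qed

text \<open>A progression of difference \<open>d\<close> among subset sums has fewer than \<open>p\<close> terms. Absorbing \<open>D1\<close> into
  it therefore bounds the sum of the \<open>\<bar>x\<bar> / d\<close>, which are the norms after dividing the dilation factor by \<open>d\<close>.\<close>

lemma redilate:
  assumes p: "prime p" and z: "zsf p A" and inj: "inj_on (\<lambda>a. a mod p) A" and \<xi>: "\<not> p dvd \<xi>"
    and D: "D \<subseteq> signed_dilate p \<xi> A" "\<And>x. x \<in> D \<Longrightarrow> \<bar>x\<bar> \<le> M" "2 * M < p"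
    and F: "F \<subseteq> D" "has_ap F u d l" "d > 0" "\<And>x. x \<in> D \<Longrightarrow> \<bar>x\<bar> \<le> l * d"
    and D1: "D1 \<subseteq> D - F" "D1 \<noteq> {}" "\<And>x. x \<in> D1 \<Longrightarrow> d dvd x"
  shows "\<exists>b D'. \<not> p dvd b \<and> D' \<subseteq> signed_dilate p b A \<and> card D' = card D1
    \<and> (\<forall>x\<in>D'. \<bar>x\<bar> \<le> M) \<and> (\<Sum>x\<in>D'. \<bar>x\<bar>) < p"
proof -
  have zA: "zsf p (signed_dilate p \<xi> A)" by (rule zsf_signed_dilate[OF p \<xi> z inj])
  have zD: "zsf p D" by (rule zsf_subset[OF zA D(1)])
  have finD: "finite D" using zD zsf_finite by blast
  obtain x0 where x0: "x0 \<in> D1" using D1(2) by blast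
  have x0D: "x0 \<in> D" using x0 D1(1) by blast
  have l: "l \<ge> 0"
  proof -
    have "0 \<le> l * d" using F(4)[OF x0D] by linarith
    then show ?thesis using F(3) by (simp add: zero_le_mult_iff)
  qed
  have pd: "\<not> p dvd d" using zsf_elem[OF zD x0D] D1(3)[OF x0] dvd_trans by blast
  have "has_ap (F \<union> D1) (u + (\<Sum>x | x \<in> D1 \<and> x < 0. x)) d (l + (\<Sum>x\<in>D1. \<bar>x\<bar> div d))"
  proof (rule has_ap_absorb[OF _ F(3,2) l])
    show "finite F" "finite D1" using F(1) D1(1) finD by (auto intro: finite_subset)
    show "D1 \<inter> F = {}" using D1(1) by blast
    fix x assume x: "x \<in> D1"
    then show "d dvd x" by (rule D1(3))
    have "l * d \<le> (l + 1) * d" using F(3) by simp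
    then show "\<bar>x\<bar> \<le> (l + 1) * d" using F(4)[of x] x D1(1) by fastforce
  qed
  moreover have "zsf p (F \<union> D1)" using F(1) D1(1) by (intro zsf_subset[OF zD]) blast
  ultimately have short: "l + (\<Sum>x\<in>D1. \<bar>x\<bar> div d) + 1 < p" using has_ap_short[OF p _ _ pd] by blast
  define D' where "D' = (\<lambda>x. x div d) ` D1"
  have injd: "inj_on (\<lambda>x. x div d) D1"
    by (rule inj_onI) (metis D1(3) dvd_div_mult_self)
  have absd: "\<bar>x div d\<bar> = \<bar>x\<bar> div d" "\<bar>x div d\<bar> \<le> \<bar>x\<bar>" if x: "x \<in> D1" for x
  proof -
    obtain y where y: "x = d * y" using D1(3)[OF x] by blast
    then show "\<bar>x div d\<bar> = \<bar>x\<bar> div d" using F(3) by (simp add: abs_mult)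
    have "1 * \<bar>y\<bar> \<le> d * \<bar>y\<bar>" using F(3) by (intro mult_right_mono) auto
    then show "\<bar>x div d\<bar> \<le> \<bar>x\<bar>" using y F(3) by (simp add: abs_mult)
  qed
  have bd: "\<forall>x\<in>D'. \<bar>x\<bar> \<le> M"
  proof
    fix x assume "x \<in> D'"
    then obtain y where y: "y \<in> D1" "x = y div d" unfolding D'_def by blast
    have "\<bar>y\<bar> \<le> M" using D(2) y(1) D1(1) by blast
    then show "\<bar>x\<bar> \<le> M" using absd(2)[OF y(1)] y(2) by simp
  qed
  have "(\<Sum>x\<in>D'. \<bar>x\<bar>) = (\<Sum>x\<in>D1. \<bar>x\<bar> div d)"
    unfolding D'_def using injd absd by (simp add: sum.reindex)
  then have sum: "(\<Sum>x\<in>D'. \<bar>x\<bar>) < p" using short l by simp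
  \<comment> \<open>The new factor is \<open>\<xi> / d\<close> modulo \<open>p\<close>. It sends the
    elements behind \<open>D1\<close> to the integer quotients by \<open>d\<close>, which are signed
    representatives because they are no larger than before.\<close>
  obtain i where i: "(int i * d) mod p = \<xi> mod p" using ex_mult_mod[OF p pd] by blast
  define b where "b = int i"
  have pb: "\<not> p dvd b"
  proof
    assume "p dvd b"
    then have "\<xi> mod p = 0" using i by (simp add: b_def flip: i)
    then show False using \<xi> by (simp add: dvd_eq_mod_eq_0)
  qed
  have "p dvd b * d - \<xi>" using i by (simp add: b_def mod_eq_dvd_iff)
  have "D' \<subseteq> signed_dilate p b A"
  proof
    fix x assume x: "x \<in> D'"
    then obtain y where y: "y \<in> D1" "x = y div d" unfolding D'_def by blast
    have yd: "y = d * x" using D1(3)[OF y(1)] y(2) by simp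
    have "y \<in> signed_dilate p \<xi> A" using y(1) D1(1) D(1) by blast
    then obtain a where a: "a \<in> A" "y = smod p (\<xi> * a)" unfolding signed_dilate_def by blast
    have "p dvd (b * d - \<xi>) * a - (smod p (\<xi> * a) - \<xi> * a)"
      by (rule dvd_diff[OF dvd_mult2[OF \<open>p dvd b * d - \<xi>\<close>] smod_cong_dvd])
    also have "(b * d - \<xi>) * a - (smod p (\<xi> * a) - \<xi> * a) = d * (b * a - x)"
      using a(2) yd by (simp add: algebra_simps)
    finally have "p dvd b * a - x" using p pd by (simp add: prime_dvd_mult_iff)
    moreover have "- p < 2 * x" "2 * x < p" using bd x D(3) by (auto dest!: bspec)
    ultimately have "smod p (b * a) = x" by (rule smod_unique)
    then show "x \<in> signed_dilate p b A" using a(1) unfolding signed_dilate_def by blast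
  qed
  moreover have "card D' = card D1" unfolding D'_def by (rule card_image[OF injd])
  ultimately show ?thesis using pb bd sum by blast
qed

text \<open>Absorbing \<open>D - F\<close> gives an interval of nonempty sums from
  \<open>u - ?N\<close> to \<open>u + l + ?P\<close>. It avoids 0, so \<open>?N < u\<close> or
  \<open>?P < - u\<close>; and \<open>u\<close> is itself a sum of elements of
  \<open>F\<close>.\<close>

lemma sign_dichotomy:
  assumes z: "zsf p D" and F: "F \<subseteq> D" "has_ap F u 1 l" and l: "\<And>x. x \<in> D \<Longrightarrow> \<bar>x\<bar> \<le> l" "D \<noteq> {}"
    and M: "\<And>x. x \<in> D \<Longrightarrow> \<bar>x\<bar> \<le> M"
  shows "(\<Sum>x | x \<in> D - F \<and> x < 0. \<bar>x\<bar>) \<le> int (card F) * M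
    \<or> (\<Sum>x | x \<in> D - F \<and> 0 < x. \<bar>x\<bar>) \<le> int (card F) * M"
proof -
  have finD: "finite D" using z zsf_finite by blast
  have l0: "l \<ge> 0" using l by fastforce
  let ?neg = "\<Sum>x | x \<in> D - F \<and> x < 0. x" and ?abs = "\<Sum>x\<in>D - F. \<bar>x\<bar>"
  let ?N = "\<Sum>x | x \<in> D - F \<and> x < 0. \<bar>x\<bar>" and ?P = "\<Sum>x | x \<in> D - F \<and> 0 < x. \<bar>x\<bar>"
  have "has_ap (F \<union> (D - F)) (u + ?neg) 1 (l + (\<Sum>x\<in>D - F. \<bar>x\<bar> div 1))"
  proof (rule has_ap_absorb[OF _ _ F(2) l0])
    show "finite F" "finite (D - F)" using F(1) finD by (auto intro: finite_subset)
    fix x assume "x \<in> D - F"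
    then show "\<bar>x\<bar> \<le> (l + 1) * 1" using l(1)[of x] by simp
  qed auto
  then have ap: "has_ap D (u + ?neg) 1 (l + ?abs)" using F(1) by (simp add: Un_absorb1)
  have negN: "?neg = - ?N" by (simp add: sum_negf[symmetric])
  have "D - F = {x. x \<in> D - F \<and> x < 0} \<union> {x. x \<in> D - F \<and> 0 < x}"
  proof -
    have "0 \<notin> D" using zsf_elem[OF z] by force
    then show ?thesis by (auto simp: linorder_neq_iff) (metis linorder_neqE_linordered_idom)
  qed
  then have "?abs = (\<Sum>x\<in>{x. x \<in> D - F \<and> x < 0} \<union> {x. x \<in> D - F \<and> 0 < x}. \<bar>x\<bar>)"
    by (rule arg_cong[where f = "sum (\<lambda>x. \<bar>x\<bar>)"])
  also have "\<dots> = ?N + ?P" using finD by (intro sum.union_disjoint) auto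
  finally have absNP: "?abs = ?N + ?P" .
  have "\<not> (u + ?neg \<le> 0 \<and> 0 \<le> u + ?neg + (l + ?abs))"
    using has_ap_avoids[OF ap z, of "- (u + ?neg)"] by auto
  then have *: "u > ?N \<or> u + l + ?P < 0" using negN absNP by linarith
  have "u \<in> nonempty_sums F" using F(2) l0 unfolding has_ap_def by force
  then obtain C where C: "C \<subseteq> F" "u = \<Sum>C" unfolding nonempty_sums_def by blast
  have M0: "M \<ge> 0" using M l(2) by fastforce
  have "\<bar>u\<bar> \<le> int (card C) * M"
    unfolding C(2) using C(1) F(1) M by (intro abs_sum_le) (force simp: abs_le_iff)
  also have "\<dots> \<le> int (card F) * M"
    using C(1) F(1) finD M0 by (intro mult_right_mono) (auto intro!: card_mono finite_subset[OF F(1)])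
  finally show ?thesis using * l0 by linarith
qed

text \<open>The quotients of the norms by \<open>d\<close> are distinct positive integers, so they
  add up to at least \<open>p / 2\<close>. For \<open>d \<ge> 2\<close> the norms themselves would
  add up to at least \<open>p\<close>.\<close>

lemma common_divisor_is_1:
  assumes z: "zsf p D" and sum: "(\<Sum>x\<in>D. \<bar>x\<bar>) < p" and D1: "D1 \<subseteq> D" "\<And>x. x \<in> D1 \<Longrightarrow> d dvd x" and d: "d > 0"
    and n: "p \<le> int (card D1) * int (card D1)"
  shows "d = 1"
proof (rule ccontr)
  assume "d \<noteq> 1"
  then have d2: "d \<ge> 2" using d by simp
  have finD: "finite D" using z zsf_finite by blast
  have fin1: "finite D1" using D1(1) finD finite_subset by blast
  define S where "S = (\<lambda>x. \<bar>x\<bar> div d) ` D1"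
  have eq: "d * (\<bar>x\<bar> div d) = \<bar>x\<bar>" if "x \<in> D1" for x using D1(2)[OF that] by simp
  have inj: "inj_on (\<lambda>x. \<bar>x\<bar> div d) D1"
  proof (rule inj_onI)
    fix x y assume xy: "x \<in> D1" "y \<in> D1" "\<bar>x\<bar> div d = \<bar>y\<bar> div d"
    then have "\<bar>x\<bar> = \<bar>y\<bar>" using eq by metis
    then show "x = y" using zsf_inj_abs[OF z] xy D1(1) by (auto dest: inj_onD)
  qed
  have pos: "0 < s" if s: "s \<in> S" for s
  proof -
    obtain x where x: "x \<in> D1" "s = \<bar>x\<bar> div d" using s unfolding S_def by blast
    have "x \<noteq> 0" using zsf_elem[OF z] x D1(1) by force
    then have "0 < d * s" using eq[OF x(1)] x(2) by simp
    then show ?thesis using d by (simp add: zero_less_mult_iff)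
  qed
  have "int (card S) * int (card S) \<le> 2 * \<Sum>S"
    using fin1 pos by (intro sum_ge_card_square) (auto simp: S_def)
  moreover have "card S = card D1" unfolding S_def by (rule card_image[OF inj])
  moreover have "\<Sum>S = (\<Sum>x\<in>D1. \<bar>x\<bar> div d)" unfolding S_def using inj by (simp add: sum.reindex)
  ultimately have "p \<le> 2 * (\<Sum>x\<in>D1. \<bar>x\<bar> div d)" using n by simp
  also have "\<dots> = (\<Sum>x\<in>D1. 2 * (\<bar>x\<bar> div d))" by (simp add: sum_distrib_left)
  also have "\<dots> \<le> (\<Sum>x\<in>D1. \<bar>x\<bar>)"
  proof (rule sum_mono)
    fix x assume x: "x \<in> D1"
    have "2 * (\<bar>x\<bar> div d) \<le> d * (\<bar>x\<bar> div d)" using d2 by (intro mult_right_mono) (auto simp: pos_imp_zdiv_nonneg_iff)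
    then show "2 * (\<bar>x\<bar> div d) \<le> \<bar>x\<bar>" using eq[OF x] by simp
  qed
  also have "\<dots> \<le> (\<Sum>x\<in>D. \<bar>x\<bar>)" using finD D1(1) by (intro sum_mono2) auto
  finally show False using sum by simp
qed

text \<open>\<open>c\<close> counts the negative elements outside \<open>F\<close>: having distinct
  norms, they are few if their total norm is small.\<close>

lemma card_positive_part:
  assumes z: "zsf p D" and F: "finite F" and neg: "(\<Sum>x | x \<in> D - F \<and> x < 0. \<bar>x\<bar>) \<le> B"
  shows "\<exists>c. int (c * c) \<le> 2 * B \<and> card D \<le> card {x \<in> D. 0 < x} + card F + c"
proof -
  have finD: "finite D" using z zsf_finite by blast
  define N where "N = {x. x \<in> D - F \<and> x < 0}"
  have finN: "finite N" using finD by (simp add: N_def)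
  have "inj_on abs N" using zsf_inj_abs[OF z] by (rule inj_on_subset) (auto simp: N_def)
  then have "card (abs ` N) = card N" "\<Sum>(abs ` N) = (\<Sum>x\<in>N. \<bar>x\<bar>)" by (auto simp: card_image sum.reindex)
  moreover have "int (card (abs ` N)) * int (card (abs ` N)) \<le> 2 * \<Sum>(abs ` N)"
    using finN by (intro sum_ge_card_square) (auto simp: N_def)
  ultimately have "int (card N * card N) \<le> 2 * B" using neg by (simp add: N_def)
  moreover have "0 \<notin> D" using zsf_elem[OF z] by force
  then have "D \<subseteq> {x \<in> D. 0 < x} \<union> (F \<union> N)" unfolding N_def by (auto) (metis linorder_neqE_linordered_idom)
  then have "card D \<le> card ({x \<in> D. 0 < x} \<union> (F \<union> N))" using finD F finN by (intro card_mono) auto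
  then have "card D \<le> card {x \<in> D. 0 < x} + card F + card N"
    using card_Un_le[of "{x \<in> D. 0 < x}" "F \<union> N"] card_Un_le[of F N] by linarith
  ultimately show ?thesis by blast
qed

text \<open>At most \<open>s / 500\<close> elements outside \<open>F\<close> are negative, since 2 /
  1000000 is below the square of 1 / 500. Together with \<open>F\<close> this leaves more than 1.39
  of the factor 1.397.\<close>

lemma positive_part_of_dilate:
  fixes p :: nat and s K :: real
  assumes p: "prime p" "odd p" and s: "s = sqrt (real p)" and z: "zsf (int p) A" and inj: "inj_on (\<lambda>a. a mod int p) A"
    and b: "\<not> int p dvd b" "D \<subseteq> signed_dilate (int p) b A" and bd: "\<forall>x\<in>D. real_of_int \<bar>x\<bar> \<le> K * s"
    and sum: "(\<Sum>x\<in>D. \<bar>x\<bar>) < int p" and cD: "(1397/1000) * s \<le> real (card D)"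
    and F: "finite F" "real (card F) \<le> s / 1000000" and B: "real_of_int B \<le> real p / 1000000"
    and neg: "(\<Sum>x | x \<in> D - F \<and> x < 0. \<bar>x\<bar>) \<le> B"
  shows "\<exists>P \<subseteq> signed_dilate (int p) b A. (\<forall>x\<in>P. 0 < x \<and> real_of_int x \<le> K * s) \<and> (139/100) * s \<le> real (card P) \<and> \<Sum>P < int p"
proof -
  have zD: "zsf (int p) D"
    by (rule zsf_subset[OF zsf_signed_dilate[OF _ b(1) z inj] b(2)]) (use p in simp)
  have finD: "finite D" using zD zsf_finite by blast
  obtain c where c: "int (c * c) \<le> 2 * B" "card D \<le> card {x \<in> D. 0 < x} + card F + c"
    using card_positive_part[OF zD F(1) neg] by blast
  have ss: "s * s = real p" "s \<ge> 0" by (auto simp: s)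
  have "real_of_int (int (c * c)) \<le> real_of_int (2 * B)" using c(1) by (simp only: of_int_le_iff)
  then have "real c * real c \<le> 2 * real p / 1000000" using B by simp
  also have "\<dots> \<le> (s / 500) * (s / 500)" by (simp add: ss(1))
  finally have "(real c)\<^sup>2 \<le> (s / 500)\<^sup>2" by (simp add: power2_eq_square)
  then have "real c \<le> s / 500" by (rule power2_le_imp_le) (use ss(2) in simp)
  moreover have "real (card D) \<le> real (card {x \<in> D. 0 < x}) + real (card F) + real c" using c(2) by linarith
  ultimately have "(139/100) * s \<le> real (card {x \<in> D. 0 < x})" using F(2) cD ss(2) by linarith
  moreover have "\<Sum>{x \<in> D. 0 < x} < int p"
  proof -
    have "\<Sum>{x \<in> D. 0 < x} = (\<Sum>x\<in>{x \<in> D. 0 < x}. \<bar>x\<bar>)" by (intro sum.cong) auto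
    also have "\<dots> \<le> (\<Sum>x\<in>D. \<bar>x\<bar>)" using finD by (intro sum_mono2) auto
    finally show ?thesis using sum by simp
  qed
  moreover have "\<forall>x\<in>{x \<in> D. 0 < x}. 0 < x \<and> real_of_int x \<le> K * s" using bd by fastforce
  moreover have "{x \<in> D. 0 < x} \<subseteq> signed_dilate (int p) b A" using b(2) by blast
  ultimately show ?thesis by blast
qed

lemma ex_dilate_dense_positive_part:
  "\<exists>(K::real) (p\<^sub>0::nat). K \<ge> 1 \<and> (\<forall>p A. prime p \<longrightarrow> p\<^sub>0 \<le> p \<longrightarrow> zsf (int p) A \<longrightarrow> inj_on (\<lambda>a. a mod int p) A \<longrightarrow>
     (14/10) * sqrt (real p) \<le> real (card A) \<longrightarrow>
     (\<exists>b P. \<not> int p dvd b \<and> P \<subseteq> signed_dilate (int p) b A \<and> (\<forall>x\<in>P. 0 < x \<and> real_of_int x \<le> K * sqrt (real p))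
        \<and> (139/100) * sqrt (real p) \<le> real (card P) \<and> \<Sum>P < int p))"
proof -
  have e: "0 < (1/1000::real)" "(1/1000::real) \<le> 1" by simp_all
  from ex_concentrating_dilate[OF e] obtain K0 :: real and p1 :: nat where K0: "K0 > 0"
    and conc: "\<forall>p A. prime p \<longrightarrow> p1 \<le> p \<longrightarrow> zsf (int p) A \<longrightarrow> inj_on (\<lambda>a. a mod int p) A \<longrightarrow> p \<le> card A * card A \<longrightarrow>
     (\<exists>\<xi>\<in>{1..<p}. real (card {a \<in> A. \<bar>smod (int p) (a * int \<xi>)\<bar> > K0 * sqrt (real p)}) \<le> (1/1000) * real (card A))"
    by (elim exE conjE) (rule that)
  define K where "K = max K0 1"
  have K: "K \<ge> 1" "K0 \<le> K" by (auto simp: K_def)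
  \<comment> \<open>In the second round \<open>F2\<close> has at most \<open>\<eta> * s\<close>
    elements of norm at most \<open>K * s\<close>; the factor \<open>K\<close> keeps their total
    norm within \<open>p / 1000000\<close>.\<close>
  define \<eta> where "\<eta> = 1 / (K * 1000000)"
  have \<eta>: "0 < \<eta>" "\<eta> \<le> 1" "\<eta> \<le> 1 / 1000000" using K by (auto simp: \<eta>_def field_simps)
  from ex_ap_dense[OF K(1) e] obtain s1 where s1: "\<forall>s D. s1 \<le> s \<longrightarrow> finite D \<longrightarrow> (\<forall>x\<in>D. real_of_int \<bar>x\<bar> \<le> K * s) \<longrightarrow> s \<le> real (card D) \<longrightarrow>
    (\<exists>d F u l D1. 0 < d \<and> F \<subseteq> D \<and> has_ap F u d l \<and> real (card F) \<le> (1/1000) * s \<and> (\<forall>x\<in>D. \<bar>x\<bar> \<le> l * d)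
       \<and> D1 \<subseteq> D - F \<and> (\<forall>x\<in>D1. d dvd x) \<and> real (card D) - (1/1000) * s \<le> real (card D1))"
    by (elim exE) (rule that)
  from ex_ap_dense[OF K(1) \<eta>(1,2)] obtain s2 where s2: "\<forall>s D. s2 \<le> s \<longrightarrow> finite D \<longrightarrow> (\<forall>x\<in>D. real_of_int \<bar>x\<bar> \<le> K * s) \<longrightarrow> s \<le> real (card D) \<longrightarrow>
    (\<exists>d F u l D1. 0 < d \<and> F \<subseteq> D \<and> has_ap F u d l \<and> real (card F) \<le> \<eta> * s \<and> (\<forall>x\<in>D. \<bar>x\<bar> \<le> l * d)
       \<and> D1 \<subseteq> D - F \<and> (\<forall>x\<in>D1. d dvd x) \<and> real (card D) - \<eta> * s \<le> real (card D1))"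
    by (elim exE) (rule that)
  define p0 where "p0 = p1 + 3 + nat \<lceil>(\<bar>s1\<bar> + \<bar>s2\<bar> + 2 * K + 1)\<^sup>2\<rceil>"
  show ?thesis
  proof (intro exI[of _ K] exI[of _ p0] conjI allI impI K(1))
    fix p :: nat and A :: "int set"
    assume p: "prime p" and pl: "p0 \<le> p" and z: "zsf (int p) A" and inj: "inj_on (\<lambda>a. a mod int p) A"
      and cA: "(14/10) * sqrt (real p) \<le> real (card A)"
    define s where "s = sqrt (real p)"
    have p': "prime (int p)" using p by simp
    have "p > 2" using pl by (simp add: p0_def)
    then have oddp: "odd p" using p prime_odd_nat by blast
    have ss: "s * s = real p" by (simp add: s_def)
    have sl: "\<bar>s1\<bar> + \<bar>s2\<bar> + 2 * K + 1 \<le> s" unfolding s_def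
    proof (rule real_le_rsqrt)
      have "(\<bar>s1\<bar> + \<bar>s2\<bar> + 2 * K + 1)\<^sup>2 \<le> real (nat \<lceil>(\<bar>s1\<bar> + \<bar>s2\<bar> + 2 * K + 1)\<^sup>2\<rceil>)"
        by (rule real_nat_ceiling_ge)
      also have "\<dots> \<le> real p" using pl by (simp add: p0_def)
      finally show "(\<bar>s1\<bar> + \<bar>s2\<bar> + 2 * K + 1)\<^sup>2 \<le> real p" .
    qed
    have s: "s1 \<le> s" "s2 \<le> s" "2 * K < s" "0 < s" using sl K by linarith+
    have finA: "finite A" using z zsf_finite by blast
    have "p \<le> card A * card A"
    proof -
      have "1 * s \<le> (14/10) * s" using s(4) by (intro mult_right_mono) auto
      then have "s * s \<le> real (card A) * real (card A)" using cA s(4) unfolding s_def[symmetric] by (intro mult_mono) auto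
      then have "real p \<le> real (card A * card A)" using ss by simp
      then show ?thesis by (simp only: of_nat_le_iff)
    qed
    moreover have "p1 \<le> p" using pl by (simp add: p0_def)
    ultimately obtain \<xi> where \<xi>: "\<xi> \<in> {1..<p}"
      and cbad: "real (card {a \<in> A. \<bar>smod (int p) (a * int \<xi>)\<bar> > K0 * s}) \<le> (1/1000) * real (card A)"
      using conc p z inj unfolding s_def by blast
    have p\<xi>: "\<not> int p dvd int \<xi>" using \<xi> by (auto dest: dvd_imp_le)
    have zA: "zsf (int p) (signed_dilate (int p) (int \<xi>) A)" by (rule zsf_signed_dilate[OF p' p\<xi> z inj])
    define D where "D = {x \<in> signed_dilate (int p) (int \<xi>) A. real_of_int \<bar>x\<bar> \<le> K * s}"
    have finD: "finite D" using zsf_finite[OF zA] by (simp add: D_def)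
    have "K * s < s * s / 2" using s by simp
    then have Ks: "K * s < real p / 2" using ss by simp
    \<comment> \<open>1.3986 is 0.999 * 1.4; the first progression will take another
      \<open>s / 1000\<close>.\<close>
    have cD: "(13986/10000) * s \<le> real (card D)"
    proof -
      let ?f = "\<lambda>a. smod (int p) (int \<xi> * a)"
      let ?Bad = "{a \<in> A. \<bar>smod (int p) (a * int \<xi>)\<bar> > K0 * s}"
      have "K0 * s \<le> K * s" using K s(4) by (intro mult_right_mono) auto
      then have "?f ` (A - ?Bad) \<subseteq> D"
        unfolding D_def signed_dilate_def by (auto simp: mult.commute)
      then have "card (?f ` (A - ?Bad)) \<le> card D" by (rule card_mono[OF finD])
      also have "card (?f ` (A - ?Bad)) = card (A - ?Bad)"
        by (rule card_image, rule inj_on_subset[OF inj_on_signed_dilate[OF p' p\<xi> inj]]) auto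
      also have "card (A - ?Bad) = card A - card ?Bad" using finA by (intro card_Diff_subset) auto
      finally have "real (card A) - real (card ?Bad) \<le> real (card D)" by linarith
      then show ?thesis using cbad cA unfolding s_def[symmetric] by linarith
    qed
    have Dsmall: "\<forall>x\<in>D. real_of_int \<bar>x\<bar> \<le> K * s" by (simp add: D_def)
    obtain d F u l D1 where r1: "0 < d" "F \<subseteq> D" "has_ap F u d l" "\<forall>x\<in>D. \<bar>x\<bar> \<le> l * d"
       "D1 \<subseteq> D - F" "\<forall>x\<in>D1. d dvd x" "real (card D) - (1/1000) * s \<le> real (card D1)"
    proof -
      have "s \<le> real (card D)" using cD s(4) by linarith
      from s1[THEN spec, THEN spec, THEN mp, OF s(1), THEN mp, OF finD, THEN mp, OF Dsmall, THEN mp, OF this] show ?thesis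
        by (elim exE conjE) (rule that)
    qed
    define M where "M = \<lfloor>K * s\<rfloor>"
    have M: "real_of_int M \<le> K * s" by (simp add: M_def)
    have "real_of_int (2 * M) < real_of_int (int p)" using M Ks by simp
    then have M2: "2 * M < int p" by (simp only: of_int_less_iff)
    have DM: "\<bar>x\<bar> \<le> M" if "x \<in> D" for x
      using that by (simp add: D_def M_def le_floor_iff)
    have D1ne: "D1 \<noteq> {}" using r1(7) cD s(4) by auto
    have DA: "D \<subseteq> signed_dilate (int p) (int \<xi>) A" by (auto simp: D_def)
    have "\<exists>b D'. \<not> int p dvd b \<and> D' \<subseteq> signed_dilate (int p) b A \<and> card D' = card D1
      \<and> (\<forall>x\<in>D'. \<bar>x\<bar> \<le> M) \<and> (\<Sum>x\<in>D'. \<bar>x\<bar>) < int p"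
      by (rule redilate[OF p' z inj p\<xi> DA _ M2 r1(2,3,1) _ r1(5) D1ne]) (use DM r1(4,6) in auto)
    then obtain b D' where b: "\<not> int p dvd b" and D': "D' \<subseteq> signed_dilate (int p) b A" "card D' = card D1"
      "\<forall>x\<in>D'. \<bar>x\<bar> \<le> M" "(\<Sum>x\<in>D'. \<bar>x\<bar>) < int p"
      by (elim exE conjE) (rule that)
    have zD': "zsf (int p) D'" by (rule zsf_subset[OF zsf_signed_dilate[OF p' b z inj] D'(1)])
    have finD': "finite D'" using zD' zsf_finite by blast
    have D'small: "real_of_int \<bar>x\<bar> \<le> K * s" if "x \<in> D'" for x
    proof -
      have "\<bar>x\<bar> \<le> M" using D'(3) that by blast
      then have "real_of_int \<bar>x\<bar> \<le> real_of_int M" by (simp only: of_int_le_iff)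
      then show ?thesis using M by linarith
    qed
    then have D'ball: "\<forall>x\<in>D'. real_of_int \<bar>x\<bar> \<le> K * s" by blast
    have cD': "(1397/1000) * s \<le> real (card D')" using r1(7) cD D'(2) s(4) by linarith
    then have cD's: "s \<le> real (card D')" using s(4) by linarith
    obtain d2 F2 u2 l2 D2 where r2: "0 < d2" "F2 \<subseteq> D'" "has_ap F2 u2 d2 l2" "real (card F2) \<le> \<eta> * s" "\<forall>x\<in>D'. \<bar>x\<bar> \<le> l2 * d2"
       "D2 \<subseteq> D' - F2" "\<forall>x\<in>D2. d2 dvd x" "real (card D') - \<eta> * s \<le> real (card D2)"
      using s2[THEN spec, THEN spec, THEN mp, OF s(2), THEN mp, OF finD', THEN mp, OF D'ball, THEN mp, OF cD's] by (elim exE conjE) (rule that)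
    have es: "\<eta> * s \<le> 1 / 1000000 * s" using \<eta> s(4) by (intro mult_right_mono) auto
    have "d2 = 1"
    proof (rule common_divisor_is_1[OF zD' D'(4) _ _ r2(1)])
      show "D2 \<subseteq> D'" using r2(6) by blast
      show "d2 dvd x" if "x \<in> D2" for x using r2(7) that by blast
      have "s \<le> real (card D2)" using r2(8) cD' es s(4) by linarith
      then have "s * s \<le> real (card D2) * real (card D2)" using s(4) by (intro mult_mono) auto
      then have "real p \<le> real (card D2 * card D2)" using ss by simp
      then have "p \<le> card D2 * card D2" by (simp only: of_nat_le_iff)
      then show "int p \<le> int (card D2) * int (card D2)" by (simp flip: of_nat_mult)
    qed
    then have ap2: "has_ap F2 u2 1 l2" and l2: "\<And>x. x \<in> D' \<Longrightarrow> \<bar>x\<bar> \<le> l2" using r2(3,5) by auto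
    have D'ne: "D' \<noteq> {}" using cD's s(4) by auto
    have finF2: "finite F2" using r2(2) finD' finite_subset by blast
    have F2s: "real (card F2) \<le> s / 1000000" using r2(4) es by simp
    define B where "B = int (card F2) * M"
    have B: "real_of_int B \<le> real p / 1000000"
    proof -
      have "real_of_int B = real (card F2) * real_of_int M" by (simp add: B_def)
      also have "\<dots> \<le> real (card F2) * (K * s)" using M by (intro mult_left_mono) auto
      also have "\<dots> \<le> (\<eta> * s) * (K * s)" using r2(4) K s(4) by (intro mult_right_mono) auto
      also have "\<dots> = (\<eta> * K) * (s * s)" by simp
      also have "\<eta> * K = 1 / 1000000" using K by (simp add: \<eta>_def)
      finally show ?thesis using ss by simp
    qed
    have dich: "(\<Sum>x | x \<in> D' - F2 \<and> x < 0. \<bar>x\<bar>) \<le> B \<or> (\<Sum>x | x \<in> D' - F2 \<and> 0 < x. \<bar>x\<bar>) \<le> B"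
      unfolding B_def by (rule sign_dichotomy[OF zD' r2(2) ap2 _ D'ne]) (use l2 D'(3) in auto)
    show "\<exists>b P. \<not> int p dvd b \<and> P \<subseteq> signed_dilate (int p) b A \<and> (\<forall>x\<in>P. 0 < x \<and> real_of_int x \<le> K * sqrt (real p))
        \<and> (139/100) * sqrt (real p) \<le> real (card P) \<and> \<Sum>P < int p"
      using dich
    proof
      assume "(\<Sum>x | x \<in> D' - F2 \<and> x < 0. \<bar>x\<bar>) \<le> B"
      from positive_part_of_dilate[OF p oddp s_def z inj b D'(1) D'ball D'(4) cD' finF2 F2s B this]
      obtain P where "P \<subseteq> signed_dilate (int p) b A \<and> (\<forall>x\<in>P. 0 < x \<and> real_of_int x \<le> K * s) \<and> (139/100) * s \<le> real (card P) \<and> \<Sum>P < int p"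
        by (elim exE) (rule that)
      then show ?thesis using b unfolding s_def[symmetric] by (intro exI[of _ "b"] exI[of _ P]) simp
    next
      assume pos: "(\<Sum>x | x \<in> D' - F2 \<and> 0 < x. \<bar>x\<bar>) \<le> B"
      let ?D = "uminus ` D'" and ?F = "uminus ` F2"
      have b': "\<not> int p dvd - b" using b by simp
      have D: "?D \<subseteq> signed_dilate (int p) (- b) A"
        using D'(1) oddp p by (subst signed_dilate_minus) (auto intro: prime_gt_0_nat)
      have small: "\<forall>x\<in>?D. real_of_int \<bar>x\<bar> \<le> K * s" using D'small by auto
      have sum: "(\<Sum>x\<in>?D. \<bar>x\<bar>) < int p" using D'(4) by (simp add: sum.reindex)
      have cD: "(1397/1000) * s \<le> real (card ?D)" using cD' by (simp add: card_image)
      have F: "finite ?F" "real (card ?F) \<le> s / 1000000" using finF2 F2s by (auto simp: card_image)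
      have "{x. x \<in> ?D - ?F \<and> x < 0} = uminus ` {x. x \<in> D' - F2 \<and> 0 < x}" by force
      then have neg: "(\<Sum>x | x \<in> ?D - ?F \<and> x < 0. \<bar>x\<bar>) \<le> B" using pos by (simp add: sum.reindex)
      from positive_part_of_dilate[OF p oddp s_def z inj b' D small sum cD F B neg]
      obtain P where "P \<subseteq> signed_dilate (int p) (- b) A \<and> (\<forall>x\<in>P. 0 < x \<and> real_of_int x \<le> K * s) \<and> (139/100) * s \<le> real (card P) \<and> \<Sum>P < int p"
        by (elim exE) (rule that)
      then show ?thesis using b' unfolding s_def[symmetric] by (intro exI[of _ "- b"] exI[of _ P]) simp
    qed
  qed
qed

section \<open>Intervals of subset sums\<close>

text \<open>If no pair works, \<open>f\<close> selects from each pair \<open>x < n - x\<close> a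
  member missing from \<open>G\<close>. The bounds on \<open>n\<close> guarantee more than
  \<open>h\<close> such pairs within \<open>{1..w}\<close>.\<close>

lemma ex_two_summands:
  fixes w h n :: int
  assumes G: "int (card ({1..w} - G)) \<le> h" and n: "2 * h + 3 \<le> n" "n \<le> 2 * w - 2 * h - 2" and h: "0 \<le> h"
  shows "\<exists>x\<in>G. \<exists>y\<in>G. x \<noteq> y \<and> x + y = n"
proof (rule ccontr)
  assume neg: "\<not> ?thesis"
  define I where "I = {max 1 (n - w)..(n - 1) div 2}"
  define f where "f x = (if x \<in> G then n - x else x)" for x
  have lt: "2 * x < n" if "x \<in> I" for x using that by (auto simp: I_def)
  have "inj_on f I"
  proof (rule inj_onI)
    fix x y assume "x \<in> I" "y \<in> I" "f x = f y"
    then show "x = y" using lt[of x] lt[of y] by (auto simp: f_def split: if_splits)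
  qed
  moreover have "f ` I \<subseteq> {1..w} - G"
  proof
    fix y assume "y \<in> f ` I"
    then obtain x where x: "x \<in> I" "y = f x" by blast
    have "x \<noteq> n - x" using lt[OF x(1)] by auto
    then have "n - x \<notin> G" if "x \<in> G" using neg that by force
    moreover have "1 \<le> x" "n - w \<le> x" using x(1) by (auto simp: I_def)
    ultimately show "y \<in> {1..w} - G" using x(2) lt[OF x(1)] n by (auto simp: f_def)
  qed
  ultimately have "card I \<le> card ({1..w} - G)" by (intro card_inj_on_le) auto
  then have "int (card I) \<le> h" using G by simp
  moreover have "h + 1 \<le> (n - 1) div 2 - max 1 (n - w) + 1"
    using n by (cases "n - w \<le> 1") (auto simp: max_def)
  ultimately show False using h unfolding I_def by (simp split: if_splits)
qed

text \<open>The first \<open>card P\<close> positive integers already account for the square. With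
  \<open>h\<close> integers up to \<open>W\<close> missing, \<open>card P - W + h\<close> elements
  lie above \<open>W\<close>, and each of these is pushed up by at least \<open>h\<close>.\<close>

lemma missing_count:
  fixes W :: int
  assumes P: "finite P" "\<And>x. x \<in> P \<Longrightarrow> 0 < x" and W: "W \<ge> 0"
  defines "h \<equiv> int (card ({1..W} - P))"
  shows "int (card P) * int (card P) + 2 * (int (card P) - W + h) * h \<le> 2 * \<Sum>P"
    and "0 \<le> int (card P) - W + h"
proof -
  define L where "L = {x \<in> P. x \<le> W}"
  define U where "U = {x \<in> P. W < x}"
  have fin: "finite L" "finite U" using P by (auto simp: L_def U_def)
  have LU: "P = L \<union> U" "L \<inter> U = {}" by (auto simp: L_def U_def)
  have cP: "int (card P) = int (card L) + int (card U)"
    unfolding LU(1) using fin LU(2) by (simp add: card_Un_disjoint)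
  have sP: "\<Sum>P = \<Sum>L + \<Sum>U" unfolding LU(1) using fin LU(2) by (simp add: sum.union_disjoint)
  have "{1..W} = L \<union> ({1..W} - P)" "L \<inter> ({1..W} - P) = {}" using P(2) by (force simp: L_def)+
  then have "card {1..W} = card L + card ({1..W} - P)" using fin(1) by (metis card_Un_disjoint finite_Diff finite_atLeastAtMost_int)
  then have cL: "int (card L) = W - h" using W by (simp add: h_def)
  have q: "int (card U) = int (card P) - W + h" using cP cL by simp
  have 1: "2 * int (card U) * W + int (card U) * (int (card U) + 1) \<le> 2 * \<Sum>U"
    using fin by (intro sum_ge_of_lower_bound) (auto simp: U_def)
  have 2: "int (card L) * (int (card L) + 1) \<le> 2 * \<Sum>L"
    using sum_ge_of_lower_bound[of L 0] fin P(2) by (auto simp: L_def)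
  have "int (card P) * int (card P) + 2 * int (card U) * h
      \<le> (2 * int (card U) * W + int (card U) * (int (card U) + 1)) + int (card L) * (int (card L) + 1)"
    unfolding cP cL by (simp add: algebra_simps) (use cL in linarith)
  then show "int (card P) * int (card P) + 2 * (int (card P) - W + h) * h \<le> 2 * \<Sum>P"
    using 1 2 sP unfolding q by linarith
  show "0 \<le> int (card P) - W + h" using q by linarith
qed

lemma has_ap_absorb_pos:
  assumes "finite F" "has_ap F u 1 l" "l \<ge> 0" "finite R" "R \<inter> F = {}" "\<And>x. x \<in> R \<Longrightarrow> 0 < x \<and> x \<le> l + 1"
  shows "has_ap (F \<union> R) u 1 (l + \<Sum>R)"
proof -
  have "has_ap (F \<union> R) (u + (\<Sum>x | x \<in> R \<and> x < 0. x)) 1 (l + (\<Sum>x\<in>R. \<bar>x\<bar> div 1))"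
    by (rule has_ap_absorb[OF assms(1) _ assms(2,3,4,5)]) (use assms(6) in force)+
  moreover have "{x. x \<in> R \<and> x < 0} = {}" using assms(6) by fastforce
  moreover have "(\<Sum>x\<in>R. \<bar>x\<bar> div 1) = \<Sum>R" using assms(6) by (intro sum.cong) force+
  ultimately show ?thesis by (simp only: sum.empty add_0_right)
qed

text \<open>A long interval of subset sums of the positive elements already determines everything: by
  complementation it bounds the total of the positive elements, and it leaves no room for negative
  elements of total norm \<open>u\<close> or more.\<close>

lemma sums_bounded_by_interval:
  assumes z: "zsf p S" and p: "p > 0" and b: "\<And>x. x \<in> S \<Longrightarrow> 2 * \<bar>x\<bar> \<le> p"
    and G: "G \<subseteq> {x \<in> S. 0 < x}" "\<Sum>G \<le> p"
    and ap: "has_ap {x \<in> S. 0 < x} u 1 (l + \<Sum>({x \<in> S. 0 < x} - G))" and ul: "0 < u" "0 \<le> l"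
    and long: "p \<le> 2 * (l + \<Sum>({x \<in> S. 0 < x} - G))"
  shows "\<Sum>{x \<in> S. 0 < x} < p + u" and "(\<Sum>x | x \<in> S \<and> x < 0. \<bar>x\<bar>) < u"
proof -
  let ?P = "{x \<in> S. 0 < x}"
  let ?l = "l + \<Sum>(?P - G)"
  have finS: "finite S" using z zsf_finite by blast
  have rep: "\<exists>C\<subseteq>?P. C \<noteq> {} \<and> \<Sum>C = m" if m: "u \<le> m" "m \<le> u + ?l" for m
  proof -
    have "m - u \<in> {0..?l}" using m by auto
    with ap have "u + (m - u) * 1 \<in> nonempty_sums ?P" unfolding has_ap_def by (rule bspec)
    then have "m \<in> nonempty_sums ?P" by simp
    then show ?thesis unfolding nonempty_sums_def by (elim CollectE exE) blast
  qed
  have split: "\<Sum>?P = \<Sum>G + \<Sum>(?P - G)"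
    using G(1) finS by (subst sum.subset_diff[OF G(1)]) auto
  show "\<Sum>?P < p + u"
  proof (rule ccontr)
    assume "\<not> \<Sum>?P < p + u"
    \<comment> \<open>This value lies in the interval because \<open>G\<close> sums to at most
      \<open>p\<close>; the complement of the corresponding \<open>C\<close> then sums to exactly
      \<open>p\<close>.\<close>
    then have "u \<le> \<Sum>?P - p" "\<Sum>?P - p \<le> u + ?l" using split G(2) ul by linarith+
    then obtain C where C: "C \<subseteq> ?P" "\<Sum>C = \<Sum>?P - p" using rep by blast
    have "\<Sum>?P = \<Sum>C + \<Sum>(?P - C)" using C(1) finS by (subst sum.subset_diff[OF C(1)]) auto
    then have s: "\<Sum>(?P - C) = p" using C(2) by simp
    then have "?P - C \<noteq> {}" using p by force
    then have "\<not> p dvd \<Sum>(?P - C)" by (intro zsf_not_dvd[OF z]) auto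
    then show False using s by simp
  qed
  \<comment> \<open>Negative elements are added one at a time. Each has norm at most
    \<open>p / 2\<close>, hence at most \<open>?l\<close>, so the first total to reach
    \<open>u\<close> lies in the interval and is cancelled by positive elements.\<close>
  have all: "(\<Sum>x\<in>N. \<bar>x\<bar>) < u" if "finite N" "N \<subseteq> {x. x \<in> S \<and> x < 0}" for N
    using that
  proof (induction N rule: finite_induct)
    case empty then show ?case using ul by simp
  next
    case (insert y N)
    then have IH: "(\<Sum>x\<in>N. \<bar>x\<bar>) < u" and y: "y \<in> S" "y < 0" by auto
    let ?m = "\<Sum>x\<in>insert y N. \<bar>x\<bar>"
    have m: "?m = \<bar>y\<bar> + (\<Sum>x\<in>N. \<bar>x\<bar>)" using insert by simp
    show ?case
    proof (rule ccontr)
      assume "\<not> ?m < u"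
      moreover have "?m \<le> u + ?l" using m IH b[OF y(1)] long unfolding distrib_left by linarith
      ultimately obtain C where C: "C \<subseteq> ?P" "C \<noteq> {}" "\<Sum>C = ?m" using rep[of ?m] by auto
      have "?m = - \<Sum>(insert y N)"
        unfolding sum_negf[symmetric] using insert.prems by (intro sum.cong) auto
      moreover have "\<Sum>(C \<union> insert y N) = \<Sum>C + \<Sum>(insert y N)"
      proof (rule sum.union_disjoint)
        show "finite C" using C(1) finS by (auto intro: finite_subset)
        show "finite (insert y N)" using insert.hyps by simp
        have "?P \<inter> {x. x \<in> S \<and> x < 0} = {}" by auto
        then show "C \<inter> insert y N = {}" using C(1) insert.prems by blast
      qed
      ultimately have "\<Sum>(C \<union> insert y N) = 0" using C(3) by simp
      moreover have "\<not> p dvd \<Sum>(C \<union> insert y N)"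
        by (rule zsf_not_dvd[OF z]) (use C(1) insert.prems in auto)
      ultimately show False by simp
    qed
  qed
  show "(\<Sum>x | x \<in> S \<and> x < 0. \<bar>x\<bar>) < u" by (rule all) (use finS in auto)
qed

text \<open>The cut-offs are staged: sums of two elements up to \<open>w\<close>, about
  \<open>0.7 * s\<close>, fill an interval longer than \<open>W\<close>, about \<open>s\<close>; the
  elements between \<open>w\<close> and \<open>W\<close> make it longer than \<open>K * s\<close>,
  the bound for \<open>P\<close>; the rest of \<open>P\<close> makes it longer than
  \<open>p / 2\<close>, the bound for \<open>S\<close>.\<close>

lemma sums_bounded_of_dense_part:
  fixes p :: nat and s K :: real
  assumes z: "zsf (int p) S" and p: "p > 0" and s: "s = sqrt (real p)" and b: "\<And>x. x \<in> S \<Longrightarrow> 2 * \<bar>x\<bar> \<le> int p"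
    and P: "P \<subseteq> S" "\<And>x. x \<in> P \<Longrightarrow> 0 < x \<and> real_of_int x \<le> K * s" and cP: "(139/100) * s \<le> real (card P)"
    and sP: "\<Sum>P < int p" and big: "200 \<le> s" "8 * K \<le> s"
  shows "real_of_int (\<Sum>{x \<in> S. 0 < x}) \<le> real p + s" and "real_of_int (\<Sum>x | x \<in> S \<and> x < 0. \<bar>x\<bar>) \<le> s"
proof -
  have ss: "s * s = real p" by (simp add: s)
  have finS: "finite S" using z zsf_finite by blast
  have finP: "finite P" using P(1) finS finite_subset by blast
  define W where "W = \<lfloor>s\<rfloor>"
  define w where "w = \<lfloor>(7/10) * s\<rfloor>"
  have W: "real_of_int W \<le> s" "s - 1 < real_of_int W" unfolding W_def by linarith+
  have w: "real_of_int w \<le> (7/10) * s" "(7/10) * s - 1 < real_of_int w" unfolding w_def by linarith+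
  have W0: "W \<ge> 0" and w0: "w \<ge> 0" using big by (simp_all add: W_def w_def)
  have "real_of_int w \<le> real_of_int W" using w W big by linarith
  then have wW: "w \<le> W" by (simp only: of_int_le_iff)
  define h where "h = int (card ({1..W} - P))"
  have h0: "h \<ge> 0" by (simp add: h_def)
  have h: "real_of_int h \<le> (8/100) * s"
  proof (rule ccontr)
    assume neg: "\<not> real_of_int h \<le> (8/100) * s"
    define n where "n = real (card P)"
    \<comment> \<open>0.47 is 1.39 - 1 + 0.08. In units of \<open>s * s\<close>, the square of 1.39
      plus 2 * 0.47 * 0.08 exceeds 2, the bound for twice the sum of \<open>P\<close>.\<close>
    have q: "(47/100) * s \<le> n - real_of_int W + real_of_int h" using cP W neg unfolding n_def by linarith
    have "(139/100 * s) * (139/100 * s) \<le> n * n" using cP big unfolding n_def by (intro mult_mono) auto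
    moreover have "(2 * ((47/100) * s)) * ((8/100) * s) \<le> (2 * (n - real_of_int W + real_of_int h)) * real_of_int h"
      using q neg big by (intro mult_mono) auto
    moreover have "real_of_int (int (card P) * int (card P) + 2 * (int (card P) - W + h) * h) \<le> real_of_int (2 * \<Sum>P)"
      using missing_count(1)[OF finP _ W0] P(2) unfolding h_def by (simp only: of_int_le_iff)
    then have "n * n + (2 * (n - real_of_int W + real_of_int h)) * real_of_int h \<le> 2 * real_of_int (\<Sum>P)"
      unfolding n_def by simp
    moreover have "real_of_int (\<Sum>P) \<le> s * s" using sP unfolding ss by linarith
    moreover have "s * s > 0" using big by simp
    ultimately show False by (simp add: algebra_simps)
  qed
  define G where "G = P \<inter> {1..w}"
  define Q where "Q = P \<inter> {w<..W}"
  define u where "u = 2 * h + 3"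
  \<comment> \<open>From \<open>u\<close> to \<open>u + l\<close> is exactly the range of
    \<open>n\<close> in \<open>ex_two_summands\<close>.\<close>
  define l where "l = 2 * w - 4 * h - 5"
  have fin: "finite G" "finite Q" using finP by (auto simp: G_def Q_def)
  have "real_of_int l \<ge> (108/100) * s - 7" using w h unfolding l_def by simp
  then have lW: "real_of_int W \<le> real_of_int l" using W big by linarith
  then have lW: "W \<le> l" by (simp only: of_int_le_iff)
  have apG: "has_ap G u 1 l"
    unfolding has_ap_def
  proof
    fix i assume i: "i \<in> {0..l}"
    have "{1..w} - G \<subseteq> {1..W} - P" using wW by (auto simp: G_def)
    then have "card ({1..w} - G) \<le> card ({1..W} - P)" by (intro card_mono) auto
    then have "int (card ({1..w} - G)) \<le> h" by (simp add: h_def)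
    from ex_two_summands[OF this _ _ h0, of "u + i"] i
    obtain x y where xy: "x \<in> G" "y \<in> G" "x \<noteq> y" "x + y = u + i" unfolding u_def l_def by auto
    show "u + i * 1 \<in> nonempty_sums G" by (rule nonempty_sumsI[of "{x, y}"]) (use xy in auto)
  qed
  have apGQ: "has_ap (G \<union> Q) u 1 (l + \<Sum>Q)"
    by (rule has_ap_absorb_pos[OF fin(1) apG _ fin(2)]) (use lW W0 w0 in \<open>auto simp: G_def Q_def\<close>)
  have Qpos: "0 \<le> \<Sum>Q" using w0 by (intro sum_nonneg) (auto simp: Q_def)
  \<comment> \<open>\<open>Q\<close> has at least \<open>0.2 * s\<close> elements, all above
    \<open>0.65 * s\<close>, so its sum is at least \<open>0.13 * s * s\<close>, while
    \<open>8 * K \<le> s\<close> makes \<open>K * s\<close> at most an eighth of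
    \<open>s * s\<close>.\<close>
  have Ks: "K * s \<le> real_of_int (\<Sum>Q)"
  proof -
    have "{w<..W} \<subseteq> Q \<union> ({1..W} - P)" using w0 by (auto simp: Q_def)
    then have "card {w<..W} \<le> card (Q \<union> ({1..W} - P))" using fin by (intro card_mono) auto
    also have "\<dots> \<le> card Q + card ({1..W} - P)" by (rule card_Un_le)
    finally have "W - w \<le> int (card Q) + h" using wW by (simp add: h_def)
    then have "real_of_int (W - w) \<le> real_of_int (int (card Q) + h)" by (simp only: of_int_le_iff)
    then have cQ: "(20/100) * s \<le> real (card Q)" using W w h big by simp
    have "(20/100 * s) * (65/100 * s) \<le> real (card Q) * real_of_int w"
      using cQ w big by (intro mult_mono) auto
    also have "\<dots> = (\<Sum>x\<in>Q. real_of_int w)" by simp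
    also have "\<dots> \<le> (\<Sum>x\<in>Q. real_of_int x)" by (intro sum_mono) (auto simp: Q_def)
    finally have "(13/100) * (s * s) \<le> real_of_int (\<Sum>Q)" by simp
    moreover have "8 * K * s \<le> s * s" using big by (intro mult_right_mono) auto
    moreover have "0 \<le> s * s" by simp
    ultimately show ?thesis by linarith
  qed
  have GQ: "G \<union> Q \<subseteq> P" by (auto simp: G_def Q_def)
  have "has_ap ((G \<union> Q) \<union> (P - (G \<union> Q))) u 1 (l + \<Sum>Q + \<Sum>(P - (G \<union> Q)))"
  proof (rule has_ap_absorb_pos[OF _ apGQ])
    fix x assume x: "x \<in> P - (G \<union> Q)"
    then have "real_of_int x \<le> real_of_int (\<Sum>Q)" using P(2)[of x] Ks by auto
    then have "x \<le> \<Sum>Q" by (simp only: of_int_le_iff)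
    then show "0 < x \<and> x \<le> l + \<Sum>Q + 1" using P(2)[of x] x lW W0 by auto
  qed (use fin finP Qpos lW W0 in auto)
  moreover have "(G \<union> Q) \<union> (P - (G \<union> Q)) = P" using GQ by blast
  moreover have "\<Sum>Q + \<Sum>(P - (G \<union> Q)) = \<Sum>(P - G)"
  proof -
    have "Q \<inter> G = {}" by (auto simp: G_def Q_def)
    then have "P - G = Q \<union> (P - (G \<union> Q))" using GQ by blast
    moreover have "\<Sum>(Q \<union> (P - (G \<union> Q))) = \<Sum>Q + \<Sum>(P - (G \<union> Q))"
      using fin finP by (intro sum.union_disjoint) auto
    ultimately show ?thesis by simp
  qed
  ultimately have apP: "has_ap P u 1 (l + \<Sum>(P - G))" by (simp add: add.assoc)
  \<comment> \<open>\<open>P - G\<close> has at least \<open>0.69 * s\<close> elements, all above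
    \<open>w\<close>; in units of \<open>s * s\<close>, twice their sum is at least 2 * 0.69 * 0.65
    plus the square of 0.69, which exceeds 1.\<close>
  have longP: "int p \<le> 2 * \<Sum>(P - G)"
  proof -
    have "card G \<le> card {1..w}" by (intro card_mono) (auto simp: G_def)
    then have "real (card G) \<le> real_of_int w" using w0 by simp
    moreover have "card (P - G) = card P - card G" using fin(1) by (intro card_Diff_subset) (auto simp: G_def)
    then have "real (card P) - real (card G) \<le> real (card (P - G))" by linarith
    ultimately have c: "(69/100) * s \<le> real (card (P - G))" using cP w by linarith
    have "2 * int (card (P - G)) * w + int (card (P - G)) * (int (card (P - G)) + 1) \<le> 2 * \<Sum>(P - G)"
      using finP P(2) by (intro sum_ge_of_lower_bound) (force simp: G_def)+
    then have "real_of_int (2 * int (card (P - G)) * w + int (card (P - G)) * (int (card (P - G)) + 1)) \<le> real_of_int (2 * \<Sum>(P - G))"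
      by (simp only: of_int_le_iff)
    then have "2 * (real (card (P - G)) * real_of_int w) + real (card (P - G)) * (real (card (P - G)) + 1) \<le> real_of_int (2 * \<Sum>(P - G))"
      by simp
    moreover have "(69/100 * s) * (65/100 * s) \<le> real (card (P - G)) * real_of_int w"
      using c w big by (intro mult_mono) auto
    moreover have "(69/100 * s) * (69/100 * s) \<le> real (card (P - G)) * (real (card (P - G)) + 1)"
      using c big by (intro mult_mono) auto
    moreover have "s * s \<le> 2 * ((69/100 * s) * (65/100 * s)) + (69/100 * s) * (69/100 * s)" by simp
    ultimately have "s * s \<le> real_of_int (2 * \<Sum>(P - G))" by linarith
    then have "real_of_int (int p) \<le> real_of_int (2 * \<Sum>(P - G))" using ss by simp
    then show ?thesis by (simp only: of_int_le_iff)
  qed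
  let ?S = "{x \<in> S. 0 < x}"
  have PS: "P \<subseteq> ?S" using P by blast
  have GS: "G \<subseteq> ?S" using PS by (auto simp: G_def)
  have "has_ap (P \<union> (?S - P)) u 1 (l + \<Sum>(P - G) + \<Sum>(?S - P))"
  proof (rule has_ap_absorb_pos[OF finP apP])
    show "0 \<le> l + \<Sum>(P - G)" using longP lW W0 by linarith
    fix x assume x: "x \<in> ?S - P"
    then show "0 < x \<and> x \<le> l + \<Sum>(P - G) + 1" using b[of x] longP lW W0 by auto
  qed (use finS in auto)
  moreover have "P \<union> (?S - P) = ?S" using PS by blast
  moreover have split: "\<Sum>(P - G) + \<Sum>(?S - P) = \<Sum>(?S - G)"
  proof -
    have "?S - G = (P - G) \<union> (?S - P)" using PS by (auto simp: G_def)
    moreover have "\<Sum>((P - G) \<union> (?S - P)) = \<Sum>(P - G) + \<Sum>(?S - P)"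
      using finP finS by (intro sum.union_disjoint) auto
    ultimately show ?thesis by simp
  qed
  ultimately have apS: "has_ap ?S u 1 (l + \<Sum>(?S - G))" by (simp add: add.assoc)
  have u0: "0 < u" "0 \<le> l" using h0 lW W0 by (auto simp: u_def)
  have "0 \<le> \<Sum>(?S - P)" by (intro sum_nonneg) auto
  then have long: "int p \<le> 2 * (l + \<Sum>(?S - G))" using longP split u0 unfolding distrib_left by linarith
  have sG: "\<Sum>G \<le> int p"
  proof -
    have "\<Sum>G \<le> \<Sum>P" using finP P(2) by (intro sum_mono2) (auto simp: G_def dest: P(2) intro: less_imp_le)
    then show ?thesis using sP by simp
  qed
  have "0 < int p" using p by simp
  note fin_bounds = sums_bounded_by_interval[OF z this b GS sG apS u0 long]
  have us: "real_of_int u \<le> s" using h big unfolding u_def by simp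
  have "real_of_int (\<Sum>?S) < real_of_int (int p + u)" using fin_bounds(1) by (simp only: of_int_less_iff)
  then show "real_of_int (\<Sum>?S) \<le> real p + s" using us by simp
  have "real_of_int (\<Sum>x | x \<in> S \<and> x < 0. \<bar>x\<bar>) < real_of_int u" using fin_bounds(2) by (simp only: of_int_less_iff)
  then show "real_of_int (\<Sum>x | x \<in> S \<and> x < 0. \<bar>x\<bar>) \<le> s" using us by linarith
qed

section \<open>The residue ring\<close>

lemma finsum_residue_ring:
  assumes p: "p > 1" and fin: "finite B" and B: "B \<subseteq> carrier (Zmod p)"
  shows "finsum (Zmod p) (\<lambda>x. x) B = \<Sum>B mod int p"
proof -
  interpret residues "int p" "Zmod p" using p by unfold_locales auto
  show ?thesis using fin B
  proof (induction B rule: finite_induct)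
    case empty then show ?case by (simp add: res_zero_eq)
  next
    case (insert x B)
    have "finsum (Zmod p) (\<lambda>x. x) (insert x B) = x \<oplus>\<^bsub>Zmod p\<^esub> finsum (Zmod p) (\<lambda>x. x) B"
      using insert by (intro finsum_insert) auto
    then show ?case using insert by (simp add: res_add_eq mod_simps)
  qed
qed

lemma zsf_of_zero_sum_free:
  assumes p: "p > 1" and A: "A \<subseteq> carrier (Zmod p)" and z: "zero_sum_free p A"
  shows "zsf (int p) A" "inj_on (\<lambda>a. a mod int p) A"
proof -
  interpret residues "int p" "Zmod p" using p by unfold_locales auto
  have carr: "carrier (Zmod p) = {0..int p - 1}" by (rule res_carrier_eq)
  have finA: "finite A" using A unfolding carr using finite_subset by blast
  show "zsf (int p) A"
    unfolding zsf_def
  proof (intro conjI allI impI finA notI)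
    fix B assume B: "B \<subseteq> A" "B \<noteq> {}" "int p dvd \<Sum>B"
    have "finsum (Zmod p) (\<lambda>x. x) B = \<Sum>B mod int p"
      by (rule finsum_residue_ring[OF p finite_subset[OF B(1) finA] order.trans[OF B(1) A]])
    then have z0: "finsum (Zmod p) (\<lambda>x. x) B = \<zero>\<^bsub>Zmod p\<^esub>" using B(3) by (simp add: res_zero_eq)
    have "\<zero>\<^bsub>Zmod p\<^esub> \<in> subset_sums p A"
      unfolding subset_sums_def mem_Collect_eq by (intro exI[of _ B] conjI z0[symmetric] B)
    then show False using z by (simp add: zero_sum_free_def)
  qed
  have "a mod int p = a" if "a \<in> A" for a using A that unfolding carr by fastforce
  then show "inj_on (\<lambda>a. a mod int p) A" by (intro inj_onI) metis
qed

text \<open>Residues above \<open>p / 2\<close> are the negative representatives shifted by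
  \<open>p\<close>. The boundary cases do not occur: \<open>p / 2\<close> by oddness, 0 because the
  dilate is zero-sum-free.\<close>

lemma dilate_norm_sums:
  assumes p: "p > 1" and odd: "odd p" and A: "A \<subseteq> carrier (Zmod p)" and z: "zsf (int p) (signed_dilate (int p) b A)"
  defines "b' \<equiv> b mod int p"
  shows "(\<Sum>a | a \<in> dilate p b' A \<and> real_of_int a < real p / 2. residue_norm p a)
      = \<Sum>{x \<in> signed_dilate (int p) b A. 0 < x}"
    and "(\<Sum>a | a \<in> dilate p b' A \<and> real_of_int a > real p / 2. residue_norm p a)
      = (\<Sum>x | x \<in> signed_dilate (int p) b A \<and> x < 0. \<bar>x\<bar>)"
proof -
  interpret residues "int p" "Zmod p" using p by unfold_locales auto
  have p0: "int p > 0" using p by simp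
  have dil: "dilate p b' A = (\<lambda>a. (b * a) mod int p) ` A"
    unfolding dilate_def b'_def by (auto simp: res_mult_eq mod_simps)
  have less: "real_of_int a < real p / 2 \<longleftrightarrow> 2 * a < int p" for a by linarith
  have gr: "real_of_int a > real p / 2 \<longleftrightarrow> 2 * a > int p" for a by linarith
  have rng: "0 \<le> (b * a) mod int p" "(b * a) mod int p < int p" for a using p0 by auto
  have nz: "(b * a) mod int p \<noteq> 0" if "a \<in> A" for a
  proof
    assume "(b * a) mod int p = 0"
    then have "smod (int p) (b * a) = 0" using p0 by (simp add: smod_def)
    then have "0 \<in> signed_dilate (int p) b A" using that by (force simp: signed_dilate_def)
    then show False using zsf_elem[OF z, of 0] by simp
  qed
  have eq1: "{a. a \<in> dilate p b' A \<and> real_of_int a < real p / 2} = {x \<in> signed_dilate (int p) b A. 0 < x}"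
  proof (intro equalityI subsetI)
    fix x assume "x \<in> {a. a \<in> dilate p b' A \<and> real_of_int a < real p / 2}"
    then obtain a where a: "a \<in> A" "x = (b * a) mod int p" "2 * x < int p" unfolding dil less by auto
    then have "smod (int p) (b * a) = x" by (simp add: smod_def)
    moreover have "0 < x" using rng(1)[of a] nz[OF a(1)] a(2) by simp
    ultimately show "x \<in> {x \<in> signed_dilate (int p) b A. 0 < x}" using a(1) by (force simp: signed_dilate_def)
  next
    fix x assume "x \<in> {x \<in> signed_dilate (int p) b A. 0 < x}"
    then obtain a where a: "a \<in> A" "x = smod (int p) (b * a)" "0 < x" by (auto simp: signed_dilate_def)
    then have "x = (b * a) mod int p" "2 * x < int p" using rng(2)[of a] by (auto simp: smod_def split: if_splits)
    then show "x \<in> {a. a \<in> dilate p b' A \<and> real_of_int a < real p / 2}" using a(1) unfolding dil less by auto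
  qed
  have "(\<Sum>a | a \<in> dilate p b' A \<and> real_of_int a < real p / 2. residue_norm p a)
      = (\<Sum>a | a \<in> dilate p b' A \<and> real_of_int a < real p / 2. a)"
    by (intro sum.cong) (auto simp: residue_norm_def less)
  then show "(\<Sum>a | a \<in> dilate p b' A \<and> real_of_int a < real p / 2. residue_norm p a)
      = \<Sum>{x \<in> signed_dilate (int p) b A. 0 < x}" unfolding eq1 .
  have eq2: "{x. x \<in> signed_dilate (int p) b A \<and> x < 0}
      = (\<lambda>a. a - int p) ` {a. a \<in> dilate p b' A \<and> real_of_int a > real p / 2}"
  proof (intro equalityI subsetI)
    fix x assume "x \<in> {x. x \<in> signed_dilate (int p) b A \<and> x < 0}"
    then obtain a where a: "a \<in> A" "x = smod (int p) (b * a)" "x < 0" by (auto simp: signed_dilate_def)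
    have "x = (b * a) mod int p - int p" "\<not> 2 * ((b * a) mod int p) < int p"
      using a rng(1)[of a] by (auto simp: smod_def split: if_splits)
    moreover have "2 * ((b * a) mod int p) \<noteq> int p"
    proof
      assume "2 * ((b * a) mod int p) = int p"
      then have "even (int p)" by (metis dvd_triv_left)
      then show False using odd by simp
    qed
    ultimately show "x \<in> (\<lambda>a. a - int p) ` {a. a \<in> dilate p b' A \<and> real_of_int a > real p / 2}"
      using a(1) unfolding dil gr by (intro image_eqI[of _ _ "(b * a) mod int p"]) auto
  next
    fix x assume "x \<in> (\<lambda>a. a - int p) ` {a. a \<in> dilate p b' A \<and> real_of_int a > real p / 2}"
    then obtain a where a: "a \<in> A" "x = (b * a) mod int p - int p" "2 * ((b * a) mod int p) > int p"
      unfolding dil gr by auto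
    then have "smod (int p) (b * a) = x" by (simp add: smod_def)
    moreover have "x < 0" using a(2) rng(2)[of a] by simp
    ultimately show "x \<in> {x. x \<in> signed_dilate (int p) b A \<and> x < 0}" using a(1) by (force simp: signed_dilate_def)
  qed
  have "(\<Sum>x | x \<in> signed_dilate (int p) b A \<and> x < 0. \<bar>x\<bar>)
      = (\<Sum>a | a \<in> dilate p b' A \<and> real_of_int a > real p / 2. \<bar>a - int p\<bar>)"
    unfolding eq2 by (subst sum.reindex) (auto simp: inj_on_def)
  also have "\<dots> = (\<Sum>a | a \<in> dilate p b' A \<and> real_of_int a > real p / 2. residue_norm p a)"
  proof (intro sum.cong refl)
    fix a assume "a \<in> {a. a \<in> dilate p b' A \<and> real_of_int a > real p / 2}"
    then have "a < int p" "2 * a > int p" unfolding dil gr using rng(2) by auto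
    then show "\<bar>a - int p\<bar> = residue_norm p a" by (simp add: residue_norm_def)
  qed
  finally show "(\<Sum>a | a \<in> dilate p b' A \<and> real_of_int a > real p / 2. residue_norm p a)
      = (\<Sum>x | x \<in> signed_dilate (int p) b A \<and> x < 0. \<bar>x\<bar>)" by simp
qed

theorem theorem1p9:
  shows "\<exists>(C::real) (p\<^sub>0::nat). \<forall>p::nat. prime p \<longrightarrow> p \<ge> p\<^sub>0 \<longrightarrow>
    (\<forall>A. A \<subseteq> carrier (Zmod p) \<longrightarrow> zero_sum_free p A \<longrightarrow>
       real (card A) \<ge> 0.99 * sqrt (2 * real p) \<longrightarrow>
       (\<exists>b \<in> carrier (Zmod p). b \<noteq> \<zero>\<^bsub>Zmod p\<^esub> \<and>
          real_of_int (\<Sum>a | a \<in> dilate p b A \<and> real_of_int a < real p / 2. residue_norm p a)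
            \<le> real p + C * sqrt (real p) \<and>
          real_of_int (\<Sum>a | a \<in> dilate p b A \<and> real_of_int a > real p / 2. residue_norm p a)
            \<le> C * sqrt (real p)))"
proof -
  obtain K :: real and p1 :: nat where K: "K \<ge> 1"
    and str: "\<forall>p A. prime p \<longrightarrow> p1 \<le> p \<longrightarrow> zsf (int p) A \<longrightarrow> inj_on (\<lambda>a. a mod int p) A \<longrightarrow>
     (14/10) * sqrt (real p) \<le> real (card A) \<longrightarrow>
     (\<exists>b P. \<not> int p dvd b \<and> P \<subseteq> signed_dilate (int p) b A \<and> (\<forall>x\<in>P. 0 < x \<and> real_of_int x \<le> K * sqrt (real p))
        \<and> (139/100) * sqrt (real p) \<le> real (card P) \<and> \<Sum>P < int p)"
    using ex_dilate_dense_positive_part by (elim exE conjE) (rule that)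
  define p0 where "p0 = p1 + 3 + nat \<lceil>(200 + 8 * K)\<^sup>2\<rceil>"
  show ?thesis
  \<comment> \<open>\<open>C = 1\<close> works because both error terms are bounded by the start
    \<open>u = 2 * h + 3\<close> of the interval, where \<open>h\<close> is at most 0.08 sqrt
    p.\<close>
  proof (rule exI[of _ 1], rule exI[of _ p0], intro allI impI)
    fix p :: nat and A :: "int set"
    assume p: "prime p" and pl: "p \<ge> p0" and A: "A \<subseteq> carrier (Zmod p)" and zf: "zero_sum_free p A"
      and cA: "real (card A) \<ge> 0.99 * sqrt (2 * real p)"
    define s where "s = sqrt (real p)"
    have p2: "p > 2" "p1 \<le> p" using pl by (auto simp: p0_def)
    have p1: "p > 1" using p2 by simp
    have p': "prime (int p)" using p by simp
    have oddp: "odd p" using p p2(1) prime_odd_nat by blast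
    interpret residues "int p" "Zmod p" using p1 by unfold_locales auto
    note z = zsf_of_zero_sum_free[OF p1 A zf]
    have s0: "s \<ge> 0" by (simp add: s_def)
    have sl: "200 + 8 * K \<le> s" unfolding s_def
    proof (rule real_le_rsqrt)
      have "(200 + 8 * K)\<^sup>2 \<le> real (nat \<lceil>(200 + 8 * K)\<^sup>2\<rceil>)" by (rule real_nat_ceiling_ge)
      also have "\<dots> \<le> real p" using pl by (simp add: p0_def)
      finally show "(200 + 8 * K)\<^sup>2 \<le> real p" .
    qed
    have sq2: "(14142/10000 :: real) \<le> sqrt 2" by (rule real_le_rsqrt) (simp add: power2_eq_square)
    \<comment> \<open>0.99 * 1.4142 is just above 1.4.\<close>
    have "(14/10) * s \<le> (99/100) * (14142/10000 * s)" using s0 by simp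
    also have "\<dots> \<le> (99/100) * (sqrt 2 * s)" using sq2 s0 by (intro mult_left_mono mult_right_mono) auto
    also have "\<dots> \<le> real (card A)" using cA by (simp add: s_def real_sqrt_mult)
    finally have cA': "(14/10) * sqrt (real p) \<le> real (card A)" by (simp only: s_def)
    obtain b P where b: "\<not> int p dvd b" and P: "P \<subseteq> signed_dilate (int p) b A"
      "\<forall>x\<in>P. 0 < x \<and> real_of_int x \<le> K * s" "(139/100) * s \<le> real (card P)" "\<Sum>P < int p"
      using str[rule_format, OF p p2(2) z cA'] unfolding s_def[symmetric] by (elim exE conjE) (rule that)
    let ?S = "signed_dilate (int p) b A"
    have zS: "zsf (int p) ?S" by (rule zsf_signed_dilate[OF p' b z])
    have bS: "2 * \<bar>x\<bar> \<le> int p" if x: "x \<in> ?S" for x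
    proof -
      obtain a where "x = smod (int p) (b * a)" using x unfolding signed_dilate_def by blast
      then show ?thesis using smod_bounds[of "int p" "b * a"] p1 by linarith
    qed
    have "p > 0" "200 \<le> s" "8 * K \<le> s" using p1 sl K by auto
    note bounds = sums_bounded_of_dense_part[OF zS this(1) s_def bS P(1) bspec[OF P(2)] P(3,4) this(2,3)]
    have bc: "b mod int p \<in> carrier (Zmod p)" unfolding res_carrier_eq using p1 by auto
    have bn: "b mod int p \<noteq> \<zero>\<^bsub>Zmod p\<^esub>" using b by (simp add: res_zero_eq dvd_eq_mod_eq_0)
    show "\<exists>b \<in> carrier (Zmod p). b \<noteq> \<zero>\<^bsub>Zmod p\<^esub> \<and>
          real_of_int (\<Sum>a | a \<in> dilate p b A \<and> real_of_int a < real p / 2. residue_norm p a)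
            \<le> real p + 1 * sqrt (real p) \<and>
          real_of_int (\<Sum>a | a \<in> dilate p b A \<and> real_of_int a > real p / 2. residue_norm p a)
            \<le> 1 * sqrt (real p)"
    proof (rule bexI[OF _ bc], intro conjI bn)
      show "real_of_int (\<Sum>a | a \<in> dilate p (b mod int p) A \<and> real_of_int a < real p / 2. residue_norm p a)
            \<le> real p + 1 * sqrt (real p)"
        unfolding dilate_norm_sums(1)[OF p1 oddp A zS] using bounds(1) by (simp only: s_def mult_1)
      show "real_of_int (\<Sum>a | a \<in> dilate p (b mod int p) A \<and> real_of_int a > real p / 2. residue_norm p a)
            \<le> 1 * sqrt (real p)"
        unfolding dilate_norm_sums(2)[OF p1 oddp A zS] using bounds(2) by (simp only: s_def mult_1)
    qed
  qed
qed

end
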